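(* Fix any $\Delta\ge3$, any integer $q\ge 3$ and any $p_0<1$. There exist $p\in(p_0,1)$ and a sequence of graphs $G_n$ on $n$ vertices with maximum degree $\Delta$ such that the mixing times of the Swendsen--Wang dynamics (at parameter $p$ with $q$ colors) and of the FK dynamics (at parameters $(p,q)$) on $G_n$ are both $\exp(\Omega(n))$.
   Context: Random-cluster model. For a finite graph $G=(V(G),E(G))$, $p\in(0,1)$, $q>0$: $\pi_{G,p,q}(\omega)\propto p^{|\omega|}(1-p)^{|E(G)|-|\omega|}q^{k(\omega)}$ for $\omega\subseteq E(G)$, where $k(\omega)$ is the number of connected components of $(V(G),\omega)$. FK dynamics (discrete time). From $E_t\subseteq E(G)$: pick $e\in E(G)$ uniformly at random; set $E_{t+1}=E_t\cup\{e\}$ with probability $p$ if $e$ is not a cut-edge in $E_t$, and with probability $\hat p=\frac{p}{p+(1-p)q}$ if $e$ is a cut-edge in $E_t$; otherwise $E_{t+1}=E_t\setminus\{e\}$. An edge $e$ is a cut-edge in $\omega$ if $\omega\cup\{e\}$ and $\omega\setminus\{e\}$ have different numbers of connected components. Its stationary distribution is $\pi_{G,p,q}$. Swendsen--Wang dynamics (integer $q\ge2$). State space $\{1,\dots,q\}^{V(G)}$. From $\sigma_t$: independently for each $e=\{u,v\}\in E(G)$ with $\sigma_t(u)=\sigma_t(v)$ include $e$ in $E_t$ with probability $p$; then independently for each connected component $\mathcal C$ of $(V(G),E_t)$ draw a uniform color $c\in\{1,\dots,q\}$ and set $\sigma_{t+1}(v)=c$ for all $v\in\mathcal C$. Its stationary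 distribution is the Potts measure $\mu(\sigma)\propto\exp(\beta\sum_{\{u,v\}\in E(G)}\mathbf 1\{\sigma(u)=\sigma(v)\})$ with $p=1-e^{-\beta}$. Mixing time: the smallest $k$ such that, from every initial state, the law after $k$ steps is within total-variation distance $1/4$ of the stationary distribution. *)

theory Defs
  imports "HOL-Probability.Probability"
begin

definition simple_graph :: "'a set \<Rightarrow> 'a set set \<Rightarrow> bool" where
  "simple_graph V E \<longleftrightarrow> finite V \<and> (\<forall>e\<in>E. e \<subseteq> V \<and> card e = 2)"

definition vertex_degree :: "'a set set \<Rightarrow> 'a \<Rightarrow> nat" where
  "vertex_degree E v = card {e \<in> E. v \<in> e}"

definition max_degree :: "'a set \<Rightarrow> 'a set set \<Rightarrow> nat" where
  "max_degree V E = Max (vertex_degree E ` V)"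

definition connection :: "'a set \<Rightarrow> 'a set set \<Rightarrow> ('a \<times> 'a) set" where
  "connection V \<omega> = {(u, v) \<in> V \<times> V. (u, v) \<in> {(x, y). {x, y} \<in> \<omega>}\<^sup>*}"

definition clusters :: "'a set \<Rightarrow> 'a set set \<Rightarrow> 'a set set" where
  "clusters V \<omega> = V // connection V \<omega>"

definition cut_edge :: "'a set \<Rightarrow> 'a set set \<Rightarrow> 'a set \<Rightarrow> bool" where
  "cut_edge V \<omega> e \<longleftrightarrow>
     card (clusters V (insert e \<omega>)) \<noteq> card (clusters V (\<omega> - {e}))"

text \<open>The probability measure on a finite nonempty set \<open>S\<close> proportional to a positive weight \<open>w\<close>.\<close>
definition gibbs_pmf :: "'s set \<Rightarrow> ('s \<Rightarrow> real) \<Rightarrow> 's pmf" where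
  "gibbs_pmf S w = embed_pmf (\<lambda>x. if x \<in> S then w x / (\<Sum>y\<in>S. w y) else 0)"

definition random_cluster :: "'a set \<Rightarrow> 'a set set \<Rightarrow> real \<Rightarrow> real \<Rightarrow> 'a set set pmf" where
  "random_cluster V E p q = gibbs_pmf (Pow E)
     (\<lambda>\<omega>. p ^ card \<omega> * (1 - p) ^ (card E - card \<omega>) * q ^ card (clusters V \<omega>))"

definition fk_step ::
  "'a set \<Rightarrow> 'a set set \<Rightarrow> real \<Rightarrow> real \<Rightarrow> 'a set set \<Rightarrow> 'a set set pmf" where
  "fk_step V E p q \<omega> =
     do {
       e \<leftarrow> pmf_of_set E;
       b \<leftarrow> bernoulli_pmf (if cut_edge V \<omega> e then p / (p + (1 - p) * q) else p);
       return_pmf (if b then insert e \<omega> else \<omega> - {e})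
     }"

text \<open>Colourings are extended by \<open>undefined\<close> outside \<open>V\<close>, so that they form a finite set.\<close>
definition colourings :: "'a set \<Rightarrow> nat \<Rightarrow> ('a \<Rightarrow> nat) set" where
  "colourings V q = V \<rightarrow>\<^sub>E {1..q}"

definition monochromatic :: "'a set set \<Rightarrow> ('a \<Rightarrow> nat) \<Rightarrow> 'a set set" where
  "monochromatic E \<sigma> = {e \<in> E. \<forall>u\<in>e. \<forall>v\<in>e. \<sigma> u = \<sigma> v}"

definition potts :: "'a set \<Rightarrow> 'a set set \<Rightarrow> real \<Rightarrow> nat \<Rightarrow> ('a \<Rightarrow> nat) pmf" where
  "potts V E \<beta> q = gibbs_pmf (colourings V q) (\<lambda>\<sigma>. exp (\<beta> * real (card (monochromatic E \<sigma>))))"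

text \<open>The second argument of \<^const>\<open>Pi_pmf\<close> is only the value taken off the index set; it is
  never used below.\<close>
definition sw_step ::
  "'a set \<Rightarrow> 'a set set \<Rightarrow> real \<Rightarrow> nat \<Rightarrow> ('a \<Rightarrow> nat) \<Rightarrow> ('a \<Rightarrow> nat) pmf" where
  "sw_step V E p q \<sigma> =
     do {
       b \<leftarrow> Pi_pmf (monochromatic E \<sigma>) False (\<lambda>_. bernoulli_pmf p);
       let \<omega> = {e \<in> monochromatic E \<sigma>. b e};
       c \<leftarrow> Pi_pmf (clusters V \<omega>) 0 (\<lambda>_. pmf_of_set {1..q});
       return_pmf (\<lambda>v\<in>V. c (connection V \<omega> `` {v}))
     }"

definition tv_dist :: "'s pmf \<Rightarrow> 's pmf \<Rightarrow> real" where
  "tv_dist \<mu> \<nu> = (SUP A. \<bar>measure_pmf.prob \<mu> A - measure_pmf.prob \<nu> A\<bar>)"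

definition law_after :: "('s \<Rightarrow> 's pmf) \<Rightarrow> nat \<Rightarrow> 's \<Rightarrow> 's pmf" where
  "law_after K k x = ((\<lambda>\<mu>. bind_pmf \<mu> K) ^^ k) (return_pmf x)"

text \<open>The smallest \<open>k\<close> in question, with the usual convention \<open>\<infinity>\<close> if there is none; for the two
  chains here (with \<open>0 < p < 1\<close>) it is finite by ergodicity.\<close>
definition mixing_time :: "'s set \<Rightarrow> ('s \<Rightarrow> 's pmf) \<Rightarrow> 's pmf \<Rightarrow> enat" where
  "mixing_time S K \<pi> = (INF k \<in> {k. \<forall>x\<in>S. tv_dist (law_after K k x) \<pi> \<le> 1 / 4}. enat k)"

definition fk_mixing_time :: "'a set \<Rightarrow> 'a set set \<Rightarrow> real \<Rightarrow> real \<Rightarrow> enat" where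
  "fk_mixing_time V E p q = mixing_time (Pow E) (fk_step V E p q) (random_cluster V E p q)"

text \<open>The inverse temperature is the solution \<open>\<beta>\<close> of \<open>p = 1 - exp (-\<beta>)\<close>.\<close>
definition sw_mixing_time :: "'a set \<Rightarrow> 'a set set \<Rightarrow> real \<Rightarrow> nat \<Rightarrow> enat" where
  "sw_mixing_time V E p q =
     mixing_time (colourings V q) (sw_step V E p q) (potts V E (- ln (1 - p)) q)"

text \<open>\<open>T n = exp (\<Omega>(n))\<close>, a lower bound on the growth of \<open>T\<close>.\<close>
definition exp_Omega :: "(nat \<Rightarrow> enat) \<Rightarrow> bool" where
  "exp_Omega T \<longleftrightarrow>
     (\<exists>c>0. \<forall>\<^sub>F n in sequentially. ereal (exp (c * real n)) \<le> ereal_of_enat (T n))"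

end

theory Submission
  imports Defs "HOL-Real_Asymp.Real_Asymp"
begin

text \<open>
  A set \<open>A\<close> of edge configurations with \<open>\<pi>(A) \<le> 1/2\<close> whose edge boundary (the members that leave
  \<open>A\<close> when a single edge is changed) is exponentially lighter than \<open>A\<close> slows down both chains. For
  the FK dynamics this is the usual conductance argument. A step of the Swendsen--Wang dynamics is,
  on pairs of a colouring and a configuration, a sequence of resamplings of single edges given the
  colouring, followed by a recolouring; each of these preserves the joint law, and only a resampling
  can leave \<open>A\<close>, through its edge boundary.

  Such a set exists for mean-field couplings because the transition is of first order for \<open>q \<ge> 3\<close>.
  Take a multigraph on \<open>N\<close> vertices with \<open>M = D N\<close> independent uniform edges of weight \<open>w\<close>, where
  \<open>D ln (1 + w) = b\<close> lies strictly between the critical value \<open>(q - 1) ln (q - 1) / (q - 2)\<close> and the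
  value \<open>q / 2\<close> at which the uniform colour frequencies stop being a local maximum of the free energy,
  and let \<open>A\<close> consist of the configurations all of whose clusters have at most \<open>x N\<close> vertices. A
  configuration with a cluster of intermediate size has, with constant probability, a colouring with
  frequencies at intermediate distance from the uniform ones, which costs an exponential factor.
  Adding the edges one at a time, this also shows that the weight of \<open>A\<close> is at least
  \<open>q ^ N (1 + w / q) ^ M / 2\<close>, and the Gibbs variational principle with the frequencies
  \<open>(q - 1) / q, 1 / (q (q - 1)), \<dots>\<close> shows that the total weight is exponentially larger.

  For a graph of maximum degree \<open>\<Delta>\<close> and \<open>p\<close> close to \<open>1\<close>, replace every vertex by a tree of
  degree at most \<open>3\<close> and every edge by a path of length \<open>l\<close>. A path acts as an edge of weight
  \<open>q / ((1 + t) ^ l - 1)\<close> with \<open>t = q (1 - p) / p\<close>, which is \<open>w\<close> for some \<open>p\<close> tending to \<open>1\<close> as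
  \<open>l\<close> grows, while closed tree edges only cost a factor \<open>1 + t\<close> per tree edge.
\<close>

section \<open>Compatible colourings\<close>

text \<open>Cluster counts are replaced throughout by counts of compatible colourings, of which
  there are q to the number of clusters. One notion then serves the graph, the multigraph and the
  contracted trees, and every comparison rests on one fact: a further constraint divides the count
  by at most q.

  The bottleneck has to be a set of edge configurations, although the phases are described by colour
  frequencies. Cluster sizes and frequencies translate into each other only up to constants, hence
  the windows from (x / 6)^2 to \<theta> for the imbalance and from x / 3 to x for cluster sizes.

  The frequency estimates only bound weights from above, while the weight of A needs a lower bound.
  Building the multigraph edge by edge supplies it, at the price that pseudorandomness must hold for
  every prefix of the edge list.

  Since p is fixed before n, the density D, the weight w and the mean-field rate c are chosen before
  the path length l: the 2 D N tree edges at path ends cost exp(2 D N h / l) with h = ln (1 + q /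
  w), which a large l makes smaller than the gain exp(c N).\<close>

definition compat :: "'a set \<Rightarrow> nat \<Rightarrow> ('a \<times> 'a) set \<Rightarrow> ('a \<Rightarrow> nat) set" where
  "compat V q R = {\<sigma> \<in> colourings V q. \<forall>(u, v)\<in>R. \<sigma> u = \<sigma> v}"

lemma finite_colourings [simp]: "finite V \<Longrightarrow> finite (colourings V q)"
  unfolding colourings_def by (intro finite_PiE) auto

lemma finite_compat [simp]: "finite V \<Longrightarrow> finite (compat V q R)"
  unfolding compat_def by simp

lemma compat_empty [simp]: "compat V q {} = colourings V q"
  by (simp add: compat_def)

lemma compat_mono: "R \<subseteq> R' \<Longrightarrow> compat V q R' \<subseteq> compat V q R"
  by (auto simp: compat_def)

lemma compat_insert: "compat V q (insert (u, v) R) = {\<sigma> \<in> compat V q R. \<sigma> u = \<sigma> v}"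
  by (auto simp: compat_def)

lemma compat_ne: "q > 0 \<Longrightarrow> R \<subseteq> V \<times> V \<Longrightarrow> compat V q R \<noteq> {}"
proof -
  assume "q > 0" "R \<subseteq> V \<times> V"
  then have "(\<lambda>v\<in>V. 1) \<in> compat V q R"
    by (auto simp: compat_def colourings_def)
  then show ?thesis by blast
qed

text \<open>Modulo \<open>q\<close> the compatible colourings form a group, and the colourings with a given value of
  \<open>\<sigma> u - \<sigma> v\<close> are a coset of the subgroup defined by the additional constraint.\<close>
lemma card_compat_insert:
  assumes fin: "finite V" and R: "R \<subseteq> V \<times> V" and uv: "u \<in> V" "v \<in> V"
  shows "card (compat V q R) \<le> q * card (compat V q (insert (u, v) R))"
proof -
  \<comment> \<open>Colours lie in {1..q}, so adding q first makes the subtraction of naturals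
    exact; the colour q stands for the residue 0.\<close>
  define d where "d \<sigma> = (\<sigma> u + q - \<sigma> v) mod q" for \<sigma> :: "'a \<Rightarrow> nat"
  define C where "C = compat V q R"
  define C' where "C' = compat V q (insert (u, v) R)"
  have finC: "finite C" "finite C'" using fin by (auto simp: C_def C'_def)
  show ?thesis
  proof (cases "q = 0")
    case True
    have "C = {}" unfolding C_def compat_def colourings_def using True uv by (auto simp: PiE_iff)
    then show ?thesis using C_def by simp
  next
    case False
    have rng: "1 \<le> \<sigma> x \<and> \<sigma> x \<le> q" if "\<sigma> \<in> C" "x \<in> V" for \<sigma> x
      using that by (auto simp: C_def compat_def colourings_def PiE_iff)
    have outside: "\<sigma> x = undefined" if "\<sigma> \<in> C" "x \<notin> V" for \<sigma> x
      using that by (auto simp: C_def compat_def colourings_def PiE_iff extensional_def)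
    have inj1: "s = t" if "(s + q - m) mod q = (t + q - m) mod q" "1 \<le> s" "s \<le> q" "1 \<le> t" "t \<le> q"
        "1 \<le> m" "m \<le> q" for s t m :: nat
    proof -
      have "((s + q - m) + m) mod q = ((t + q - m) + m) mod q"
        using that(1) by (rule mod_add_cong) simp
      then have "s mod q = t mod q" using that by simp
      then show ?thesis using that by (cases "s = q"; cases "t = q") auto
    qed
    have fib: "card {\<sigma> \<in> C. d \<sigma> = k} \<le> card C'" for k
    proof (cases "{\<sigma> \<in> C. d \<sigma> = k} = {}")
      case True
      then show ?thesis by (metis card.empty le0)
    next
      case False
      then obtain \<rho> where \<rho>: "\<rho> \<in> C" "d \<rho> = k" by auto
      \<comment> \<open>Subtracting a fixed member \<rho> of the same coset gives equal values at u
        and v; the final + 1 moves residues back into {1..q}.\<close>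
      define \<phi> where "\<phi> \<sigma> = (\<lambda>x\<in>V. (\<sigma> x + q - \<rho> x) mod q + 1)" for \<sigma>
      have "inj_on \<phi> {\<sigma> \<in> C. d \<sigma> = k}"
      proof (rule inj_onI, rule ext)
        fix \<sigma> \<tau> x assume a: "\<sigma> \<in> {\<sigma> \<in> C. d \<sigma> = k}" "\<tau> \<in> {\<sigma> \<in> C. d \<sigma> = k}" and e: "\<phi> \<sigma> = \<phi> \<tau>"
        show "\<sigma> x = \<tau> x"
        proof (cases "x \<in> V")
          case True
          have "(\<sigma> x + q - \<rho> x) mod q = (\<tau> x + q - \<rho> x) mod q"
            using fun_cong[OF e, of x] True by (simp add: \<phi>_def)
          moreover have "\<sigma> \<in> C" "\<tau> \<in> C" using a by auto
          ultimately show ?thesis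
            using rng[of \<sigma> x] rng[of \<tau> x] rng[of \<rho> x] True \<rho>(1) by (intro inj1[of "\<sigma> x" "\<rho> x"]) auto
        next
          case False
          then show ?thesis using outside[of \<sigma> x] outside[of \<tau> x] a by auto
        qed
      qed
      moreover have "\<phi> ` {\<sigma> \<in> C. d \<sigma> = k} \<subseteq> C'"
      proof safe
        fix \<sigma> assume s: "\<sigma> \<in> C" and k: "k = d \<sigma>"
        have "((\<sigma> u + q - \<sigma> v) + (\<sigma> v + q - \<rho> u)) mod q = ((\<rho> u + q - \<rho> v) + (\<sigma> v + q - \<rho> u)) mod q"
          using \<rho>(2) k by (intro mod_add_cong) (auto simp: d_def)
        moreover have "(\<sigma> u + q - \<sigma> v) + (\<sigma> v + q - \<rho> u) = (\<sigma> u + q - \<rho> u) + q"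
          using rng[OF s uv(1)] rng[OF s uv(2)] rng[OF \<rho>(1) uv(1)] rng[OF \<rho>(1) uv(2)] by simp
        moreover have "(\<rho> u + q - \<rho> v) + (\<sigma> v + q - \<rho> u) = (\<sigma> v + q - \<rho> v) + q"
          using rng[OF s uv(1)] rng[OF s uv(2)] rng[OF \<rho>(1) uv(1)] rng[OF \<rho>(1) uv(2)] by simp
        ultimately have "(\<sigma> u + q - \<rho> u) mod q = (\<sigma> v + q - \<rho> v) mod q"
          by simp
        then have "\<phi> \<sigma> u = \<phi> \<sigma> v" using uv by (simp add: \<phi>_def)
        moreover have "\<phi> \<sigma> x = \<phi> \<sigma> y" if "(x, y) \<in> R" for x y
        proof -
          have "\<sigma> x = \<sigma> y" "\<rho> x = \<rho> y" "x \<in> V" "y \<in> V"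
            using that s \<rho> R by (auto simp: C_def compat_def)
          then show ?thesis by (simp add: \<phi>_def)
        qed
        moreover have "\<phi> \<sigma> \<in> colourings V q"
          using \<open>q \<noteq> 0\<close> by (auto simp: \<phi>_def colourings_def Suc_le_eq)
        ultimately show "\<phi> \<sigma> \<in> C'" by (auto simp: C'_def compat_def)
      qed
      ultimately show ?thesis using finC by (intro card_inj_on_le) auto
    qed
    have "C = (\<Union>k<q. {\<sigma> \<in> C. d \<sigma> = k})" using False by (auto simp: d_def)
    then have "card C \<le> (\<Sum>k<q. card {\<sigma> \<in> C. d \<sigma> = k})"
      using card_UN_le[of "{..<q}" "\<lambda>k. {\<sigma> \<in> C. d \<sigma> = k}"] by simp
    also have "\<dots> \<le> (\<Sum>k<q. card C')" by (intro sum_mono fib)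
    finally show ?thesis by (simp add: C_def C'_def)
  qed
qed

lemma compat_rtrancl:
  assumes "\<sigma> \<in> compat V q R" "(u, v) \<in> R\<^sup>*"
  shows "\<sigma> u = \<sigma> v"
  using assms(2,1) by (induction) (auto simp: compat_def)

lemma compat_recolour:
  assumes "\<sigma> \<in> compat V q R" "sym R" "R \<subseteq> V \<times> V" "u \<in> V" "c \<in> {1..q}"
  shows "(\<lambda>x. if (u, x) \<in> R\<^sup>* then c else \<sigma> x) \<in> compat V q R"
proof -
  have in_V: "x \<in> V" if "(u, x) \<in> R\<^sup>*" for x
    using that assms(3,4) by induction auto
  have "(u, x) \<in> R\<^sup>* \<longleftrightarrow> (u, y) \<in> R\<^sup>*" if "(x, y) \<in> R" for x y
    using that assms(2) by (meson rtrancl.rtrancl_into_rtrancl symD)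
  then show ?thesis using assms(1,5) in_V
    by (auto simp: compat_def colourings_def PiE_iff extensional_def)
qed

text \<open>The class of u may be given any of the q colours; the untouched colour of v still tells
  the original colour of u, so nothing is lost. Hence unconnected vertices agree in at most 1 / q of
  the colourings.\<close>

lemma card_compat_insert_unconnected:
  assumes fin: "finite V" and R: "R \<subseteq> V \<times> V" "sym R" and uv: "u \<in> V" "v \<in> V" "(u, v) \<notin> R\<^sup>*"
  shows "q * card (compat V q (insert (u, v) R)) \<le> card (compat V q R)"
proof -
  define \<phi> where "\<phi> = (\<lambda>(\<sigma> :: 'a \<Rightarrow> nat, c). (\<lambda>x. if (u, x) \<in> R\<^sup>* then c else \<sigma> x))"
  have "inj_on \<phi> (compat V q (insert (u, v) R) \<times> {1..q})"
  proof (rule inj_onI, clarify)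
    fix \<sigma> c \<tau> c' assume s: "\<sigma> \<in> compat V q (insert (u, v) R)" and t: "\<tau> \<in> compat V q (insert (u, v) R)"
      and e: "\<phi> (\<sigma>, c) = \<phi> (\<tau>, c')"
    have c: "c = c'" using fun_cong[OF e, of u] by (simp add: \<phi>_def)
    have "\<sigma> v = \<tau> v" using fun_cong[OF e, of v] uv by (simp add: \<phi>_def)
    then have uu: "\<sigma> u = \<tau> u" using s t by (simp add: compat_insert)
    have s': "\<sigma> \<in> compat V q R" and t': "\<tau> \<in> compat V q R" using s t by (auto simp: compat_insert)
    have "\<sigma> x = \<tau> x" for x
    proof (cases "(u, x) \<in> R\<^sup>*")
      case True
      then show ?thesis using compat_rtrancl[OF s' True] compat_rtrancl[OF t' True] uu by simp
    next
      case False
      then show ?thesis using fun_cong[OF e, of x] by (simp add: \<phi>_def)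
    qed
    then show "\<sigma> = \<tau> \<and> c = c'" using c by auto
  qed
  moreover have "\<phi> ` (compat V q (insert (u, v) R) \<times> {1..q}) \<subseteq> compat V q R"
    using compat_recolour[of _ V q R u] R uv by (auto simp: \<phi>_def compat_insert)
  ultimately have "card (compat V q (insert (u, v) R) \<times> {1..q}) \<le> card (compat V q R)"
    using fin by (intro card_inj_on_le) auto
  then show ?thesis by (simp add: card_cartesian_product mult.commute)
qed

section \<open>Clusters and their colourings\<close>

definition edge_rel :: "'a set set \<Rightarrow> ('a \<times> 'a) set" where
  "edge_rel \<omega> = {(x, y). {x, y} \<in> \<omega>}"

lemma sym_edge_rel: "sym (edge_rel \<omega>)"
  by (auto simp: sym_def edge_rel_def insert_commute)

lemma equiv_connection: "equiv V (connection V \<omega>)"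
proof -
  have "sym ((edge_rel \<omega>)\<^sup>*)" using sym_edge_rel by (rule sym_rtrancl)
  then show ?thesis
    unfolding connection_def edge_rel_def[symmetric]
    by (auto simp: equiv_def refl_on_def sym_def trans_def)
qed

lemma finite_clusters: "finite V \<Longrightarrow> finite (clusters V \<omega>)"
  unfolding clusters_def by (rule finite_quotient) (auto simp: connection_def)

lemma compat_edge_rel_iff:
  assumes "\<forall>e\<in>\<omega>. e \<subseteq> V \<and> card e = 2"
  shows "\<sigma> \<in> compat V q (edge_rel \<omega>) \<longleftrightarrow> \<sigma> \<in> colourings V q \<and> (\<forall>e\<in>\<omega>. \<forall>u\<in>e. \<forall>v\<in>e. \<sigma> u = \<sigma> v)"
proof -
  have "(\<forall>(u, v)\<in>edge_rel \<omega>. \<sigma> u = \<sigma> v) \<longleftrightarrow> (\<forall>e\<in>\<omega>. \<forall>u\<in>e. \<forall>v\<in>e. \<sigma> u = \<sigma> v)"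
  proof safe
    fix e u v assume h: "\<forall>(u, v)\<in>edge_rel \<omega>. \<sigma> u = \<sigma> v" "e \<in> \<omega>" "u \<in> e" "v \<in> e"
    have "card e = 2" using assms h(2) by auto
    then obtain x y where "e = {x, y}" by (auto simp: card_2_iff)
    then show "\<sigma> u = \<sigma> v" using h by (auto simp: edge_rel_def)
  next
    fix u v assume h: "\<forall>e\<in>\<omega>. \<forall>u\<in>e. \<forall>v\<in>e. \<sigma> u = \<sigma> v" "(u, v) \<in> edge_rel \<omega>"
    then show "\<sigma> u = \<sigma> v" by (auto simp: edge_rel_def)
  qed
  then show ?thesis by (auto simp: compat_def)
qed

text \<open>A compatible colouring is constant on clusters, so it amounts to one colour per cluster.
  The default 0 is the one \<open>sw_step\<close> uses off the clusters, so the bijection serves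
  both the count of colourings and the law of the recolouring.\<close>

lemma bij_betw_cluster_colouring:
  assumes "\<forall>e\<in>\<omega>. e \<subseteq> V"
  shows "bij_betw (\<lambda>c. \<lambda>v\<in>V. c (connection V \<omega> `` {v})) (PiE_dflt (clusters V \<omega>) 0 (\<lambda>_. {1..q}))
           (compat V q (edge_rel \<omega>))"
proof -
  have eq: "equiv V (connection V \<omega>)" by (rule equiv_connection)
  have cl: "connection V \<omega> `` {v} \<in> clusters V \<omega>" if "v \<in> V" for v
    using that by (simp add: clusters_def quotientI)
  have ex: "\<exists>v\<in>V. X = connection V \<omega> `` {v}" if "X \<in> clusters V \<omega>" for X
    using that by (auto simp: clusters_def quotient_def)
  have conn: "(u, v) \<in> connection V \<omega> \<Longrightarrow> connection V \<omega> `` {u} = connection V \<omega> `` {v}" for u v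
    by (rule equiv_class_eq[OF eq])
  show ?thesis
    unfolding bij_betw_def
  proof (intro conjI equalityI subsetI)
    show "inj_on (\<lambda>c. \<lambda>v\<in>V. c (connection V \<omega> `` {v})) (PiE_dflt (clusters V \<omega>) 0 (\<lambda>_. {1..q}))"
    proof (rule inj_onI)
      fix c c' assume c: "c \<in> PiE_dflt (clusters V \<omega>) 0 (\<lambda>_. {1..q})" "c' \<in> PiE_dflt (clusters V \<omega>) 0 (\<lambda>_. {1..q})"
        and e: "(\<lambda>v\<in>V. c (connection V \<omega> `` {v})) = (\<lambda>v\<in>V. c' (connection V \<omega> `` {v}))"
      show "c = c'"
      proof
        fix X
        show "c X = c' X"
        proof (cases "X \<in> clusters V \<omega>")
          case True
          then obtain v where "v \<in> V" "X = connection V \<omega> `` {v}" using ex by blast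
          then show ?thesis using fun_cong[OF e, of v] by simp
        next
          case False
          then show ?thesis using c by (auto simp: PiE_dflt_def)
        qed
      qed
    qed
  next
    fix \<sigma> assume "\<sigma> \<in> (\<lambda>c. \<lambda>v\<in>V. c (connection V \<omega> `` {v})) ` (PiE_dflt (clusters V \<omega>) 0 (\<lambda>_. {1..q}))"
    then obtain c where c: "c \<in> PiE_dflt (clusters V \<omega>) 0 (\<lambda>_. {1..q})" and s: "\<sigma> = (\<lambda>v\<in>V. c (connection V \<omega> `` {v}))"
      by blast
    have "\<sigma> u = \<sigma> v" if "(u, v) \<in> edge_rel \<omega>" for u v
    proof -
      have uv: "u \<in> V" "v \<in> V" using that assms by (auto simp: edge_rel_def)
      have "(u, v) \<in> connection V \<omega>" using that uv by (auto simp: connection_def edge_rel_def)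
      then show ?thesis using conn[of u v] uv by (simp add: s)
    qed
    moreover have "\<sigma> \<in> colourings V q" using c cl by (auto simp: s colourings_def PiE_dflt_def)
    ultimately show "\<sigma> \<in> compat V q (edge_rel \<omega>)" by (auto simp: compat_def)
  next
    fix \<sigma> assume s: "\<sigma> \<in> compat V q (edge_rel \<omega>)"
    define c where "c = (\<lambda>X. if X \<in> clusters V \<omega> then \<sigma> (SOME v. v \<in> X) else 0)"
    have in_V: "X \<subseteq> V" if "X \<in> clusters V \<omega>" for X
      using that by (auto simp: clusters_def quotient_def connection_def)
    have ne: "X \<noteq> {}" if "X \<in> clusters V \<omega>" for X
      using that in_quotient_imp_non_empty[OF eq] by (auto simp: clusters_def)
    have some: "(SOME v. v \<in> X) \<in> X" if "X \<in> clusters V \<omega>" for X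
      using ne[OF that] by (simp add: some_in_eq)
    have "c \<in> PiE_dflt (clusters V \<omega>) 0 (\<lambda>_. {1..q})"
      using s some in_V by (fastforce simp: c_def compat_def colourings_def PiE_iff PiE_dflt_def)
    moreover have "\<sigma> = (\<lambda>v\<in>V. c (connection V \<omega> `` {v}))"
    proof
      fix v
      show "\<sigma> v = (\<lambda>v\<in>V. c (connection V \<omega> `` {v})) v"
      proof (cases "v \<in> V")
        case True
        let ?X = "connection V \<omega> `` {v}"
        have m: "(v, SOME v. v \<in> ?X) \<in> connection V \<omega>" using some[OF cl[OF True]] by simp
        have "\<sigma> x = \<sigma> y" if "(x, y) \<in> connection V \<omega>" for x y
        proof -
          have "(x, y) \<in> (edge_rel \<omega>)\<^sup>*" using that by (auto simp: connection_def edge_rel_def)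
          then show ?thesis using compat_rtrancl[OF s] by blast
        qed
        then show ?thesis using m True cl[OF True] in_V some by (auto simp: c_def)
      next
        case False
        then show ?thesis using s by (auto simp: compat_def colourings_def PiE_iff extensional_def)
      qed
    qed
    ultimately show "\<sigma> \<in> (\<lambda>c. \<lambda>v\<in>V. c (connection V \<omega> `` {v})) ` (PiE_dflt (clusters V \<omega>) 0 (\<lambda>_. {1..q}))" by blast
  qed
qed

lemma card_compat_edge_rel:
  assumes "finite V" "\<forall>e\<in>\<omega>. e \<subseteq> V"
  shows "card (compat V q (edge_rel \<omega>)) = q ^ card (clusters V \<omega>)"
  using bij_betw_same_card[OF bij_betw_cluster_colouring[OF assms(2), of q]] finite_clusters[OF assms(1)]
  by (simp add: card_PiE_dflt)

section \<open>Finitely supported kernels\<close>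

lemma pmf_gibbs:
  assumes "finite S" "S \<noteq> {}" "\<And>x. x \<in> S \<Longrightarrow> w x > 0"
  shows "pmf (gibbs_pmf S w) x = (if x \<in> S then w x / sum w S else 0)"
proof -
  have pos: "sum w S > 0" using assms by (intro sum_pos) auto
  have nn: "0 \<le> (if x \<in> S then w x / sum w S else 0)" for x
    using pos assms(3)[of x] by (auto simp: zero_le_divide_iff intro: less_imp_le)
  have "(\<integral>\<^sup>+x. ennreal (if x \<in> S then w x / sum w S else 0) \<partial>count_space UNIV) =
        (\<Sum>x\<in>S. ennreal (if x \<in> S then w x / sum w S else 0))"
    using assms(1) by (intro nn_integral_count_space') auto
  also have "\<dots> = ennreal (\<Sum>x\<in>S. if x \<in> S then w x / sum w S else 0)"
    by (rule sum_ennreal) (rule nn)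
  also have "(\<Sum>x\<in>S. if x \<in> S then w x / sum w S else 0) = 1"
    using pos by (simp flip: sum_divide_distrib)
  finally have tot: "(\<integral>\<^sup>+x. ennreal (if x \<in> S then w x / sum w S else 0) \<partial>count_space UNIV) = 1" by simp
  show ?thesis
    unfolding gibbs_pmf_def by (rule pmf_embed_pmf[OF nn tot])
qed

lemma set_pmf_gibbs:
  assumes "finite S" "S \<noteq> {}" "\<And>x. x \<in> S \<Longrightarrow> w x > 0"
  shows "set_pmf (gibbs_pmf S w) = S"
proof -
  have pos: "sum w S > 0" using assms by (intro sum_pos) auto
  have "w x / sum w S \<noteq> 0" if "x \<in> S" for x using pos assms(3)[OF that] by simp
  then show ?thesis by (auto simp: set_pmf_eq pmf_gibbs[OF assms])
qed

lemma prob_gibbs: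
  assumes "finite S" "S \<noteq> {}" "\<And>x. x \<in> S \<Longrightarrow> w x > 0"
  shows "measure_pmf.prob (gibbs_pmf S w) A = sum w (A \<inter> S) / sum w S"
proof -
  have "measure_pmf.prob (gibbs_pmf S w) A = measure_pmf.prob (gibbs_pmf S w) (A \<inter> S)"
    using measure_Int_set_pmf[of "gibbs_pmf S w" A] set_pmf_gibbs[OF assms] by simp
  also have "\<dots> = (\<Sum>x\<in>A \<inter> S. pmf (gibbs_pmf S w) x)"
    using assms(1) by (intro measure_measure_pmf_finite) auto
  also have "\<dots> = (\<Sum>x\<in>A \<inter> S. w x / sum w S)"
    by (intro sum.cong) (auto simp: pmf_gibbs[OF assms])
  finally show ?thesis by (simp add: sum_divide_distrib)
qed

lemma prob_bind_pmf:
  "measure_pmf.prob (bind_pmf M K) X = (\<integral>x. measure_pmf.prob (K x) X \<partial>measure_pmf M)"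
proof -
  have "ennreal (measure_pmf.prob (bind_pmf M K) X) = emeasure (bind_pmf M K) X"
    by (simp add: measure_pmf.emeasure_eq_measure)
  also have "\<dots> = (\<integral>\<^sup>+x. emeasure (K x) X \<partial>measure_pmf M)" by (rule emeasure_bind_pmf)
  also have "\<dots> = (\<integral>\<^sup>+x. ennreal (measure_pmf.prob (K x) X) \<partial>measure_pmf M)"
    by (simp add: measure_pmf.emeasure_eq_measure)
  also have "\<dots> = ennreal (\<integral>x. measure_pmf.prob (K x) X \<partial>measure_pmf M)"
    by (intro nn_integral_eq_integral measure_pmf.integrable_const_bound[where B = 1]) auto
  finally show ?thesis by (simp add: integral_nonneg)
qed

lemma prob_bind_pmf_sum:
  assumes "finite S" "set_pmf M \<subseteq> S"
  shows "measure_pmf.prob (bind_pmf M K) X = (\<Sum>x\<in>S. measure_pmf.prob (K x) X * pmf M x)"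
  unfolding prob_bind_pmf using assms by (intro integral_measure_pmf_real) auto

lemma pmf_bind_sum:
  assumes "finite S" "set_pmf M \<subseteq> S"
  shows "pmf (bind_pmf M K) y = (\<Sum>x\<in>S. pmf (K x) y * pmf M x)"
  unfolding pmf_bind using assms by (intro integral_measure_pmf_real) auto

lemma prob_pmf_sum:
  assumes "finite S" "set_pmf M \<subseteq> S"
  shows "measure_pmf.prob M X = (\<Sum>x\<in>S. (if x \<in> X then 1 else 0) * pmf M x)"
proof -
  have "measure_pmf.prob M X = measure_pmf.prob (bind_pmf M return_pmf) X"
    by (simp add: bind_return_pmf')
  also have "\<dots> = (\<Sum>x\<in>S. (if x \<in> X then 1 else 0) * pmf M x)"
    unfolding prob_bind_pmf_sum[OF assms] by (intro sum.cong) (auto simp: indicator_def)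
  finally show ?thesis .
qed

text \<open>Summing over all points forces C = 1, so two laws can be identified without computing
  their normalising constants.\<close>

lemma pmf_proportional:
  assumes "\<And>x. pmf M x = C * pmf M' x"
  shows "M = M'"
proof -
  have "1 = (\<integral>x. pmf M x \<partial>count_space UNIV)"
    by (simp add: integral_pmf)
  also have "\<dots> = C * (\<integral>x. pmf M' x \<partial>count_space UNIV)" by (simp add: assms)
  also have "(\<integral>x. pmf M' x \<partial>count_space UNIV) = 1"
    by (simp add: integral_pmf)
  finally show ?thesis using assms by (intro pmf_eqI) simp
qed

section \<open>Escape from a set under laws of bounded density\<close>

definition dominated :: "'s pmf \<Rightarrow> real \<Rightarrow> 's pmf \<Rightarrow> bool" where
  "dominated \<nu> C \<pi> \<longleftrightarrow> (\<forall>y. pmf \<nu> y \<le> C * pmf \<pi> y)"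

lemma dominated_set_pmf: "dominated \<nu> C \<pi> \<Longrightarrow> set_pmf \<nu> \<subseteq> set_pmf \<pi>"
  unfolding dominated_def by (metis mult_zero_right pmf_nonneg pmf_eq_0_set_pmf order_antisym subsetI)

text \<open>The same C survives because the density bound is linear in the law. If the kernel
  preserves \<pi>, the bound therefore holds at all times with the initial C.\<close>

lemma dominated_bind:
  assumes "dominated \<nu> C \<pi>" "finite (set_pmf \<pi>)"
  shows "dominated (bind_pmf \<nu> K) C (bind_pmf \<pi> K)"
  unfolding dominated_def
proof
  fix y
  have "pmf (bind_pmf \<nu> K) y = (\<Sum>x\<in>set_pmf \<pi>. pmf (K x) y * pmf \<nu> x)"
    using assms dominated_set_pmf by (intro pmf_bind_sum) auto
  also have "\<dots> \<le> (\<Sum>x\<in>set_pmf \<pi>. pmf (K x) y * (C * pmf \<pi> x))"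
    using assms(1) by (intro sum_mono mult_left_mono) (auto simp: dominated_def)
  also have "\<dots> = C * pmf (bind_pmf \<pi> K) y"
    using assms(2) by (subst pmf_bind_sum[of "set_pmf \<pi>"]) (auto simp: sum_distrib_left mult_ac)
  finally show "pmf (bind_pmf \<nu> K) y \<le> C * pmf (bind_pmf \<pi> K) y" .
qed

lemma dominated_cond:
  assumes "set_pmf \<pi> \<inter> A \<noteq> {}"
  shows "dominated (cond_pmf \<pi> A) (1 / measure_pmf.prob \<pi> A) \<pi>"
  unfolding dominated_def using assms by (auto simp: pmf_cond)

text \<open>Mass can newly leave A only from points of A in B, and domination bounds the \<nu>-mass
  of B by C times its \<pi>-mass, whatever the time.\<close>

lemma escape_step:
  assumes dom: "dominated \<nu> C \<pi>" and fin: "finite (set_pmf \<pi>)"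
    and stay: "\<And>y. y \<in> set_pmf \<pi> \<Longrightarrow> y \<in> A \<Longrightarrow> y \<notin> B \<Longrightarrow> set_pmf (K y) \<subseteq> A"
  shows "measure_pmf.prob (bind_pmf \<nu> K) (- A) \<le> measure_pmf.prob \<nu> (- A) + C * measure_pmf.prob \<pi> B"
proof -
  let ?S = "set_pmf \<pi>"
  have sub: "set_pmf \<nu> \<subseteq> ?S" using dominated_set_pmf[OF dom] .
  have "measure_pmf.prob (bind_pmf \<nu> K) (- A) = (\<Sum>y\<in>?S. measure_pmf.prob (K y) (- A) * pmf \<nu> y)"
    by (rule prob_bind_pmf_sum[OF fin sub])
  also have "\<dots> \<le> (\<Sum>y\<in>?S. (if y \<in> - A then 1 else 0) * pmf \<nu> y + C * ((if y \<in> B then 1 else 0) * pmf \<pi> y))"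
  proof (rule sum_mono)
    fix y assume y: "y \<in> ?S"
    have nn: "0 \<le> C * pmf \<pi> y" "pmf \<nu> y \<le> C * pmf \<pi> y"
      using dom order_trans[OF pmf_nonneg[of \<nu> y]] by (auto simp: dominated_def)
    have le: "measure_pmf.prob (K y) (- A) * pmf \<nu> y \<le> pmf \<nu> y"
      by (simp add: mult_left_le_one_le)
    consider "y \<notin> A" | "y \<in> A" "y \<in> B" | "y \<in> A" "y \<notin> B" by blast
    then show "measure_pmf.prob (K y) (- A) * pmf \<nu> y
        \<le> (if y \<in> - A then 1 else 0) * pmf \<nu> y + C * ((if y \<in> B then 1 else 0) * pmf \<pi> y)"
    proof cases
      case 3
      have "measure_pmf.prob (K y) (- A) = 0"
        using stay[OF y 3] by (subst measure_pmf_zero_iff) auto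
      then show ?thesis using nn 3 by simp
    qed (use nn le in auto)
  qed
  also have "\<dots> = measure_pmf.prob \<nu> (- A) + C * measure_pmf.prob \<pi> B"
    by (simp add: prob_pmf_sum[OF fin sub] prob_pmf_sum[OF fin order_refl, of B] sum.distrib sum_distrib_left)
  finally show ?thesis .
qed

text \<open>Data processing: the set where \<mu> exceeds \<nu> is the worst test, since weights in
  [0, 1] can do no better than its indicator.\<close>

lemma prob_bind_le_tv:
  assumes fin: "finite (set_pmf \<mu>)" "finite (set_pmf \<nu>)"
    and tv: "\<And>S. measure_pmf.prob \<mu> S - measure_pmf.prob \<nu> S \<le> \<epsilon>"
  shows "measure_pmf.prob (bind_pmf \<mu> K) X - measure_pmf.prob (bind_pmf \<nu> K) X \<le> \<epsilon>"
proof -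
  let ?U = "set_pmf \<mu> \<union> set_pmf \<nu>"
  define S where "S = {x. pmf \<nu> x < pmf \<mu> x}"
  have U: "finite ?U" using fin by simp
  have "measure_pmf.prob (bind_pmf \<mu> K) X - measure_pmf.prob (bind_pmf \<nu> K) X
      = (\<Sum>x\<in>?U. measure_pmf.prob (K x) X * (pmf \<mu> x - pmf \<nu> x))"
    using prob_bind_pmf_sum[OF U, of \<mu> K X] prob_bind_pmf_sum[OF U, of \<nu> K X]
    by (simp add: right_diff_distrib sum_subtractf)
  also have "\<dots> \<le> (\<Sum>x\<in>?U. (if x \<in> S then 1 else 0) * (pmf \<mu> x - pmf \<nu> x))"
  proof (rule sum_mono)
    fix x
    show "measure_pmf.prob (K x) X * (pmf \<mu> x - pmf \<nu> x) \<le> (if x \<in> S then 1 else 0) * (pmf \<mu> x - pmf \<nu> x)"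
      by (auto simp: S_def mult_left_le_one_le mult_nonneg_nonpos)
  qed
  also have "\<dots> = measure_pmf.prob \<mu> S - measure_pmf.prob \<nu> S"
    using prob_pmf_sum[OF U, of \<mu> S] prob_pmf_sum[OF U, of \<nu> S]
    by (simp add: right_diff_distrib sum_subtractf)
  finally show ?thesis using tv[of S] by linarith
qed

lemma prob_diff_le_tv_dist:
  "\<bar>measure_pmf.prob \<mu> A - measure_pmf.prob \<nu> A\<bar> \<le> tv_dist \<mu> \<nu>"
  unfolding tv_dist_def
proof (rule cSUP_upper)
  have "\<bar>measure_pmf.prob \<mu> X - measure_pmf.prob \<nu> X\<bar> \<le> 1" for X
    using measure_pmf.prob_le_1[of \<mu> X] measure_pmf.prob_le_1[of \<nu> X]
      measure_nonneg[of \<mu> X] measure_nonneg[of \<nu> X] by linarith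
  then show "bdd_above (range (\<lambda>A. \<bar>measure_pmf.prob \<mu> A - measure_pmf.prob \<nu> A\<bar>))"
    by (intro bdd_aboveI2)
qed simp

text \<open>Closeness from every deterministic start passes to random starts by averaging; the
  bottleneck arguments start from a conditioned stationary law.\<close>

lemma prob_bind_diff_le:
  assumes "finite (set_pmf \<nu>)" "\<And>x. x \<in> set_pmf \<nu> \<Longrightarrow> \<bar>measure_pmf.prob (L x) X - t\<bar> \<le> \<epsilon>"
  shows "\<bar>measure_pmf.prob (bind_pmf \<nu> L) X - t\<bar> \<le> \<epsilon>"
proof -
  let ?S = "set_pmf \<nu>"
  have one: "(\<Sum>x\<in>?S. pmf \<nu> x) = 1" using assms(1) by (simp add: sum_pmf_eq_1)
  have "measure_pmf.prob (bind_pmf \<nu> L) X - t = (\<Sum>x\<in>?S. (measure_pmf.prob (L x) X - t) * pmf \<nu> x)"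
    using one by (subst prob_bind_pmf_sum[of ?S])
      (auto simp: assms left_diff_distrib sum_subtractf simp flip: sum_distrib_left)
  also have "\<bar>\<dots>\<bar> \<le> (\<Sum>x\<in>?S. \<bar>(measure_pmf.prob (L x) X - t) * pmf \<nu> x\<bar>)" by (rule sum_abs)
  also have "\<dots> \<le> (\<Sum>x\<in>?S. \<epsilon> * pmf \<nu> x)"
    using assms(2) by (intro sum_mono) (auto simp: abs_mult intro!: mult_right_mono)
  also have "\<dots> = \<epsilon>" using one by (simp flip: sum_distrib_left)
  finally show ?thesis .
qed

lemma law_after_Suc: "law_after K (Suc k) x = bind_pmf (law_after K k x) K"
  by (simp add: law_after_def)

lemma law_after_0: "law_after K 0 x = return_pmf x"
  by (simp add: law_after_def)

text \<open>Holds also when no k qualifies, as the infimum is then infinite.\<close>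

lemma mixing_time_ge:
  assumes "\<And>k. (\<And>x. x \<in> S \<Longrightarrow> tv_dist (law_after K k x) \<pi> \<le> 1 / 4) \<Longrightarrow> t \<le> real k"
  shows "ereal t \<le> ereal_of_enat (mixing_time S K \<pi>)"
proof -
  have "enat (nat \<lceil>t\<rceil>) \<le> mixing_time S K \<pi>"
    unfolding mixing_time_def
  proof (rule INF_greatest)
    fix k assume "k \<in> {k. \<forall>x\<in>S. tv_dist (law_after K k x) \<pi> \<le> 1 / 4}"
    then have "t \<le> real k" using assms by blast
    then show "enat (nat \<lceil>t\<rceil>) \<le> enat k" by (simp add: ceiling_le_iff nat_le_iff)
  qed
  then have "ereal_of_enat (enat (nat \<lceil>t\<rceil>)) \<le> ereal_of_enat (mixing_time S K \<pi>)"
    by (simp only: ereal_of_enat_le_iff)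
  moreover have "ereal t \<le> ereal_of_enat (enat (nat \<lceil>t\<rceil>))"
    by (simp add: real_nat_ceiling_ge)
  ultimately show ?thesis by (rule order_trans[rotated])
qed

section \<open>Bottlenecks of the FK dynamics\<close>

locale rc_graph =
  fixes V :: "'a set" and E :: "'a set set" and p :: real and q :: nat
  assumes finite_V: "finite V" and edges: "\<forall>e\<in>E. e \<subseteq> V \<and> card e = 2" and E_ne: "E \<noteq> {}"
    and p_pos: "0 < p" and p_less_1: "p < 1" and q_ge_2: "2 \<le> q"
begin

definition n_compat :: "'a set set \<Rightarrow> real" where
  "n_compat \<omega> = real (card (compat V q (edge_rel \<omega>)))"

definition wt :: "'a set set \<Rightarrow> real" where
  "wt \<omega> = p ^ card \<omega> * (1 - p) ^ (card E - card \<omega>) * n_compat \<omega>"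

abbreviation \<pi> :: "'a set set pmf" where
  "\<pi> \<equiv> random_cluster V E p (real q)"

abbreviation \<mu> :: "('a \<Rightarrow> nat) pmf" where
  "\<mu> \<equiv> potts V E (- ln (1 - p)) q"

definition edge_boundary :: "'a set set set \<Rightarrow> 'a set set set" where
  "edge_boundary A = {\<omega> \<in> A. \<exists>e\<in>E. insert e \<omega> \<notin> A \<or> \<omega> - {e} \<notin> A}"

lemma finite_E: "finite E"
proof -
  have "E \<subseteq> Pow V" using edges by auto
  then show ?thesis using finite_V finite_subset by blast
qed

lemma edge_rel_subset: "\<omega> \<subseteq> E \<Longrightarrow> edge_rel \<omega> \<subseteq> V \<times> V"
proof clarify
  fix a b assume "\<omega> \<subseteq> E" "(a, b) \<in> edge_rel \<omega>"
  then have "{a, b} \<in> E" by (auto simp: edge_rel_def)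
  then have "{a, b} \<subseteq> V" using bspec[OF edges] by blast
  then show "a \<in> V \<and> b \<in> V" by simp
qed

lemma n_compat_eq: "\<omega> \<subseteq> E \<Longrightarrow> n_compat \<omega> = real q ^ card (clusters V \<omega>)"
  unfolding n_compat_def using edges by (subst card_compat_edge_rel[OF finite_V]) auto

lemma n_compat_pos: "\<omega> \<subseteq> E \<Longrightarrow> 0 < n_compat \<omega>"
  using q_ge_2 by (simp add: n_compat_eq)

lemma wt_pos: "\<omega> \<in> Pow E \<Longrightarrow> 0 < wt \<omega>"
  using p_pos p_less_1 n_compat_pos by (simp add: wt_def)

lemma random_cluster_eq: "\<pi> = gibbs_pmf (Pow E) wt"
proof -
  have "wt \<omega> = p ^ card \<omega> * (1 - p) ^ (card E - card \<omega>) * real q ^ card (clusters V \<omega>)"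
    if "\<omega> \<in> Pow E" for \<omega> using that by (simp add: wt_def n_compat_eq)
  then show ?thesis unfolding random_cluster_def gibbs_pmf_def
    by (intro arg_cong[of _ _ embed_pmf] ext) (auto intro!: sum.cong arg_cong2[of _ _ _ _ "(/)"])
qed

lemma pmf_rc: "pmf \<pi> \<omega> = (if \<omega> \<subseteq> E then wt \<omega> / sum wt (Pow E) else 0)"
  unfolding random_cluster_eq using pmf_gibbs[where S = "Pow E" and w = wt, OF _ Pow_not_empty wt_pos] finite_E
  by simp

lemma set_pmf_rc: "set_pmf \<pi> = Pow E"
  unfolding random_cluster_eq using set_pmf_gibbs[where S = "Pow E" and w = wt, OF _ Pow_not_empty wt_pos] finite_E
  by simp

lemma Z_pos: "0 < sum wt (Pow E)"
  using finite_E wt_pos by (intro sum_pos) auto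

lemma prob_rc: "A \<subseteq> Pow E \<Longrightarrow> measure_pmf.prob \<pi> A = sum wt A / sum wt (Pow E)"
  unfolding random_cluster_eq
  using prob_gibbs[where S = "Pow E" and w = wt, OF _ Pow_not_empty wt_pos] finite_E
  by (simp add: Int_absorb2)

lemma n_compat_insert:
  assumes "\<omega> \<subseteq> E" "e \<in> E"
  shows "n_compat (insert e \<omega>) \<le> n_compat \<omega>" "n_compat \<omega> \<le> q * n_compat (insert e \<omega>)"
proof -
  obtain u v where e: "e = {u, v}" using edges assms(2) by (meson card_2_iff)
  have uv: "u \<in> V" "v \<in> V" using edges assms(2) e by auto
  have eq: "compat V q (edge_rel (insert e \<omega>)) = compat V q (insert (u, v) (edge_rel \<omega>))"
    by (auto simp: compat_def edge_rel_def e doubleton_eq_iff)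
  show "n_compat (insert e \<omega>) \<le> n_compat \<omega>"
    unfolding n_compat_def eq using finite_V by (auto intro!: card_mono compat_mono)
  have "card (compat V q (edge_rel \<omega>)) \<le> q * card (compat V q (insert (u, v) (edge_rel \<omega>)))"
    using finite_V edge_rel_subset[OF assms(1)] uv by (rule card_compat_insert)
  then show "n_compat \<omega> \<le> q * n_compat (insert e \<omega>)"
    unfolding n_compat_def eq by (metis of_nat_le_iff of_nat_mult)
qed

text \<open>Opening e divides the number of compatible colourings by a factor between 1 and q. Both
  counts are powers of q with q >= 2, so the cluster numbers differ by 0 or 1, and
  \<open>cut_edge\<close> tells which.\<close>

lemma n_compat_ratio:
  assumes "\<omega> \<subseteq> E" "e \<in> E"
  shows "n_compat (\<omega> - {e}) = (if cut_edge V \<omega> e then q else 1) * n_compat (insert e \<omega>)"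
proof -
  have q: "1 < real q" using q_ge_2 by simp
  define k where "k = card (clusters V (\<omega> - {e}))"
  define k' where "k' = card (clusters V (insert e \<omega>))"
  have n: "n_compat (\<omega> - {e}) = real q ^ k" "n_compat (insert e \<omega>) = real q ^ k'"
    using assms by (auto simp: k_def k'_def intro!: n_compat_eq)
  have ins: "insert e (\<omega> - {e}) = insert e \<omega>" by auto
  have "real q ^ k' \<le> real q ^ k" "real q ^ k \<le> real q ^ Suc k'"
    using n_compat_insert[of "\<omega> - {e}" e] assms n by (auto simp: ins)
  then have "k' \<le> k" "k \<le> Suc k'" using q by (auto simp only: power_increasing_iff)
  moreover have "cut_edge V \<omega> e \<longleftrightarrow> k' \<noteq> k" by (simp add: cut_edge_def k_def k'_def)
  ultimately have "k = (if cut_edge V \<omega> e then Suc k' else k')" by auto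
  then show ?thesis by (simp add: n)
qed

section \<open>Heat-bath update of a single edge\<close>

definition fk_prob :: "'a set set \<Rightarrow> 'a set \<Rightarrow> real" where
  "fk_prob \<omega> e = (if cut_edge V \<omega> e then p / (p + (1 - p) * real q) else p)"

definition heat :: "'a set \<Rightarrow> 'a set set \<Rightarrow> 'a set set pmf" where
  "heat e \<omega> = map_pmf (\<lambda>b. if b then insert e \<omega> else \<omega> - {e}) (bernoulli_pmf (fk_prob \<omega> e))"

lemma fk_step_eq: "fk_step V E p (real q) \<omega> = bind_pmf (pmf_of_set E) (\<lambda>e. heat e \<omega>)"
  by (simp add: fk_step_def heat_def fk_prob_def map_pmf_def)

lemma fk_prob_bounds: "0 < fk_prob \<omega> e" "fk_prob \<omega> e < 1"
proof -
  have "0 < (1 - p) * real q" using p_less_1 q_ge_2 by simp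
  then show "0 < fk_prob \<omega> e" "fk_prob \<omega> e < 1"
    using p_pos p_less_1 by (cases "cut_edge V \<omega> e"; simp only: fk_prob_def if_True if_False; simp add: add_pos_pos)+
qed

text \<open>Detailed balance between the two configurations that differ at e only. For a cut-edge
  the weights of open and closed are in the ratio p : (1 - p) q, which is where p / (p + (1 - p) q)
  comes from.\<close>

lemma wt_balance:
  assumes "\<omega> \<subseteq> E" "e \<in> E"
  shows "(1 - fk_prob \<omega> e) * wt (insert e \<omega>) = fk_prob \<omega> e * wt (\<omega> - {e})"
proof -
  define c where "c = card (\<omega> - {e})"
  have fin: "finite \<omega>" using assms finite_E finite_subset by blast
  have c1: "card (insert e \<omega>) = Suc c"
    using fin by (metis c_def card_insert_disjoint finite_Diff insertI1 Diff_iff insert_Diff_single)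
  have "card (insert e \<omega>) \<le> card E" using assms finite_E by (intro card_mono) auto
  then have c2: "card E - c = Suc (card E - Suc c)" using c1 by simp
  define r where "r = (if cut_edge V \<omega> e then real q else 1)"
  have r: "n_compat (\<omega> - {e}) = r * n_compat (insert e \<omega>)"
    using n_compat_ratio[OF assms] by (simp add: r_def)
  define d where "d = p + (1 - p) * real q"
  have "0 \<le> (1 - p) * real q" using p_less_1 by simp
  then have "0 < d" using p_pos by (simp add: d_def)
  then have "1 - p / d = (1 - p) * real q / d" by (simp add: d_def diff_divide_eq_iff)
  then have f: "(1 - fk_prob \<omega> e) * p = fk_prob \<omega> e * (1 - p) * r"
    by (simp add: fk_prob_def r_def flip: d_def)
  have "(1 - fk_prob \<omega> e) * wt (insert e \<omega>)
      = ((1 - fk_prob \<omega> e) * p) * (p ^ c * (1 - p) ^ (card E - Suc c) * n_compat (insert e \<omega>))"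
    by (simp add: wt_def c1)
  also have "\<dots> = fk_prob \<omega> e * wt (\<omega> - {e})"
    unfolding f by (simp add: wt_def c2 r flip: c_def)
  finally show ?thesis .
qed

text \<open>The update draws the state of e afresh with odds that depend only on the other edges,
  and by \<open>wt_balance\<close> these are the conditional odds under
  \<open>\<pi>\<close>.\<close>

lemma heat_invariant:
  assumes e: "e \<in> E"
  shows "bind_pmf \<pi> (heat e) = \<pi>"
proof (rule pmf_eqI)
  fix \<omega>
  show "pmf (bind_pmf \<pi> (heat e)) \<omega> = pmf \<pi> \<omega>"
  proof (cases "\<omega> \<subseteq> E")
    case False
    have "set_pmf (bind_pmf \<pi> (heat e)) \<subseteq> Pow E"
      using e by (auto simp: set_pmf_rc heat_def split: if_splits)
    then have "\<omega> \<notin> set_pmf (bind_pmf \<pi> (heat e))" using False by blast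
    then show ?thesis using False by (simp add: pmf_rc pmf_eq_0_set_pmf)
  next
    case True
    define \<omega>0 where "\<omega>0 = \<omega> - {e}"
    define \<omega>1 where "\<omega>1 = insert e \<omega>"
    have ne: "\<omega>0 \<noteq> \<omega>1" by (auto simp: \<omega>0_def \<omega>1_def)
    have sub: "\<omega>0 \<subseteq> E" "\<omega>1 \<subseteq> E" using True e by (auto simp: \<omega>0_def \<omega>1_def)
    have ins: "insert e \<omega>0 = \<omega>1" "insert e \<omega>1 = \<omega>1" "\<omega>0 - {e} = \<omega>0" "\<omega>1 - {e} = \<omega>0"
      by (auto simp: \<omega>0_def \<omega>1_def)
    have f1: "fk_prob \<omega>1 e = fk_prob \<omega>0 e" "fk_prob \<omega> e = fk_prob \<omega>0 e"
      using ins by (auto simp: fk_prob_def cut_edge_def \<omega>0_def \<omega>1_def)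
    have h: "heat e \<omega>1 = heat e \<omega>0" by (simp add: heat_def ins f1 cong: if_cong)
    define r where "r = fk_prob \<omega>0 e"
    have r: "0 \<le> r" "r \<le> 1" using fk_prob_bounds[of \<omega>0 e] by (auto simp: r_def)
    have h0: "heat e \<omega>0 = map_pmf (\<lambda>b. if b then \<omega>1 else \<omega>0) (bernoulli_pmf r)"
      by (simp add: heat_def ins r_def cong: if_cong)
    have inj: "inj (\<lambda>b. if b then \<omega>1 else \<omega>0)" using ne by (auto simp: inj_def split: if_splits)
    have p1: "pmf (heat e \<omega>0) \<omega>1 = r"
      using pmf_map_inj'[OF inj, of "bernoulli_pmf r" True] r by (simp add: h0)
    have p0: "pmf (heat e \<omega>0) \<omega>0 = 1 - r"
      using pmf_map_inj'[OF inj, of "bernoulli_pmf r" False] r by (simp add: h0)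
    have "pmf (bind_pmf \<pi> (heat e)) \<omega> = (\<Sum>\<omega>'\<in>{\<omega>0, \<omega>1}. pmf (heat e \<omega>') \<omega> * pmf \<pi> \<omega>')"
      unfolding pmf_bind
    proof (rule integral_measure_pmf_real)
      fix \<omega>' assume "\<omega>' \<in> set_pmf \<pi>" "pmf (heat e \<omega>') \<omega> \<noteq> 0"
      then have "\<omega> \<in> set_pmf (heat e \<omega>')" by (simp add: set_pmf_iff)
      then have "\<omega> = insert e \<omega>' \<or> \<omega> = \<omega>' - {e}" by (auto simp: heat_def split: if_splits)
      then show "\<omega>' \<in> {\<omega>0, \<omega>1}" by (auto simp: \<omega>0_def \<omega>1_def)
    qed simp
    also have "\<dots> = pmf (heat e \<omega>0) \<omega> * (wt \<omega>0 + wt \<omega>1) / sum wt (Pow E)"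
      using ne sub by (simp add: h pmf_rc add_divide_distrib distrib_left)
    also have "pmf (heat e \<omega>0) \<omega> * (wt \<omega>0 + wt \<omega>1) = wt \<omega>"
    proof -
      have "(1 - r) * wt \<omega>1 = r * wt \<omega>0"
        using wt_balance[OF True e] by (simp add: f1 r_def \<omega>0_def \<omega>1_def)
      moreover have "\<omega> = \<omega>0 \<or> \<omega> = \<omega>1" by (auto simp: \<omega>0_def \<omega>1_def)
      ultimately show ?thesis by (auto simp: p0 p1 algebra_simps)
    qed
    finally show ?thesis using True by (simp add: pmf_rc)
  qed
qed

lemma fk_step_invariant: "bind_pmf \<pi> (fk_step V E p (real q)) = \<pi>"
proof -
  have "bind_pmf \<pi> (fk_step V E p (real q)) = bind_pmf (pmf_of_set E) (\<lambda>e. bind_pmf \<pi> (heat e))"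
    unfolding fk_step_eq[abs_def] by (rule bind_commute_pmf)
  also have "\<dots> = bind_pmf (pmf_of_set E) (\<lambda>e. \<pi>)"
    using E_ne finite_E by (intro bind_pmf_cong) (auto simp: heat_invariant)
  finally show ?thesis by simp
qed

lemma edge_boundary_subset: "edge_boundary A \<subseteq> A"
  by (auto simp: edge_boundary_def)

text \<open>Started from \<open>\<pi>\<close> conditioned on A, the law keeps density at most 1 /
  \<open>\<pi>\<close>(A), so each step lets at most \<open>\<pi>\<close>(boundary) /
  \<open>\<pi>\<close>(A) escape. Mixing at time k demands an escaped mass of at least 1/2 - 1/4,
  whence the factor 4.\<close>

lemma fk_bottleneck:
  assumes A: "A \<subseteq> Pow E" "A \<noteq> {}" and half: "2 * sum wt A \<le> sum wt (Pow E)"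
    and mix: "\<And>x. x \<in> Pow E \<Longrightarrow> tv_dist (law_after (fk_step V E p (real q)) k x) \<pi> \<le> 1 / 4"
  shows "sum wt A \<le> 4 * real k * sum wt (edge_boundary A)"
proof -
  let ?K = "fk_step V E p (real q)"
  let ?\<nu> = "cond_pmf \<pi> A"
  define C where "C = 1 / measure_pmf.prob \<pi> A"
  have A_ne: "set_pmf \<pi> \<inter> A \<noteq> {}" using A unfolding set_pmf_rc by blast
  have fin: "finite (set_pmf \<pi>)" using finite_E by (simp add: set_pmf_rc)
  have dom: "dominated (bind_pmf ?\<nu> (law_after ?K j)) C \<pi> \<and>
      measure_pmf.prob (bind_pmf ?\<nu> (law_after ?K j)) (- A) \<le> real j * (C * measure_pmf.prob \<pi> (edge_boundary A))" for j
  proof (induction j)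
    case 0
    have "measure_pmf.prob ?\<nu> (- A) = 0"
      by (subst measure_pmf_zero_iff) (auto simp: set_cond_pmf[OF A_ne])
    then show ?case using dominated_cond[OF A_ne]
      by (simp add: law_after_0[abs_def] bind_return_pmf' C_def)
  next
    case (Suc j)
    have eq: "bind_pmf ?\<nu> (law_after ?K (Suc j)) = bind_pmf (bind_pmf ?\<nu> (law_after ?K j)) ?K"
      by (simp add: law_after_Suc[abs_def] bind_assoc_pmf)
    have stay: "set_pmf (?K y) \<subseteq> A" if "y \<in> set_pmf \<pi>" "y \<in> A" "y \<notin> edge_boundary A" for y
      using that E_ne finite_E unfolding fk_step_eq edge_boundary_def heat_def by auto
    show ?case
      using dominated_bind[OF conjunct1[OF Suc.IH] fin, of ?K]
        escape_step[OF conjunct1[OF Suc.IH] fin, of A "edge_boundary A" ?K] stay Suc.IH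
      by (auto simp: eq fk_step_invariant algebra_simps)
  qed
  have finlaw: "finite (set_pmf ?\<nu>)" using fin by (simp add: set_cond_pmf[OF A_ne])
  have "\<bar>measure_pmf.prob (bind_pmf ?\<nu> (law_after ?K k)) (- A) - measure_pmf.prob \<pi> (- A)\<bar> \<le> 1 / 4"
  proof (rule prob_bind_diff_le[OF finlaw])
    fix x assume "x \<in> set_pmf ?\<nu>"
    then have "x \<in> Pow E" by (simp add: set_cond_pmf[OF A_ne] set_pmf_rc)
    then show "\<bar>measure_pmf.prob (law_after ?K k x) (- A) - measure_pmf.prob \<pi> (- A)\<bar> \<le> 1 / 4"
      using mix prob_diff_le_tv_dist order_trans by blast
  qed
  moreover have "measure_pmf.prob \<pi> (- A) = 1 - sum wt A / sum wt (Pow E)"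
    using measure_pmf.prob_compl[of A \<pi>] prob_rc[OF A(1)] by (simp add: Compl_eq_Diff_UNIV)
  moreover have "sum wt A / sum wt (Pow E) \<le> 1 / 2" using half Z_pos by (simp add: field_simps)
  ultimately have "1 / 4 \<le> real k * (C * measure_pmf.prob \<pi> (edge_boundary A))"
    using dom[of k] by linarith
  also have "C * measure_pmf.prob \<pi> (edge_boundary A) = sum wt (edge_boundary A) / sum wt A"
    using prob_rc[OF A(1)] prob_rc[of "edge_boundary A"] A(1) edge_boundary_subset[of A] Z_pos
    by (simp add: C_def)
  finally have le: "1 / 4 \<le> real k * (sum wt (edge_boundary A) / sum wt A)" .
  have "0 < sum wt A"
    using A finite_E wt_pos by (intro sum_pos) (auto intro: finite_subset)
  then show ?thesis using le by (simp add: field_simps)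
qed

end

section \<open>Bottlenecks of the Swendsen--Wang dynamics\<close>

lemma pmf_bind_Pair:
  "pmf (bind_pmf M (\<lambda>x. map_pmf (Pair x) (K x))) (x, y) = pmf M x * pmf (K x) y"
proof -
  have "pmf (bind_pmf M (\<lambda>x. map_pmf (Pair x) (K x))) (x, y)
      = (\<Sum>a\<in>{x}. pmf (map_pmf (Pair a) (K a)) (x, y) * pmf M a)"
    unfolding pmf_bind by (intro integral_measure_pmf_real) (auto simp: set_pmf_iff[symmetric])
  also have "\<dots> = pmf M x * pmf (K x) y"
    by (simp add: pmf_map_inj' inj_def)
  finally show ?thesis .
qed

lemma pmf_bind_Pair_swap:
  "pmf (bind_pmf M (\<lambda>y. map_pmf (\<lambda>x. (x, y)) (K y))) (x, y) = pmf M y * pmf (K y) x"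
proof -
  have inj: "inj (\<lambda>x. (x, y))" by (simp add: inj_def)
  have "pmf (bind_pmf M (\<lambda>y. map_pmf (\<lambda>x. (x, y)) (K y))) (x, y)
      = (\<Sum>a\<in>{y}. pmf (map_pmf (\<lambda>x. (x, a)) (K a)) (x, y) * pmf M a)"
    unfolding pmf_bind by (intro integral_measure_pmf_real) (auto simp: set_pmf_iff[symmetric])
  also have "\<dots> = pmf M y * pmf (K y) x"
    using pmf_map_inj'[OF inj, of "K y" x] by simp
  finally show ?thesis .
qed

context rc_graph
begin

definition edges_pmf :: "('a \<Rightarrow> nat) \<Rightarrow> 'a set set pmf" where
  "edges_pmf \<sigma> = map_pmf (\<lambda>b. {e \<in> monochromatic E \<sigma>. b e})
     (Pi_pmf (monochromatic E \<sigma>) False (\<lambda>_. bernoulli_pmf p))"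

definition colour_pmf :: "'a set set \<Rightarrow> ('a \<Rightarrow> nat) pmf" where
  "colour_pmf \<omega> = map_pmf (\<lambda>c. \<lambda>v\<in>V. c (connection V \<omega> `` {v}))
     (Pi_pmf (clusters V \<omega>) 0 (\<lambda>_. pmf_of_set {1..q}))"

lemma sw_step_eq: "sw_step V E p q \<sigma> = bind_pmf (edges_pmf \<sigma>) colour_pmf"
  by (simp add: sw_step_def edges_pmf_def colour_pmf_def Let_def map_pmf_def bind_assoc_pmf bind_return_pmf)

lemma mono_subset: "monochromatic E \<sigma> \<subseteq> E"
  by (auto simp: monochromatic_def)

lemma finite_mono: "finite (monochromatic E \<sigma>)"
  using mono_subset finite_E finite_subset by blast

lemma compat_iff_mono:
  assumes "\<omega> \<subseteq> E"
  shows "\<sigma> \<in> compat V q (edge_rel \<omega>) \<longleftrightarrow> \<sigma> \<in> colourings V q \<and> \<omega> \<subseteq> monochromatic E \<sigma>"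
proof -
  have "\<forall>e\<in>\<omega>. e \<subseteq> V \<and> card e = 2" using assms edges by blast
  moreover have "(\<forall>e\<in>\<omega>. \<forall>u\<in>e. \<forall>v\<in>e. \<sigma> u = \<sigma> v) \<longleftrightarrow> \<omega> \<subseteq> monochromatic E \<sigma>"
    using assms unfolding monochromatic_def by blast
  ultimately show ?thesis using compat_edge_rel_iff[of \<omega> V \<sigma> q] by simp
qed

lemma colour_pmf_eq:
  assumes "\<omega> \<subseteq> E"
  shows "colour_pmf \<omega> = pmf_of_set (compat V q (edge_rel \<omega>))"
proof -
  have "\<forall>e\<in>\<omega>. e \<subseteq> V" using assms edges by blast
  note bij = bij_betw_cluster_colouring[OF this, of q]
  have ne: "PiE_dflt (clusters V \<omega>) 0 (\<lambda>_. {1..q}) \<noteq> {}" using q_ge_2 by auto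
  have fin: "finite (PiE_dflt (clusters V \<omega>) 0 (\<lambda>_. {1..q}))"
    using finite_clusters[OF finite_V] by auto
  have "colour_pmf \<omega> = map_pmf (\<lambda>c. \<lambda>v\<in>V. c (connection V \<omega> `` {v}))
      (pmf_of_set (PiE_dflt (clusters V \<omega>) 0 (\<lambda>_. {1..q})))"
    unfolding colour_pmf_def using finite_clusters[OF finite_V] q_ge_2
    by (subst Pi_pmf_of_set) auto
  also have "\<dots> = pmf_of_set (compat V q (edge_rel \<omega>))"
    using bij by (subst map_pmf_of_set_inj[OF _ ne fin]) (auto simp: bij_betw_def)
  finally show ?thesis .
qed

lemma compat_nonempty: "\<omega> \<subseteq> E \<Longrightarrow> compat V q (edge_rel \<omega>) \<noteq> {}"
  using edge_rel_subset q_ge_2 by (intro compat_ne) auto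

lemma pmf_colour:
  assumes "\<omega> \<subseteq> E"
  shows "pmf (colour_pmf \<omega>) \<sigma> = (if \<sigma> \<in> compat V q (edge_rel \<omega>) then 1 / n_compat \<omega> else 0)"
  unfolding colour_pmf_eq[OF assms] using compat_nonempty[OF assms] finite_V
  by (simp add: n_compat_def)

lemma set_pmf_colour: "\<omega> \<subseteq> E \<Longrightarrow> set_pmf (colour_pmf \<omega>) = compat V q (edge_rel \<omega>)"
  using compat_nonempty finite_V by (simp add: colour_pmf_eq)

lemma set_pmf_edges: "set_pmf (edges_pmf \<sigma>) \<subseteq> Pow (monochromatic E \<sigma>)"
  by (auto simp: edges_pmf_def)

lemma pmf_edges:
  "pmf (edges_pmf \<sigma>) \<omega> = (if \<omega> \<subseteq> monochromatic E \<sigma>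
     then p ^ card \<omega> * (1 - p) ^ (card (monochromatic E \<sigma>) - card \<omega>) else 0)"
proof (cases "\<omega> \<subseteq> monochromatic E \<sigma>")
  case False
  then show ?thesis using set_pmf_edges[of \<sigma>] by (auto simp: set_pmf_iff)
next
  case True
  let ?M = "monochromatic E \<sigma>"
  let ?P = "Pi_pmf ?M False (\<lambda>_. bernoulli_pmf p)"
  let ?f = "\<lambda>b. {e \<in> ?M. b e}"
  have fin: "finite ?M" by (rule finite_mono)
  have inj: "inj_on ?f (set_pmf ?P)"
  proof (rule inj_onI, rule ext)
    fix b c e assume "b \<in> set_pmf ?P" "c \<in> set_pmf ?P" and eq: "?f b = ?f c"
    then have "e \<notin> ?M \<longrightarrow> \<not> b e \<and> \<not> c e"
      using set_Pi_pmf_subset[OF fin, of False "\<lambda>_. bernoulli_pmf p"] by auto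
    then show "b e = c e" using eq by blast
  qed
  have "pmf ?P (\<lambda>e. e \<in> \<omega>) = (\<Prod>e\<in>?M. if e \<in> \<omega> then p else 1 - p)"
    using True p_pos p_less_1 by (subst pmf_Pi'[OF fin]) (auto intro!: prod.cong)
  also have "\<dots> = (\<Prod>e\<in>\<omega>. p) * (\<Prod>e\<in>?M - \<omega>. 1 - p)"
    using fin True by (simp add: prod.If_cases Int_absorb1 Diff_eq)
  also have "\<dots> = p ^ card \<omega> * (1 - p) ^ (card ?M - card \<omega>)"
    using fin True by (simp add: card_Diff_subset finite_subset)
  finally have val: "pmf ?P (\<lambda>e. e \<in> \<omega>) = p ^ card \<omega> * (1 - p) ^ (card ?M - card \<omega>)" .
  then have "pmf ?P (\<lambda>e. e \<in> \<omega>) \<noteq> 0" using p_pos p_less_1 by simp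
  then have "(\<lambda>e. e \<in> \<omega>) \<in> set_pmf ?P" by (simp add: set_pmf_iff)
  then have "pmf (edges_pmf \<sigma>) (?f (\<lambda>e. e \<in> \<omega>)) = pmf ?P (\<lambda>e. e \<in> \<omega>)"
    unfolding edges_pmf_def by (rule pmf_map_inj[OF inj])
  moreover have "?f (\<lambda>e. e \<in> \<omega>) = \<omega>" using True by auto
  ultimately show ?thesis using True val by simp
qed

lemma colourings_nonempty: "colourings V q \<noteq> {}"
  using compat_nonempty[of "{}"] by (simp add: edge_rel_def)

lemma potts_weight: "exp (- ln (1 - p) * real m) = 1 / (1 - p) ^ m"
proof -
  have "exp (- ln (1 - p) * real m) = exp (- (real m * ln (1 - p)))" by (simp add: mult.commute)
  also have "\<dots> = 1 / (1 - p) ^ m"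
    using p_less_1 by (simp add: exp_minus exp_of_nat_mult inverse_eq_divide)
  finally show ?thesis .
qed

lemma pmf_potts:
  obtains Zp where "Zp > 0" "\<And>\<sigma>. pmf \<mu> \<sigma> = (if \<sigma> \<in> colourings V q
    then 1 / (1 - p) ^ card (monochromatic E \<sigma>) / Zp else 0)"
proof
  let ?w = "\<lambda>\<sigma>. exp (- ln (1 - p) * real (card (monochromatic E \<sigma>)))"
  show "sum ?w (colourings V q) > 0"
    using finite_V colourings_nonempty by (intro sum_pos) auto
  show "pmf \<mu> \<sigma> = (if \<sigma> \<in> colourings V q
    then 1 / (1 - p) ^ card (monochromatic E \<sigma>) / sum ?w (colourings V q) else 0)" for \<sigma>
    unfolding potts_def
    using pmf_gibbs[OF finite_colourings[OF finite_V] colourings_nonempty, of ?w \<sigma>, OF exp_gt_zero]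
    by (simp only: potts_weight)
qed

section \<open>The Edwards--Sokal coupling\<close>

definition joint :: "(('a \<Rightarrow> nat) \<times> 'a set set) pmf" where
  "joint = bind_pmf \<pi> (\<lambda>\<omega>. map_pmf (\<lambda>\<sigma>. (\<sigma>, \<omega>)) (colour_pmf \<omega>))"

text \<open>On compatible pairs both sides are proportional to
  \<open>p ^ card \<omega> * (1 - p) ^ (card E - card \<omega>)\<close>: on one side
  \<open>n_compat\<close> cancels, on the other the Potts weight cancels the dependence on the
  number of monochromatic edges.\<close>

lemma joint_eq: "joint = bind_pmf \<mu> (\<lambda>\<sigma>. map_pmf (Pair \<sigma>) (edges_pmf \<sigma>))"
proof -
  obtain Zp where Zp: "Zp > 0" "\<And>\<sigma>. pmf \<mu> \<sigma> = (if \<sigma> \<in> colourings V q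
    then 1 / (1 - p) ^ card (monochromatic E \<sigma>) / Zp else 0)" by (rule pmf_potts) blast
  define Z where "Z = sum wt (Pow E)"
  have Z: "Z > 0" using Z_pos by (simp add: Z_def)
  define C where "C = (1 - p) ^ card E * Zp / Z"
  have "pmf joint (\<sigma>, \<omega>) = C * pmf (bind_pmf \<mu> (\<lambda>\<sigma>. map_pmf (Pair \<sigma>) (edges_pmf \<sigma>))) (\<sigma>, \<omega>)"
    for \<sigma> \<omega>
  proof (cases "\<omega> \<subseteq> E \<and> \<sigma> \<in> colourings V q \<and> \<omega> \<subseteq> monochromatic E \<sigma>")
    case True
    let ?m = "card (monochromatic E \<sigma>)"
    have le: "card \<omega> \<le> ?m" "?m \<le> card E"
      using True finite_mono mono_subset finite_E by (auto intro!: card_mono)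
    have ne: "1 - p \<noteq> 0" using p_less_1 by simp
    have "pmf joint (\<sigma>, \<omega>) = p ^ card \<omega> * (1 - p) ^ (card E - card \<omega>) / Z"
      using True compat_iff_mono n_compat_pos[of \<omega>]
      by (simp add: joint_def pmf_bind_Pair_swap pmf_rc pmf_colour wt_def Z_def)
    also have "\<dots> = C * (1 / (1 - p) ^ ?m / Zp * (p ^ card \<omega> * (1 - p) ^ (?m - card \<omega>)))"
      using le ne Zp(1) Z by (simp add: C_def power_diff field_simps)
    finally show ?thesis using True by (simp add: pmf_bind_Pair Zp(2) pmf_edges)
  next
    case False
    have "pmf joint (\<sigma>, \<omega>) = 0"
    proof (cases "\<omega> \<subseteq> E")
      case True
      then have "\<sigma> \<notin> compat V q (edge_rel \<omega>)" using False compat_iff_mono[OF True] by blast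
      then show ?thesis using True by (simp add: joint_def pmf_bind_Pair_swap pmf_colour)
    qed (simp add: joint_def pmf_bind_Pair_swap pmf_rc)
    moreover have "pmf \<mu> \<sigma> * pmf (edges_pmf \<sigma>) \<omega> = 0"
      using False mono_subset[of \<sigma>] unfolding Zp(2) pmf_edges by (cases "\<sigma> \<in> colourings V q") auto
    ultimately show ?thesis by (simp add: pmf_bind_Pair)
  qed
  then have "\<And>s. pmf joint s = C * pmf (bind_pmf \<mu> (\<lambda>\<sigma>. map_pmf (Pair \<sigma>) (edges_pmf \<sigma>))) s"
    by (simp only: split_paired_all)
  then show ?thesis by (rule pmf_proportional)
qed

lemma set_pmf_joint: "set_pmf joint \<subseteq> colourings V q \<times> Pow E"
  unfolding joint_def by (auto simp: set_pmf_rc set_pmf_colour compat_iff_mono)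

lemma finite_joint: "finite (set_pmf joint)"
  using finite_subset[OF set_pmf_joint] finite_V finite_E by auto

lemma map_snd_joint: "map_pmf snd joint = \<pi>"
  by (simp add: joint_def map_bind_pmf pmf.map_comp o_def bind_return_pmf')

lemma bind_potts_edges: "bind_pmf \<mu> edges_pmf = \<pi>"
proof -
  have "map_pmf snd joint = bind_pmf \<mu> edges_pmf"
    unfolding joint_eq by (simp add: map_bind_pmf pmf.map_comp o_def)
  then show ?thesis by (simp add: map_snd_joint)
qed

section \<open>Edge-by-edge form of a Swendsen--Wang step\<close>

definition resample :: "'a set \<Rightarrow> ('a \<Rightarrow> nat) \<times> 'a set set \<Rightarrow> (('a \<Rightarrow> nat) \<times> 'a set set) pmf" where
  "resample e s = (if e \<in> monochromatic E (fst s)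
     then map_pmf (\<lambda>b. (fst s, if b then insert e (snd s) else snd s - {e})) (bernoulli_pmf p)
     else return_pmf (fst s, snd s - {e}))"

primrec resample_list ::
  "'a set list \<Rightarrow> ('a \<Rightarrow> nat) \<times> 'a set set \<Rightarrow> (('a \<Rightarrow> nat) \<times> 'a set set) pmf" where
  "resample_list [] s = return_pmf s"
| "resample_list (e # es) s = bind_pmf (resample e s) (resample_list es)"

definition recolour :: "('a \<Rightarrow> nat) \<times> 'a set set \<Rightarrow> (('a \<Rightarrow> nat) \<times> 'a set set) pmf" where
  "recolour s = map_pmf (\<lambda>\<sigma>. (\<sigma>, snd s)) (colour_pmf (snd s))"

lemma resample_list_eq:
  assumes "distinct es"
  shows "resample_list es (\<sigma>, \<omega>) =
    map_pmf (\<lambda>b. (\<sigma>, (\<omega> - set es) \<union> {e \<in> set es \<inter> monochromatic E \<sigma>. b e}))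
      (Pi_pmf (set es \<inter> monochromatic E \<sigma>) False (\<lambda>_. bernoulli_pmf p))"
  using assms
proof (induction es arbitrary: \<omega>)
  case Nil
  then show ?case by simp
next
  case (Cons e es)
  let ?M = "monochromatic E \<sigma>"
  let ?A = "set es \<inter> ?M"
  have fin: "finite ?A" by simp
  have e: "e \<notin> set es" and IH: "\<And>\<omega>. resample_list es (\<sigma>, \<omega>) =
      map_pmf (\<lambda>b. (\<sigma>, (\<omega> - set es) \<union> {e \<in> ?A. b e})) (Pi_pmf ?A False (\<lambda>_. bernoulli_pmf p))"
    using Cons by auto
  show ?case
  proof (cases "e \<in> ?M")
    case True
    have set_eq: "set (e # es) \<inter> ?M = insert e ?A" using True by auto
    have eA: "e \<notin> ?A" using e by simp
    have res: "((if b then insert e \<omega> else \<omega> - {e}) - set es) \<union> {x \<in> ?A. f x}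
        = (\<omega> - set (e # es)) \<union> {x \<in> insert e ?A. (f(e := b)) x}" for b f
      using e by (auto split: if_splits)
    have "resample_list (e # es) (\<sigma>, \<omega>) = bind_pmf (bernoulli_pmf p) (\<lambda>b.
        resample_list es (\<sigma>, if b then insert e \<omega> else \<omega> - {e}))"
      using True by (simp add: resample_def map_pmf_def bind_assoc_pmf bind_return_pmf cong: if_cong)
    also have "\<dots> = bind_pmf (bernoulli_pmf p) (\<lambda>b.
        bind_pmf (Pi_pmf ?A False (\<lambda>_. bernoulli_pmf p)) (\<lambda>f.
          return_pmf (\<sigma>, ((if b then insert e \<omega> else \<omega> - {e}) - set es) \<union> {x \<in> ?A. f x})))"
      by (simp only: IH map_pmf_def)
    also have "\<dots> = map_pmf (\<lambda>b. (\<sigma>, (\<omega> - set (e # es)) \<union> {x \<in> insert e ?A. b x}))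
        (Pi_pmf (insert e ?A) False (\<lambda>_. bernoulli_pmf p))"
      unfolding res Pi_pmf_insert'[OF fin eA] map_pmf_def bind_assoc_pmf bind_return_pmf by simp
    finally show ?thesis unfolding set_eq .
  next
    case False
    have set_eq: "set (e # es) \<inter> ?M = ?A" using False by auto
    have "(\<omega> - {e}) - set es = \<omega> - set (e # es)" by auto
    then show ?thesis unfolding set_eq using False
      by (simp add: resample_def IH bind_return_pmf)
  qed
qed

text \<open>A sweep over all edges forgets the old configuration, so it is exactly the percolation
  half of a Swendsen--Wang step, now cut into single-edge changes.\<close>

lemma resample_list_all:
  assumes "distinct es" "set es = E" "snd s \<subseteq> E"
  shows "resample_list es s = map_pmf (Pair (fst s)) (edges_pmf (fst s))"
proof -
  have empty: "snd s - E = {}" and "E \<inter> monochromatic E (fst s) = monochromatic E (fst s)"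
    using assms mono_subset by auto
  then show ?thesis using resample_list_eq[OF assms(1), of "fst s" "snd s"] assms(2)
    by (simp add: empty edges_pmf_def pmf.map_comp o_def)
qed

text \<open>Given \<sigma> the monochromatic edges carry independent bits, and replacing one of them
  by an independent copy does not change their law.\<close>

lemma resample_edges:
  "bind_pmf (edges_pmf \<sigma>) (\<lambda>\<omega>. resample e (\<sigma>, \<omega>)) = map_pmf (Pair \<sigma>) (edges_pmf \<sigma>)"
proof (cases "e \<in> monochromatic E \<sigma>")
  case False
  have "bind_pmf (edges_pmf \<sigma>) (\<lambda>\<omega>. resample e (\<sigma>, \<omega>)) = bind_pmf (edges_pmf \<sigma>) (\<lambda>\<omega>. return_pmf (\<sigma>, \<omega>))"
    using set_pmf_edges[of \<sigma>] False by (intro bind_pmf_cong) (auto simp: resample_def)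
  then show ?thesis by (simp add: map_pmf_def)
next
  case True
  let ?M = "monochromatic E \<sigma>"
  let ?A = "?M - {e}"
  let ?P = "Pi_pmf ?A False (\<lambda>_. bernoulli_pmf p)"
  let ?G = "\<lambda>y f. {x \<in> ?M. (f(e := y)) x}"
  have fin: "finite ?A" using finite_mono by simp
  have ed: "edges_pmf \<sigma> = bind_pmf (bernoulli_pmf p) (\<lambda>y. bind_pmf ?P (\<lambda>f. return_pmf (?G y f)))"
  proof -
    have M: "insert e ?A = ?M" using True by auto
    show ?thesis
      using Pi_pmf_insert'[OF fin, of e False "\<lambda>_. bernoulli_pmf p"] unfolding edges_pmf_def M
      by (simp add: map_pmf_def bind_assoc_pmf bind_return_pmf)
  qed
  have G: "(if b then insert e (?G y f) else ?G y f - {e}) = ?G b f" for b y f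
    using True by auto
  have "bind_pmf (edges_pmf \<sigma>) (\<lambda>\<omega>. resample e (\<sigma>, \<omega>)) = bind_pmf (bernoulli_pmf p) (\<lambda>y.
      bind_pmf ?P (\<lambda>f. bind_pmf (bernoulli_pmf p) (\<lambda>b. return_pmf (\<sigma>, if b then insert e (?G y f) else ?G y f - {e}))))"
    unfolding ed using True
    by (simp add: resample_def map_pmf_def bind_assoc_pmf bind_return_pmf del: fun_upd_apply cong: if_cong)
  also have "\<dots> = bind_pmf ?P (\<lambda>f. bind_pmf (bernoulli_pmf p) (\<lambda>b. return_pmf (\<sigma>, ?G b f)))"
    unfolding G by simp
  also have "\<dots> = bind_pmf (bernoulli_pmf p) (\<lambda>b. bind_pmf ?P (\<lambda>f. return_pmf (\<sigma>, ?G b f)))"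
    by (rule bind_commute_pmf)
  also have "\<dots> = map_pmf (Pair \<sigma>) (edges_pmf \<sigma>)"
    unfolding ed by (simp add: map_pmf_def bind_assoc_pmf bind_return_pmf)
  finally show ?thesis .
qed

lemma resample_invariant: "bind_pmf joint (resample e) = joint"
proof -
  have "bind_pmf joint (resample e) = bind_pmf \<mu> (\<lambda>\<sigma>. bind_pmf (edges_pmf \<sigma>) (\<lambda>\<omega>. resample e (\<sigma>, \<omega>)))"
    unfolding joint_eq by (simp add: bind_assoc_pmf bind_map_pmf)
  then show ?thesis by (simp add: resample_edges joint_eq)
qed

lemma recolour_invariant: "bind_pmf joint recolour = joint"
  unfolding joint_def by (simp add: recolour_def bind_assoc_pmf bind_map_pmf)

definition in_second :: "'a set set set \<Rightarrow> (('a \<Rightarrow> nat) \<times> 'a set set) set" where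
  "in_second A = snd -` A"

lemma prob_joint_in_second: "measure_pmf.prob joint (in_second A) = measure_pmf.prob \<pi> A"
  unfolding in_second_def map_snd_joint[symmetric] by simp

text \<open>A resampling changes at most one edge, so it leaves A only from the edge boundary. The
  intermediate laws stay dominated by \<open>joint\<close>, so a sweep costs at most one boundary
  term per edge.\<close>

lemma resample_list_escape:
  assumes "dominated \<theta> C joint" "set es \<subseteq> E"
  shows "dominated (bind_pmf \<theta> (resample_list es)) C joint \<and>
    measure_pmf.prob (bind_pmf \<theta> (resample_list es)) (- in_second A)
      \<le> measure_pmf.prob \<theta> (- in_second A) + real (length es) * (C * measure_pmf.prob \<pi> (edge_boundary A))"
  using assms
proof (induction es arbitrary: \<theta>)
  case Nil
  then show ?case by (simp add: bind_return_pmf')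
next
  case (Cons e es)
  let ?\<theta> = "bind_pmf \<theta> (resample e)"
  have dom: "dominated ?\<theta> C joint"
    using dominated_bind[OF Cons.prems(1) finite_joint, of "resample e"] by (simp add: resample_invariant)
  have "measure_pmf.prob ?\<theta> (- in_second A)
      \<le> measure_pmf.prob \<theta> (- in_second A) + C * measure_pmf.prob joint (in_second (edge_boundary A))"
  proof (rule escape_step[OF Cons.prems(1) finite_joint])
    fix y assume "y \<in> in_second A" "y \<notin> in_second (edge_boundary A)"
    then show "set_pmf (resample e y) \<subseteq> in_second A"
      using Cons.prems(2) by (auto simp: in_second_def edge_boundary_def resample_def)
  qed
  then have h: "measure_pmf.prob ?\<theta> (- in_second A)
      \<le> measure_pmf.prob \<theta> (- in_second A) + C * measure_pmf.prob \<pi> (edge_boundary A)"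
    by (simp add: prob_joint_in_second)
  have eq: "bind_pmf \<theta> (resample_list (e # es)) = bind_pmf ?\<theta> (resample_list es)"
  proof -
    have "resample_list (e # es) = (\<lambda>s. bind_pmf (resample e s) (resample_list es))" by (rule ext) simp
    then show ?thesis by (simp add: bind_assoc_pmf)
  qed
  show ?case unfolding eq using h Cons.IH[OF dom] Cons.prems(2) by (auto simp: algebra_simps)
qed

text \<open>The hypothesis compares laws of colourings, while A is a set of configurations. One more
  sweep after the k steps turns closeness of colourings into closeness of configurations, which
  accounts for \<open>Suc k\<close>; each sweep counts the boundary \<open>card E\<close>
  times.\<close>

lemma sw_bottleneck:
  assumes A: "A \<subseteq> Pow E" "A \<noteq> {}" and half: "2 * sum wt A \<le> sum wt (Pow E)"
    and mix: "\<And>x. x \<in> colourings V q \<Longrightarrow> tv_dist (law_after (sw_step V E p q) k x) \<mu> \<le> 1 / 4"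
  shows "sum wt A \<le> 4 * real (Suc k) * real (card E) * sum wt (edge_boundary A)"
proof -
  let ?K = "sw_step V E p q"
  obtain es where es: "distinct es" "set es = E" using finite_distinct_list[OF finite_E] by blast
  have len: "length es = card E" using es distinct_card by metis
  \<comment> \<open>The Swendsen--Wang chain lifted to pairs; its first component is the original
    chain as long as the configuration is a subset of E.\<close>
  define T where "T = (\<lambda>s. bind_pmf (resample_list es s) recolour)"
  define C where "C = 1 / measure_pmf.prob \<pi> A"
  define D where "D = C * measure_pmf.prob \<pi> (edge_boundary A)"
  have A_ne: "set_pmf \<pi> \<inter> A \<noteq> {}" using A unfolding set_pmf_rc by blast
  define \<Theta> where "\<Theta> = bind_pmf (cond_pmf \<pi> A) (\<lambda>\<omega>. map_pmf (\<lambda>\<sigma>. (\<sigma>, \<omega>)) (colour_pmf \<omega>))"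
  have \<Theta>_dom: "dominated \<Theta> C joint"
    unfolding \<Theta>_def joint_def C_def using finite_E
    by (intro dominated_bind dominated_cond A_ne) (simp add: set_pmf_rc)
  have T_eq: "T s = bind_pmf (edges_pmf (fst s)) (\<lambda>\<omega>. map_pmf (\<lambda>\<sigma>. (\<sigma>, \<omega>)) (colour_pmf \<omega>))"
    if "snd s \<subseteq> E" for s
    by (simp add: T_def resample_list_all[OF es that] bind_map_pmf recolour_def)
  have fst_T: "map_pmf fst (T s) = ?K (fst s)" if "snd s \<subseteq> E" for s
    by (simp add: T_eq[OF that] sw_step_eq map_bind_pmf pmf.map_comp o_def)
  have sup_T: "snd s' \<subseteq> E" if "snd s \<subseteq> E" "s' \<in> set_pmf (T s)" for s s'
    using that set_pmf_edges mono_subset by (fastforce simp: T_eq[OF that(1)])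
  have step: "map_pmf fst (law_after T j s) = law_after ?K j (fst s) \<and>
      (\<forall>s'\<in>set_pmf (law_after T j s). snd s' \<subseteq> E)" if "snd s \<subseteq> E" for j s
  proof (induction j)
    case 0
    then show ?case using that by (simp add: law_after_0)
  next
    case (Suc j)
    have "map_pmf fst (law_after T (Suc j) s) = bind_pmf (law_after T j s) (\<lambda>s'. map_pmf fst (T s'))"
      by (simp add: law_after_Suc map_bind_pmf)
    also have "\<dots> = bind_pmf (law_after T j s) (\<lambda>s'. ?K (fst s'))"
      using Suc.IH by (intro bind_pmf_cong refl fst_T) auto
    also have "\<dots> = bind_pmf (map_pmf fst (law_after T j s)) ?K" by (simp add: bind_map_pmf)
    also have "\<dots> = law_after ?K (Suc j) (fst s)" using Suc.IH by (simp add: law_after_Suc)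
    finally have "map_pmf fst (law_after T (Suc j) s) = law_after ?K (Suc j) (fst s)" .
    moreover have "snd s' \<subseteq> E" if s': "s' \<in> set_pmf (law_after T (Suc j) s)" for s'
    proof -
      obtain s'' where "s'' \<in> set_pmf (law_after T j s)" "s' \<in> set_pmf (T s'')"
        using s' unfolding law_after_Suc set_bind_pmf by blast
      then show ?thesis using Suc.IH sup_T by blast
    qed
    ultimately show ?case by blast
  qed
  have dom: "dominated (bind_pmf \<Theta> (law_after T j)) C joint \<and>
      measure_pmf.prob (bind_pmf \<Theta> (law_after T j)) (- in_second A) \<le> real j * (real (card E) * D)" for j
  proof (induction j)
    case 0
    have "set_pmf \<Theta> \<subseteq> in_second A" 
      unfolding \<Theta>_def in_second_def set_bind_pmf set_map_pmf set_cond_pmf[OF A_ne] by auto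
    then have "measure_pmf.prob \<Theta> (- in_second A) = 0"
      by (subst measure_pmf_zero_iff) auto
    then show ?case using \<Theta>_dom by (simp add: law_after_0[abs_def] bind_return_pmf')
  next
    case (Suc j)
    let ?\<theta> = "bind_pmf (bind_pmf \<Theta> (law_after T j)) (resample_list es)"
    have sw: "dominated ?\<theta> C joint"
      "measure_pmf.prob ?\<theta> (- in_second A) \<le> real (Suc j) * (real (card E) * D)"
      using resample_list_escape[OF conjunct1[OF Suc.IH], of es A] es Suc.IH
      by (auto simp: len D_def algebra_simps)
    have eq: "bind_pmf \<Theta> (law_after T (Suc j)) = bind_pmf ?\<theta> recolour"
      by (simp add: law_after_Suc[abs_def] T_def bind_assoc_pmf)
    \<comment> \<open>Recolouring does not touch the configuration, so here the exit set is
      empty.\<close>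
    have "measure_pmf.prob (bind_pmf ?\<theta> recolour) (- in_second A)
        \<le> measure_pmf.prob ?\<theta> (- in_second A) + C * measure_pmf.prob joint {}"
      by (rule escape_step[OF sw(1) finite_joint]) (auto simp: recolour_def in_second_def)
    then show ?case
      using sw dominated_bind[OF sw(1) finite_joint, of recolour] by (simp add: eq recolour_invariant)
  qed
  define \<nu> where "\<nu> = bind_pmf \<Theta> (\<lambda>s. law_after ?K k (fst s))"
  have sup: "s \<in> colourings V q \<times> Pow E" if "s \<in> set_pmf \<Theta>" for s
    using subsetD[OF set_pmf_joint subsetD[OF dominated_set_pmf[OF \<Theta>_dom] that]] .
  have \<nu>: "\<nu> = map_pmf fst (bind_pmf \<Theta> (law_after T k))"
    unfolding \<nu>_def map_bind_pmf using sup step by (intro bind_pmf_cong refl) auto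
  have fin\<nu>: "finite (set_pmf \<nu>)"
    using finite_subset[OF dominated_set_pmf[OF conjunct1[OF dom[of k]]] finite_joint] by (simp add: \<nu>)
  have fin\<Theta>: "finite (set_pmf \<Theta>)"
    using finite_subset[OF dominated_set_pmf[OF \<Theta>_dom] finite_joint] .
  have sup2: "snd s \<subseteq> E" if "s \<in> set_pmf (bind_pmf \<Theta> (law_after T k))" for s
  proof -
    have "s \<in> set_pmf joint" using subsetD[OF dominated_set_pmf[OF conjunct1[OF dom[of k]]] that] .
    then have "s \<in> colourings V q \<times> Pow E" using set_pmf_joint by (rule rev_subsetD)
    then show ?thesis by (simp add: mem_Times_iff)
  qed
  have fin\<mu>: "finite (set_pmf \<mu>)"
    using finite_V unfolding potts_def
    by (subst set_pmf_gibbs[OF finite_colourings[OF finite_V] colourings_nonempty]) auto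
  have close: "\<bar>measure_pmf.prob \<nu> S - measure_pmf.prob \<mu> S\<bar> \<le> 1 / 4" for S
    unfolding \<nu>_def
  proof (rule prob_bind_diff_le[OF fin\<Theta>])
    fix s assume "s \<in> set_pmf \<Theta>"
    then have "fst s \<in> colourings V q" using sup by (simp add: mem_Times_iff)
    then show "\<bar>measure_pmf.prob (law_after ?K k (fst s)) S - measure_pmf.prob \<mu> S\<bar> \<le> 1 / 4"
      using mix prob_diff_le_tv_dist order_trans by blast
  qed
  \<comment> \<open>The extra sweep: it turns the Potts measure into \<open>\<pi>\<close>, and \<nu>
    into the configuration law of the lifted chain after k steps and one sweep.\<close>
  have "measure_pmf.prob (bind_pmf \<mu> edges_pmf) (- A) - measure_pmf.prob (bind_pmf \<nu> edges_pmf) (- A) \<le> 1 / 4"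
  proof (rule prob_bind_le_tv[OF fin\<mu> fin\<nu>])
    fix S show "measure_pmf.prob \<mu> S - measure_pmf.prob \<nu> S \<le> 1 / 4" using close[of S] by linarith
  qed
  moreover have "bind_pmf \<nu> edges_pmf = map_pmf snd (bind_pmf (bind_pmf \<Theta> (law_after T k)) (resample_list es))"
  proof -
    have "map_pmf snd (bind_pmf (bind_pmf \<Theta> (law_after T k)) (resample_list es))
        = bind_pmf (bind_pmf \<Theta> (law_after T k)) (\<lambda>s. edges_pmf (fst s))"
      unfolding map_bind_pmf[of snd]
      by (intro bind_pmf_cong refl) (simp add: resample_list_all[OF es sup2] pmf.map_comp o_def)
    then show ?thesis by (simp add: \<nu> bind_map_pmf)
  qed
  moreover have "measure_pmf.prob (map_pmf snd (bind_pmf (bind_pmf \<Theta> (law_after T k)) (resample_list es))) (- A)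
      \<le> real (Suc k) * (real (card E) * D)"
    using resample_list_escape[OF conjunct1[OF dom[of k]], of es A] es dom[of k]
    by (auto simp: len D_def in_second_def vimage_Compl algebra_simps)
  moreover have "measure_pmf.prob \<pi> (- A) = 1 - sum wt A / sum wt (Pow E)"
    using measure_pmf.prob_compl[of A \<pi>] prob_rc[OF A(1)] by (simp add: Compl_eq_Diff_UNIV)
  moreover have "sum wt A / sum wt (Pow E) \<le> 1 / 2" using half Z_pos by (simp add: field_simps)
  ultimately have "1 / 4 \<le> real (Suc k) * (real (card E) * D)"
    by (simp add: bind_potts_edges)
  also have "D = sum wt (edge_boundary A) / sum wt A"
    using prob_rc[OF A(1)] prob_rc[of "edge_boundary A"] A(1) edge_boundary_subset[of A] Z_pos
    by (simp add: C_def D_def)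
  finally have le: "1 / 4 \<le> real (Suc k) * (real (card E) * (sum wt (edge_boundary A) / sum wt A))" .
  have "0 < sum wt A"
    using A finite_E wt_pos by (intro sum_pos) (auto intro: finite_subset)
  then show ?thesis using le by (simp add: field_simps)
qed

end

section \<open>Entropy of colour frequencies\<close>

lemma prod_sum_PiE:
  fixes f :: "'a \<Rightarrow> 'b \<Rightarrow> real"
  assumes "finite A" "\<And>x. x \<in> A \<Longrightarrow> finite (B x)"
  shows "(\<Prod>x\<in>A. \<Sum>y\<in>B x. f x y) = (\<Sum>g\<in>PiE A B. \<Prod>x\<in>A. f x (g x))"
  using assms
proof (induction A rule: finite_induct)
  case empty
  then show ?case by simp
next
  case (insert a A)
  have inj: "inj_on (\<lambda>(y, g). g(a := y)) (B a \<times> PiE A B)"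
    using insert.hyps(2) by (rule inj_combinator)
  have "(\<Sum>g\<in>PiE (insert a A) B. \<Prod>x\<in>insert a A. f x (g x))
      = (\<Sum>(y, g)\<in>B a \<times> PiE A B. \<Prod>x\<in>insert a A. f x ((g(a := y)) x))"
    unfolding PiE_insert_eq by (subst sum.reindex[OF inj]) (simp add: case_prod_unfold)
  also have "\<dots> = (\<Sum>(y, g)\<in>B a \<times> PiE A B. f a y * (\<Prod>x\<in>A. f x (g x)))"
  proof (rule sum.cong[OF refl], clarify)
    fix y g
    have "(\<Prod>x\<in>A. f x ((g(a := y)) x)) = (\<Prod>x\<in>A. f x (g x))"
      using insert.hyps by (intro prod.cong) auto
    then show "(\<Prod>x\<in>insert a A. f x ((g(a := y)) x)) = f a y * (\<Prod>x\<in>A. f x (g x))"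
      using insert.hyps by simp
  qed
  also have "\<dots> = (\<Sum>y\<in>B a. f a y) * (\<Sum>g\<in>PiE A B. \<Prod>x\<in>A. f x (g x))"
    by (simp add: sum_product sum.cartesian_product)
  finally show ?case using insert by simp
qed

lemma sum_power_card_Pow:
  fixes w :: real
  assumes "finite A"
  shows "(\<Sum>X\<in>Pow A. w ^ card X) = (1 + w) ^ card A"
proof -
  have "(1 + w) ^ card A = (\<Prod>x\<in>A. w + 1)" by (simp add: add.commute)
  also have "\<dots> = (\<Sum>X\<in>Pow A. (\<Prod>x\<in>X. w) * (\<Prod>x\<in>A - X. 1))" by (rule prod_add[OF assms])
  finally show ?thesis by simp
qed

text \<open>The difference g of the two sides has g(0) = 0, and g'(s) = ln (1 + s) - s / (1 +
  \<eta>) has the sign of s for -1 < s <= \<eta>, by s / (1 + s) <= ln (1 + s) <= s. The coefficient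
  tends to the true value 1/2 as \<eta> tends to 0, which lets the coupling come arbitrarily close
  to q / 2.\<close>

lemma entropy_pointwise:
  fixes t \<eta> :: real
  assumes t: "-1 \<le> t" "t \<le> \<eta>" and \<eta>: "0 \<le> \<eta>"
  shows "t + t\<^sup>2 / (2 * (1 + \<eta>)) \<le> (1 + t) * ln (1 + t)"
proof (cases "t = -1")
  case True
  then show ?thesis using \<eta> by (simp add: field_simps)
next
  case False
  define k where "k = inverse (1 + \<eta>) / 2"
  define g where "g = (\<lambda>s. (1 + s) * ln (1 + s) - s - k * s\<^sup>2)"
  have k: "2 * k * s = s / (1 + \<eta>)" for s
  proof -
    have "2 * k * s = inverse (1 + \<eta>) * s" by (simp add: k_def)
    then show ?thesis by (simp only: divide_inverse mult.commute)
  qed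
  have k_sq: "t\<^sup>2 / (2 * (1 + \<eta>)) = k * t\<^sup>2"
    by (simp only: k_def divide_inverse inverse_mult_distrib mult_ac)
  have der: "(g has_real_derivative (ln (1 + s) - 2 * k * s)) (at s)" if "-1 < s" for s
  proof -
    have ne: "1 + s \<noteq> 0" "0 < 1 + s" using that by auto
    have d1: "((\<lambda>s. ln (1 + s)) has_real_derivative 1 / (1 + s)) (at s)"
      using ne by (auto intro!: derivative_eq_intros)
    have d2: "((\<lambda>s. (1 + s) * ln (1 + s)) has_real_derivative (1 * ln (1 + s) + 1 / (1 + s) * (1 + s))) (at s)"
      by (rule DERIV_mult[OF _ d1]) (auto intro!: derivative_eq_intros)
    have d3: "((\<lambda>s. s\<^sup>2) has_real_derivative 2 * s) (at s)"
      using DERIV_pow[of 2 s] by simp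
    have "(g has_real_derivative (1 * ln (1 + s) + 1 / (1 + s) * (1 + s) - 1 - k * (2 * s))) (at s)"
      unfolding g_def by (intro DERIV_diff d2 DERIV_ident DERIV_cmult d3)
    then show ?thesis using ne by (simp add: mult_ac)
  qed
  have "g 0 \<le> g t"
  proof (cases "0 \<le> t")
    case True
    show ?thesis
    proof (rule DERIV_nonneg_imp_nondecreasing[OF True])
      fix s assume s: "0 \<le> s" "s \<le> t"
      have "s / (1 + \<eta>) \<le> s / (1 + s)" using s t \<eta> by (intro divide_left_mono) auto
      also have "s / (1 + s) \<le> ln (1 + s)"
      proof -
        have "1 / (1 + s) - 1 = - (s / (1 + s))" using s by (simp add: field_simps)
        then show ?thesis using ln_le_minus_one[of "1 / (1 + s)"] s by (simp add: ln_div)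
      qed
      finally show "\<exists>y. (g has_real_derivative y) (at s) \<and> 0 \<le> y"
        using der[of s] s by (auto simp: k)
    qed
  next
    case False
    have "t \<le> 0" using False by simp
    then show ?thesis
    proof (rule DERIV_nonpos_imp_nonincreasing)
      fix s assume s: "t \<le> s" "s \<le> 0"
      have s1: "-1 < s" using s t \<open>t \<noteq> -1\<close> by simp
      have "ln (1 + s) \<le> s" using s1 by (rule ln_add_one_self_le_self2)
      also have "s \<le> s / (1 + \<eta>)" using s \<eta> by (simp add: field_simps mult_nonneg_nonpos)
      finally show "\<exists>y. (g has_real_derivative y) (at s) \<and> y \<le> 0"
        using der[OF s1] by (auto simp: k)
    qed
  qed
  then show ?thesis unfolding k_sq by (simp add: g_def)
qed

section \<open>Colour frequencies and their distance from uniform\<close>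

definition count_colour :: "nat \<Rightarrow> (nat \<Rightarrow> nat) \<Rightarrow> nat \<Rightarrow> nat" where
  "count_colour N \<tau> c = card {v \<in> {..<N}. \<tau> v = c}"

definition imbalance :: "nat \<Rightarrow> nat \<Rightarrow> (nat \<Rightarrow> nat) \<Rightarrow> real" where
  "imbalance N q \<tau> = (\<Sum>c\<in>{1..q}. (real (count_colour N \<tau> c) / real N - 1 / real q)\<^sup>2)"

lemma imbalance_nonneg: "0 \<le> imbalance N q \<tau>"
  unfolding imbalance_def by (intro sum_nonneg) auto

lemma sum_by_colour:
  fixes f :: "nat \<Rightarrow> nat \<Rightarrow> real"
  assumes "\<tau> \<in> colourings {..<N} q"
  shows "(\<Sum>v<N. f v (\<tau> v)) = (\<Sum>c\<in>{1..q}. \<Sum>v\<in>{v \<in> {..<N}. \<tau> v = c}. f v c)"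
proof -
  have "(\<Sum>v<N. f v (\<tau> v)) = (\<Sum>c\<in>{1..q}. \<Sum>v\<in>{v \<in> {..<N}. \<tau> v = c}. f v (\<tau> v))"
    using assms by (intro sum.group[symmetric]) (auto simp: colourings_def PiE_iff)
  also have "\<dots> = (\<Sum>c\<in>{1..q}. \<Sum>v\<in>{v \<in> {..<N}. \<tau> v = c}. f v c)"
    by (intro sum.cong refl) auto
  finally show ?thesis .
qed

lemma sum_count_colour:
  assumes "\<tau> \<in> colourings {..<N} q"
  shows "(\<Sum>c\<in>{1..q}. real (count_colour N \<tau> c)) = real N"
  using sum_by_colour[OF assms, of "\<lambda>_ _. 1"] by (simp add: count_colour_def)

lemma sum_count_colour_sq:
  assumes "\<tau> \<in> colourings {..<N} q"
  shows "(\<Sum>c\<in>{1..q}. (real (count_colour N \<tau> c))\<^sup>2) = (\<Sum>u<N. \<Sum>v<N. if \<tau> u = \<tau> v then 1 else 0)"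
proof -
  have "(\<Sum>u<N. \<Sum>v<N. if \<tau> u = \<tau> v then 1 else 0 :: real) = (\<Sum>u<N. real (count_colour N \<tau> (\<tau> u)))"
    by (intro sum.cong refl) (simp add: count_colour_def sum.If_cases Int_def eq_commute)
  also have "\<dots> = (\<Sum>c\<in>{1..q}. \<Sum>v\<in>{v \<in> {..<N}. \<tau> v = c}. real (count_colour N \<tau> c))"
    by (rule sum_by_colour[OF assms])
  also have "\<dots> = (\<Sum>c\<in>{1..q}. (real (count_colour N \<tau> c))\<^sup>2)"
    by (simp add: count_colour_def power2_eq_square)
  finally show ?thesis by simp
qed

text \<open>Expanding the squares, the linear term is fixed because the frequencies sum to 1. Thus
  the distance from uniform frequencies is also the excess over 1 / q of the probability that a
  uniform ordered pair agrees, that is, the energy.\<close>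

lemma imbalance_eq:
  assumes "\<tau> \<in> colourings {..<N} q" "N > 0" "q > 0"
  shows "imbalance N q \<tau> = (\<Sum>u<N. \<Sum>v<N. if \<tau> u = \<tau> v then 1 else 0) / (real N)\<^sup>2 - 1 / real q"
proof -
  have "imbalance N q \<tau> = (\<Sum>c\<in>{1..q}. (real (count_colour N \<tau> c))\<^sup>2 / (real N)\<^sup>2
      - 2 / (real N * real q) * real (count_colour N \<tau> c) + 1 / (real q)\<^sup>2)"
    unfolding imbalance_def by (intro sum.cong refl) (simp add: power2_diff power_divide algebra_simps)
  also have "\<dots> = (\<Sum>c\<in>{1..q}. (real (count_colour N \<tau> c))\<^sup>2) / (real N)\<^sup>2
      - 2 / (real N * real q) * (\<Sum>c\<in>{1..q}. real (count_colour N \<tau> c)) + real q * (1 / (real q)\<^sup>2)"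
    by (simp only: sum.distrib sum_subtractf sum_divide_distrib[symmetric] sum_distrib_left[symmetric]) simp
  also have "\<dots> = (\<Sum>u<N. \<Sum>v<N. if \<tau> u = \<tau> v then 1 else 0) / (real N)\<^sup>2 - 1 / real q"
    unfolding sum_count_colour[OF assms(1)] sum_count_colour_sq[OF assms(1)]
    using assms(2,3) by (simp add: power2_eq_square field_simps)
  finally show ?thesis .
qed

text \<open>The probability that independent colours with the frequencies of \<open>\<tau>\<close> reproduce \<open>\<tau>\<close> is
  \<open>exp (- N h)\<close> with the entropy \<open>h\<close> of these frequencies; near the uniform vector the relative
  entropy dominates a multiple of the squared distance.\<close>
lemma exp_imbalance_le:
  assumes \<tau>: "\<tau> \<in> colourings {..<N} q" and N: "N > 0" and q: "q > 0"
    and small: "imbalance N q \<tau> \<le> \<theta>"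
  shows "exp (real q / (2 * (1 + real q * sqrt \<theta>)) * real N * imbalance N q \<tau>)
    \<le> real q ^ N * (\<Prod>v<N. real (count_colour N \<tau> (\<tau> v)) / real N)"
proof -
  define a where "a c = real (count_colour N \<tau> c) / real N" for c
  \<comment> \<open>Relative deviation of the frequency of c from 1 / q; it sums to 0 over the
    colours, which removes the linear term of \<open>entropy_pointwise\<close>.\<close>
  define t where "t c = real q * a c - 1" for c
  define \<eta> where "\<eta> = real q * sqrt \<theta>"
  have \<theta>: "0 \<le> \<theta>" using imbalance_nonneg[of N q \<tau>] small by linarith
  have \<eta>: "0 \<le> \<eta>" using \<theta> by (simp add: \<eta>_def)
  have a_pos: "0 \<le> a c" for c by (simp add: a_def)
  have t_ge: "-1 \<le> t c" for c using a_pos[of c] by (simp add: t_def)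
  have t_le: "t c \<le> \<eta>" if c: "c \<in> {1..q}" for c
  proof -
    have "(a c - 1 / real q)\<^sup>2 \<le> imbalance N q \<tau>"
      unfolding imbalance_def a_def
      by (rule member_le_sum[OF c, of "\<lambda>c. (real (count_colour N \<tau> c) / real N - 1 / real q)\<^sup>2"]) auto
    then have "(a c - 1 / real q)\<^sup>2 \<le> \<theta>" using small by linarith
    then have "a c - 1 / real q \<le> sqrt \<theta>" by (rule real_le_rsqrt)
    then have "real q * (a c - 1 / real q) \<le> real q * sqrt \<theta>" by (intro mult_left_mono) auto
    then show ?thesis using q by (simp add: t_def \<eta>_def algebra_simps)
  qed
  have sum_a: "(\<Sum>c\<in>{1..q}. a c) = 1"
    using sum_count_colour[OF \<tau>] N by (simp add: a_def flip: sum_divide_distrib)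
  have sum_t: "(\<Sum>c\<in>{1..q}. t c) = 0"
    using sum_a by (simp add: t_def sum_subtractf flip: sum_distrib_left)
  have sq: "(\<Sum>c\<in>{1..q}. (t c)\<^sup>2) = (real q)\<^sup>2 * imbalance N q \<tau>"
    unfolding imbalance_def a_def[symmetric] sum_distrib_left t_def using q
    by (intro sum.cong refl) (simp add: power2_eq_square field_simps)
  have "(real q)\<^sup>2 * imbalance N q \<tau> / (2 * (1 + \<eta>)) = (\<Sum>c\<in>{1..q}. t c + (t c)\<^sup>2 / (2 * (1 + \<eta>)))"
    unfolding sum.distrib sum_t sum_divide_distrib[symmetric] sq by simp
  also have "\<dots> \<le> (\<Sum>c\<in>{1..q}. (1 + t c) * ln (1 + t c))"
    using t_ge t_le \<eta> by (intro sum_mono entropy_pointwise) auto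
  also have "\<dots> = (\<Sum>c\<in>{1..q}. real q * a c * ln (real q * a c))" by (simp add: t_def)
  finally have key: "(real q)\<^sup>2 * imbalance N q \<tau> / (2 * (1 + \<eta>))
      \<le> real q * (\<Sum>c\<in>{1..q}. a c * ln (real q * a c))"
    by (simp add: sum_distrib_left mult.assoc)
  then have "real q * (real q * imbalance N q \<tau> / (2 * (1 + \<eta>)))
      \<le> real q * (\<Sum>c\<in>{1..q}. a c * ln (real q * a c))"
    by (simp add: power2_eq_square)
  then have key: "real q * imbalance N q \<tau> / (2 * (1 + \<eta>)) \<le> (\<Sum>c\<in>{1..q}. a c * ln (real q * a c))"
    by (rule mult_left_le_imp_le) (use q in simp)
  have a_v: "0 < a (\<tau> v)" if "v < N" for v
  proof -
    have "v \<in> {u \<in> {..<N}. \<tau> u = \<tau> v}" using that by simp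
    then have "0 < count_colour N \<tau> (\<tau> v)" unfolding count_colour_def by (subst card_gt_0_iff) auto
    then show ?thesis using N by (simp add: a_def)
  qed
  have "real q ^ N * (\<Prod>v<N. a (\<tau> v)) = (\<Prod>v<N. real q * a (\<tau> v))"
    by (simp add: prod.distrib)
  also have "\<dots> = (\<Prod>v<N. exp (ln (real q * a (\<tau> v))))"
    using a_v q by (intro prod.cong refl) simp
  also have "\<dots> = exp (\<Sum>v<N. ln (real q * a (\<tau> v)))" by (simp add: exp_sum)
  also have "(\<Sum>v<N. ln (real q * a (\<tau> v))) = (\<Sum>c\<in>{1..q}. real (count_colour N \<tau> c) * ln (real q * a c))"
    using sum_by_colour[OF \<tau>, of "\<lambda>_ c. ln (real q * a c)"] by (simp add: count_colour_def)
  also have "\<dots> = real N * (\<Sum>c\<in>{1..q}. a c * ln (real q * a c))"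
    using N by (simp add: a_def sum_distrib_left)
  finally have "real q ^ N * (\<Prod>v<N. a (\<tau> v)) = exp (real N * (\<Sum>c\<in>{1..q}. a c * ln (real q * a c)))" .
  moreover have "real q / (2 * (1 + \<eta>)) * real N * imbalance N q \<tau>
      \<le> real N * (\<Sum>c\<in>{1..q}. a c * ln (real q * a c))"
    using mult_left_mono[OF key, of "real N"] by (simp add: mult_ac)
  ultimately show ?thesis by (simp add: a_def \<eta>_def)
qed

text \<open>Method of types: for a fixed frequency vector the colourings are weighted by a product
  probability measure, with total mass at most 1, and there are at most (N + 1)^q such
  vectors.\<close>

lemma sum_own_frequencies_le:
  assumes N: "N > 0"
  shows "(\<Sum>\<tau>\<in>colourings {..<N} q. \<Prod>v<N. real (count_colour N \<tau> (\<tau> v)) / real N) \<le> (real N + 1) ^ q"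
proof -
  let ?Cl = "colourings {..<N} q"
  define k where "k \<tau> = (\<lambda>c\<in>{1..q}. count_colour N \<tau> c)" for \<tau>
  have "count_colour N \<tau> c \<le> N" for \<tau> c
    using card_mono[of "{..<N}" "{v \<in> {..<N}. \<tau> v = c}"] by (auto simp: count_colour_def)
  then have "k \<tau> \<in> {1..q} \<rightarrow>\<^sub>E {0..N}" for \<tau> by (auto simp: k_def)
  then have img: "k ` ?Cl \<subseteq> {1..q} \<rightarrow>\<^sub>E {0..N}" by blast
  have fin: "finite (k ` ?Cl)" by simp
  have "(\<Sum>\<tau>\<in>?Cl. \<Prod>v<N. real (count_colour N \<tau> (\<tau> v)) / real N)
      = (\<Sum>\<tau>\<in>?Cl. \<Prod>v<N. real (k \<tau> (\<tau> v)) / real N)"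
    by (intro sum.cong prod.cong refl) (auto simp: k_def colourings_def PiE_iff)
  also have "\<dots> = (\<Sum>\<kappa>\<in>k ` ?Cl. \<Sum>\<tau>\<in>{\<tau> \<in> ?Cl. k \<tau> = \<kappa>}. \<Prod>v<N. real (k \<tau> (\<tau> v)) / real N)"
    by (intro sum.group[symmetric]) auto
  also have "\<dots> \<le> (\<Sum>\<kappa>\<in>k ` ?Cl. 1)"
  proof (rule sum_mono)
    fix \<kappa> assume "\<kappa> \<in> k ` ?Cl"
    then obtain \<tau>0 where \<tau>0: "\<tau>0 \<in> ?Cl" "\<kappa> = k \<tau>0" by blast
    have one: "(\<Sum>c\<in>{1..q}. real (\<kappa> c) / real N) = 1"
      using sum_count_colour[OF \<tau>0(1)] N by (simp add: \<tau>0(2) k_def flip: sum_divide_distrib)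
    have "(\<Sum>\<tau>\<in>{\<tau> \<in> ?Cl. k \<tau> = \<kappa>}. \<Prod>v<N. real (k \<tau> (\<tau> v)) / real N)
        = (\<Sum>\<tau>\<in>{\<tau> \<in> ?Cl. k \<tau> = \<kappa>}. \<Prod>v<N. real (\<kappa> (\<tau> v)) / real N)"
      by (intro sum.cong refl) auto
    also have "\<dots> \<le> (\<Sum>\<tau>\<in>?Cl. \<Prod>v<N. real (\<kappa> (\<tau> v)) / real N)"
      by (intro sum_mono2) (auto intro: prod_nonneg)
    also have "\<dots> = (\<Prod>v<N. \<Sum>c\<in>{1..q}. real (\<kappa> c) / real N)"
      unfolding colourings_def by (subst prod_sum_PiE) auto
    also have "\<dots> = 1" by (simp only: one prod_constant power_one)
    finally show "(\<Sum>\<tau>\<in>{\<tau> \<in> ?Cl. k \<tau> = \<kappa>}. \<Prod>v<N. real (k \<tau> (\<tau> v)) / real N) \<le> 1" .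
  qed
  also have "\<dots> = real (card (k ` ?Cl))" by simp
  also have "\<dots> \<le> real (card ({1..q} \<rightarrow>\<^sub>E {0..N}))"
    using card_mono[OF _ img] by (simp add: finite_PiE)
  also have "\<dots> = (real N + 1) ^ q" by (simp add: card_PiE add.commute)
  finally show ?thesis .
qed

text \<open>The free-energy estimate near uniform frequencies: a reward for imbalance with this
  coefficient is absorbed by the loss of entropy, up to a polynomial factor in N.\<close>

lemma sum_exp_imbalance_le:
  assumes N: "N > 0" and q: "q > 0"
  shows "(\<Sum>\<tau>\<in>{\<tau> \<in> colourings {..<N} q. imbalance N q \<tau> \<le> \<theta>}.
      exp (real q / (2 * (1 + real q * sqrt \<theta>)) * real N * imbalance N q \<tau>)) \<le> real q ^ N * (real N + 1) ^ q"
proof -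
  let ?C = "{\<tau> \<in> colourings {..<N} q. imbalance N q \<tau> \<le> \<theta>}"
  let ?P = "\<lambda>\<tau>. \<Prod>v<N. real (count_colour N \<tau> (\<tau> v)) / real N"
  have "(\<Sum>\<tau>\<in>?C. exp (real q / (2 * (1 + real q * sqrt \<theta>)) * real N * imbalance N q \<tau>))
      \<le> (\<Sum>\<tau>\<in>?C. real q ^ N * ?P \<tau>)"
    using exp_imbalance_le[OF _ N q] by (intro sum_mono) auto
  also have "\<dots> \<le> (\<Sum>\<tau>\<in>colourings {..<N} q. real q ^ N * ?P \<tau>)"
    by (intro sum_mono2) (auto intro!: mult_nonneg_nonneg prod_nonneg)
  also have "\<dots> \<le> real q ^ N * (real N + 1) ^ q"
    using sum_own_frequencies_le[OF N, of q] by (simp flip: sum_distrib_left add: mult_left_mono)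
  finally show ?thesis .
qed

section \<open>Clusters of a random multigraph\<close>

text \<open>Edges are indices with two end points, so loops and parallel edges are allowed; this
  makes independent uniform edges possible. A configuration is a set of indices.\<close>

locale edge_list =
  fixes N q :: nat and a b :: "nat \<Rightarrow> nat"
  assumes N_pos: "N > 0" and q_ge_2: "2 \<le> q" and ends: "\<And>i. a i < N" "\<And>i. b i < N"
begin

abbreviation "Cl \<equiv> colourings {..<N} q"
abbreviation "Y \<equiv> imbalance N q"

definition rel :: "nat set \<Rightarrow> (nat \<times> nat) set" where
  "rel r = (\<Union>i\<in>r. {(a i, b i), (b i, a i)})"

definition num :: "nat set \<Rightarrow> real" where
  "num r = real (card (compat {..<N} q (rel r)))"

definition rwt :: "real \<Rightarrow> nat set \<Rightarrow> real" where
  "rwt w r = w ^ card r * num r"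

definition small :: "real \<Rightarrow> nat set \<Rightarrow> bool" where
  "small x r \<longleftrightarrow> (\<forall>u<N. real (card ((rel r)\<^sup>* `` {u})) \<le> x * real N)"

definition agree :: "nat \<Rightarrow> (nat \<Rightarrow> nat) \<Rightarrow> nat set" where
  "agree j \<tau> = {i \<in> {..<j}. \<tau> (a i) = \<tau> (b i)}"

lemma sym_rel: "sym (rel r)"
  by (auto simp: rel_def sym_def)

lemma rel_subset: "rel r \<subseteq> {..<N} \<times> {..<N}"
  using ends by (auto simp: rel_def)

lemma rel_mono: "r \<subseteq> r' \<Longrightarrow> rel r \<subseteq> rel r'"
  by (auto simp: rel_def)

lemma class_subset: "u < N \<Longrightarrow> (rel r)\<^sup>* `` {u} \<subseteq> {..<N}"
proof
  fix x assume "u < N" "x \<in> (rel r)\<^sup>* `` {u}"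
  then have "(u, x) \<in> (rel r)\<^sup>*" by simp
  then show "x \<in> {..<N}" using \<open>u < N\<close> rel_subset by induction auto
qed

lemma finite_class: "u < N \<Longrightarrow> finite ((rel r)\<^sup>* `` {u})"
  using class_subset finite_subset by blast

lemma compat_rel_iff:
  "r \<subseteq> {..<j} \<Longrightarrow> \<tau> \<in> compat {..<N} q (rel r) \<longleftrightarrow> \<tau> \<in> Cl \<and> r \<subseteq> agree j \<tau>"
  by (auto simp: compat_def rel_def agree_def)

lemma num_pos: "0 < num r"
proof -
  have "compat {..<N} q (rel r) \<noteq> {}" using q_ge_2 rel_subset by (intro compat_ne) auto
  then show ?thesis unfolding num_def by (simp add: card_gt_0_iff)
qed

lemma rwt_nonneg: "0 \<le> w \<Longrightarrow> 0 \<le> rwt w r"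
  using num_pos[of r] by (simp add: rwt_def)

lemma small_antimono:
  assumes "r \<subseteq> r'" "small x r'"
  shows "small x r"
  unfolding small_def
proof (intro allI impI)
  fix u assume u: "u < N"
  have "card ((rel r)\<^sup>* `` {u}) \<le> card ((rel r')\<^sup>* `` {u})"
    using rtrancl_mono[OF rel_mono[OF assms(1)]] finite_class[OF u] by (intro card_mono) auto
  then show "real (card ((rel r)\<^sup>* `` {u})) \<le> x * real N"
    using assms(2) u unfolding small_def by (meson of_nat_le_iff order_trans)
qed

text \<open>Every vertex reached after the insertion was already reached from u or from one of the
  two ends of the new edge, hence three old classes.\<close>

lemma small_insert:
  assumes "small (x / 3) r"
  shows "small x (insert i r)"
  unfolding small_def
proof (intro allI impI)
  fix u assume u: "u < N"
  let ?cl = "\<lambda>v. (rel r)\<^sup>* `` {v}"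
  have "(rel (insert i r))\<^sup>* `` {u} \<subseteq> ?cl u \<union> ?cl (a i) \<union> ?cl (b i)"
  proof
    fix y assume "y \<in> (rel (insert i r))\<^sup>* `` {u}"
    then have "(u, y) \<in> (rel (insert i r))\<^sup>*" by simp
    then show "y \<in> ?cl u \<union> ?cl (a i) \<union> ?cl (b i)"
    proof induction
      case (step y z)
      then show ?case
      proof (cases "(y, z) \<in> rel r")
        case True
        then show ?thesis using step.IH by (auto intro: rtrancl_into_rtrancl)
      next
        case False
        then have "z = a i \<or> z = b i" using step.hyps(2) by (auto simp: rel_def)
        then show ?thesis by auto
      qed
    qed simp
  qed
  then have "card ((rel (insert i r))\<^sup>* `` {u}) \<le> card (?cl u \<union> ?cl (a i) \<union> ?cl (b i))"
    using finite_class u ends by (intro card_mono) auto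
  also have "\<dots> \<le> card (?cl u) + card (?cl (a i)) + card (?cl (b i))"
    by (meson add_mono card_Un_le order_refl order_trans)
  finally have "real (card ((rel (insert i r))\<^sup>* `` {u}))
      \<le> real (card (?cl u)) + real (card (?cl (a i))) + real (card (?cl (b i)))" by simp
  also have "\<dots> \<le> x / 3 * real N + x / 3 * real N + x / 3 * real N"
    using assms u ends unfolding small_def by (intro add_mono) auto
  finally show "real (card ((rel (insert i r))\<^sup>* `` {u})) \<le> x * real N" by simp
qed

lemma num_insert: "num r \<le> real q * num (insert i r)"
proof -
  have eq: "compat {..<N} q (rel (insert i r)) = compat {..<N} q (insert (a i, b i) (rel r))"
    by (auto simp: compat_def rel_def)
  have "card (compat {..<N} q (rel r)) \<le> q * card (compat {..<N} q (insert (a i, b i) (rel r)))"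
    using ends rel_subset by (intro card_compat_insert) auto
  then show ?thesis unfolding num_def eq by (simp only: of_nat_mult[symmetric] of_nat_le_iff)
qed

text \<open>In a uniform compatible colouring connected pairs agree, and unconnected ones agree with
  probability at most 1 / q. By \<open>imbalance_eq\<close> the mean imbalance is at most the
  fraction of connected pairs, hence at most x.\<close>

lemma sum_imbalance_le:
  assumes "small x r"
  shows "(\<Sum>\<tau>\<in>compat {..<N} q (rel r). Y \<tau>) \<le> num r * x"
proof -
  let ?C = "compat {..<N} q (rel r)"
  have sub: "?C \<subseteq> Cl" by (auto simp: compat_def)
  have pair: "real (card {\<tau> \<in> ?C. \<tau> u = \<tau> v}) \<le> num r * ((if (u, v) \<in> (rel r)\<^sup>* then 1 else 0) + 1 / real q)"
    if "u < N" "v < N" for u v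
  proof (cases "(u, v) \<in> (rel r)\<^sup>*")
    case True
    have "card {\<tau> \<in> ?C. \<tau> u = \<tau> v} \<le> card ?C" by (intro card_mono) auto
    then have "real (card {\<tau> \<in> ?C. \<tau> u = \<tau> v}) \<le> num r" by (simp add: num_def)
    moreover have "0 \<le> num r * (1 / real q)" using num_pos[of r] by simp
    ultimately show ?thesis using True by (simp only: if_True distrib_left mult_1_right)
  next
    case False
    have "q * card (compat {..<N} q (insert (u, v) (rel r))) \<le> card ?C"
      using that False rel_subset sym_rel by (intro card_compat_insert_unconnected) auto
    then have "real q * real (card {\<tau> \<in> ?C. \<tau> u = \<tau> v}) \<le> num r"
      unfolding num_def compat_insert by (simp only: of_nat_mult[symmetric] of_nat_le_iff)
    then have "real (card {\<tau> \<in> ?C. \<tau> u = \<tau> v}) \<le> num r / real q"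
      using q_ge_2 by (simp add: pos_le_divide_eq mult.commute)
    then show ?thesis using False by simp
  qed
  have cl: "(\<Sum>u<N. \<Sum>v<N. if (u, v) \<in> (rel r)\<^sup>* then 1 else 0) \<le> real N * (x * real N)"
  proof -
    have "(\<Sum>v<N. if (u, v) \<in> (rel r)\<^sup>* then 1 else 0) \<le> x * real N" if "u < N" for u
    proof -
      have "{..<N} \<inter> {v. (u, v) \<in> (rel r)\<^sup>*} = (rel r)\<^sup>* `` {u}" using class_subset[OF that] by auto
      then have "(\<Sum>v<N. if (u, v) \<in> (rel r)\<^sup>* then 1 else 0) = real (card ((rel r)\<^sup>* `` {u}))"
        by (simp add: sum.If_cases)
      then show ?thesis using assms that by (simp add: small_def)
    qed
    then have "(\<Sum>u<N. \<Sum>v<N. if (u, v) \<in> (rel r)\<^sup>* then 1 else 0) \<le> (\<Sum>u<N. x * real N)"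
      by (intro sum_mono) auto
    then show ?thesis by simp
  qed
  have "(\<Sum>\<tau>\<in>?C. \<Sum>u<N. \<Sum>v<N. if \<tau> u = \<tau> v then 1 else 0)
      = (\<Sum>u<N. \<Sum>v<N. \<Sum>\<tau>\<in>?C. if \<tau> u = \<tau> v then 1 else 0)"
    by (subst sum.swap, intro sum.cong refl, rule sum.swap)
  also have "\<dots> = (\<Sum>u<N. \<Sum>v<N. real (card {\<tau> \<in> ?C. \<tau> u = \<tau> v}))"
    by (intro sum.cong refl) (simp add: sum.If_cases Int_def)
  also have "\<dots> \<le> (\<Sum>u<N. \<Sum>v<N. num r * ((if (u, v) \<in> (rel r)\<^sup>* then 1 else 0) + 1 / real q))"
    using pair by (intro sum_mono) auto
  also have "\<dots> = num r * ((\<Sum>u<N. \<Sum>v<N. if (u, v) \<in> (rel r)\<^sup>* then 1 else 0) + (real N)\<^sup>2 / real q)"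
    by (simp add: sum_distrib_left[symmetric] sum.distrib power2_eq_square)
  also have "\<dots> \<le> num r * (real N * (x * real N) + (real N)\<^sup>2 / real q)"
    using cl num_pos[of r] by (intro mult_left_mono add_mono) auto
  finally have S: "(\<Sum>\<tau>\<in>?C. \<Sum>u<N. \<Sum>v<N. if \<tau> u = \<tau> v then 1 else 0)
      \<le> num r * (real N * (x * real N) + (real N)\<^sup>2 / real q)" .
  have "(\<Sum>\<tau>\<in>?C. Y \<tau>) = (\<Sum>\<tau>\<in>?C. (\<Sum>u<N. \<Sum>v<N. if \<tau> u = \<tau> v then 1 else 0) / (real N)\<^sup>2 - 1 / real q)"
    using sub N_pos q_ge_2 by (intro sum.cong refl imbalance_eq) auto
  also have "\<dots> = (\<Sum>\<tau>\<in>?C. \<Sum>u<N. \<Sum>v<N. if \<tau> u = \<tau> v then 1 else 0) / (real N)\<^sup>2 - num r / real q"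
    by (simp add: sum_subtractf sum_divide_distrib num_def)
  also have "\<dots> \<le> num r * (real N * (x * real N) + (real N)\<^sup>2 / real q) / (real N)\<^sup>2 - num r / real q"
    using S by (intro diff_right_mono divide_right_mono) auto
  also have "\<dots> = num r * x"
    using N_pos q_ge_2 by (simp add: power2_eq_square field_simps)
  finally show ?thesis .
qed

lemma card_imbalance_gt:
  assumes "small x r" "0 < \<theta>"
  shows "real (card {\<tau> \<in> compat {..<N} q (rel r). \<theta> < Y \<tau>}) \<le> num r * x / \<theta>"
proof -
  let ?C = "compat {..<N} q (rel r)"
  have "\<theta> * real (card {\<tau> \<in> ?C. \<theta> < Y \<tau>}) = (\<Sum>\<tau>\<in>{\<tau> \<in> ?C. \<theta> < Y \<tau>}. \<theta>)" by simp
  also have "\<dots> \<le> (\<Sum>\<tau>\<in>{\<tau> \<in> ?C. \<theta> < Y \<tau>}. Y \<tau>)" by (intro sum_mono) auto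
  also have "\<dots> \<le> (\<Sum>\<tau>\<in>?C. Y \<tau>)" by (intro sum_mono2) (auto simp: imbalance_nonneg)
  also have "\<dots> \<le> num r * x" by (rule sum_imbalance_le[OF assms(1)])
  finally show ?thesis using assms(2) by (simp add: field_simps)
qed

text \<open>Recolouring a large cluster with the majority colour of its complement makes the colouring
  unbalanced, and a colouring is recovered from the result and the former colour of the cluster.\<close>
lemma card_imbalance_ge:
  assumes u: "u < N" and big: "x * real N \<le> real (card ((rel r)\<^sup>* `` {u}))" and x: "0 \<le> x"
  shows "num r \<le> real q * real (card {\<tau> \<in> compat {..<N} q (rel r). (x / 2)\<^sup>2 \<le> Y \<tau>})"
proof -
  let ?C = "compat {..<N} q (rel r)"
  let ?D = "(rel r)\<^sup>* `` {u}"
  let ?B = "{\<tau> \<in> ?C. (x / 2)\<^sup>2 \<le> Y \<tau>}"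
  define rc where "rc c \<tau> = (\<lambda>y. if (u, y) \<in> (rel r)\<^sup>* then c else \<tau> y)" for c :: nat and \<tau> :: "nat \<Rightarrow> nat"
  have D: "?D \<subseteq> {..<N}" using class_subset[OF u] .
  have ex: "\<exists>c\<in>{1..q}. rc c \<tau> \<in> ?B" if \<tau>: "\<tau> \<in> ?C" for \<tau>
  proof -
    define m where "m c = card {v \<in> {..<N} - ?D. \<tau> v = c}" for c
    have "(\<Sum>c\<in>{1..q}. m c) = card ({..<N} - ?D)"
    proof -
      have "card ({..<N} - ?D) = (\<Sum>v\<in>{..<N} - ?D. 1)" by simp
      also have "\<dots> = (\<Sum>c\<in>{1..q}. \<Sum>v\<in>{v \<in> {..<N} - ?D. \<tau> v = c}. 1)"
        using \<tau> by (intro sum.group[symmetric]) (auto simp: compat_def colourings_def PiE_iff)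
      finally show ?thesis by (simp add: m_def)
    qed
    then have sum_m: "(\<Sum>c\<in>{1..q}. real (m c)) = real N - real (card ?D)"
      using card_Diff_subset[of ?D "{..<N}"] D finite_class[OF u] card_mono[OF _ D]
      by (simp flip: of_nat_sum)
    \<comment> \<open>Pigeonhole: some colour has at least the average share of the vertices outside
      the cluster.\<close>
    have "\<exists>c\<in>{1..q}. (real N - real (card ?D)) / real q \<le> real (m c)"
    proof (rule ccontr)
      assume "\<not> ?thesis"
      then have "real (m c) < (real N - real (card ?D)) / real q" if "c \<in> {1..q}" for c
        using that by (meson not_le)
      then have "(\<Sum>c\<in>{1..q}. real (m c)) < (\<Sum>c\<in>{1..q}. (real N - real (card ?D)) / real q)"
        using q_ge_2 by (intro sum_strict_mono) auto
      then show False using sum_m q_ge_2 by simp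
    qed
    then obtain c where c: "c \<in> {1..q}" "(real N - real (card ?D)) / real q \<le> real (m c)" by blast
    have "{v \<in> {..<N}. rc c \<tau> v = c} = {v \<in> {..<N} - ?D. \<tau> v = c} \<union> ?D"
      using D by (auto simp: rc_def)
    then have "count_colour N (rc c \<tau>) c = card ({v \<in> {..<N} - ?D. \<tau> v = c} \<union> ?D)"
      by (simp only: count_colour_def)
    also have "\<dots> = m c + card ?D"
      unfolding m_def using finite_class[OF u] by (intro card_Un_disjoint) auto
    finally have "real (count_colour N (rc c \<tau>) c) = real (m c) + real (card ?D)" by simp
    \<comment> \<open>Giving the cluster to this colour produces an excess over N / q of 1 - 1 / q
      times the cluster size, at least half of it as q >= 2.\<close>
    then have "real N / real q + real (card ?D) * (1 - 1 / real q) \<le> real (count_colour N (rc c \<tau>) c)"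
      using c(2) q_ge_2 by (simp add: field_simps)
    moreover have "real (card ?D) * (1 / 2) \<le> real (card ?D) * (1 - 1 / real q)"
      using q_ge_2 by (intro mult_left_mono) (auto simp: field_simps)
    ultimately have "real N / real q + x * real N / 2 \<le> real (count_colour N (rc c \<tau>) c)"
      using big by linarith
    then have "(real N / real q + x * real N / 2) / real N \<le> real (count_colour N (rc c \<tau>) c) / real N"
      by (intro divide_right_mono) auto
    moreover have "(real N / real q + x * real N / 2) / real N = 1 / real q + x / 2"
      using N_pos by (simp add: add_divide_distrib)
    ultimately have "x / 2 \<le> real (count_colour N (rc c \<tau>) c) / real N - 1 / real q" by linarith
    then have "(x / 2)\<^sup>2 \<le> (real (count_colour N (rc c \<tau>) c) / real N - 1 / real q)\<^sup>2"
      using x by (intro power_mono) auto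
    also have "\<dots> \<le> Y (rc c \<tau>)"
      unfolding imbalance_def
      by (rule member_le_sum[OF c(1), of "\<lambda>d. (real (count_colour N (rc c \<tau>) d) / real N - 1 / real q)\<^sup>2"]) auto
    finally have "(x / 2)\<^sup>2 \<le> Y (rc c \<tau>)" .
    moreover have "rc c \<tau> \<in> ?C"
      unfolding rc_def using u c(1) sym_rel rel_subset \<tau> by (intro compat_recolour) auto
    ultimately show ?thesis using c(1) by blast
  qed
  define f where "f \<tau> = rc (SOME c. c \<in> {1..q} \<and> rc c \<tau> \<in> ?B) \<tau>" for \<tau>
  have f: "f \<tau> \<in> ?B" if "\<tau> \<in> ?C" for \<tau>
    unfolding f_def
  proof (rule conjunct2, rule someI_ex)
    show "\<exists>c. c \<in> {1..q} \<and> rc c \<tau> \<in> ?B" using ex[OF that] unfolding Bex_def .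
  qed
  have "inj_on (\<lambda>\<tau>. (f \<tau>, \<tau> u)) ?C"
  proof (rule inj_onI)
    fix \<sigma> \<tau> assume s: "\<sigma> \<in> ?C" and t: "\<tau> \<in> ?C" and e: "(f \<sigma>, \<sigma> u) = (f \<tau>, \<tau> u)"
    show "\<sigma> = \<tau>"
    proof
      fix y
      show "\<sigma> y = \<tau> y"
      proof (cases "(u, y) \<in> (rel r)\<^sup>*")
        case True
        then show ?thesis using compat_rtrancl[OF s True] compat_rtrancl[OF t True] e by simp
      next
        case False
        have "f \<sigma> y = f \<tau> y" using e by simp
        then show ?thesis using False by (simp add: f_def rc_def)
      qed
    qed
  qed
  moreover have "(\<lambda>\<tau>. (f \<tau>, \<tau> u)) ` ?C \<subseteq> ?B \<times> {1..q}"
  proof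
    fix z assume "z \<in> (\<lambda>\<tau>. (f \<tau>, \<tau> u)) ` ?C"
    then obtain \<tau> where t: "\<tau> \<in> ?C" "z = (f \<tau>, \<tau> u)" by blast
    then have "\<tau> u \<in> {1..q}" using u by (auto simp: compat_def colourings_def PiE_iff)
    then show "z \<in> ?B \<times> {1..q}" using f[OF t(1)] t(2) by simp
  qed
  ultimately have "card ?C \<le> card (?B \<times> {1..q})"
    by (intro card_inj_on_le) auto
  then have "card ?C \<le> q * card ?B" by (simp add: card_cartesian_product mult.commute)
  then show ?thesis unfolding num_def by (simp only: of_nat_mult[symmetric] of_nat_le_iff)
qed

text \<open>A class with more than x N / 3 vertices makes at least 1 / q of the colourings have
  imbalance (x / 6)^2 or more; by Markov's inequality and 2 q x <= \<theta> at most 1 / (2 q) of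
  them exceed \<theta>. The remaining 1 / (2 q) lie in the window.\<close>

lemma num_le_critical:
  assumes r: "small x r" "\<not> small (x / 3) r" and x: "0 < x" "2 * real q * x \<le> \<theta>"
  shows "num r \<le> 2 * real q * real (card {\<tau> \<in> compat {..<N} q (rel r). (x / 6)\<^sup>2 \<le> Y \<tau> \<and> Y \<tau> \<le> \<theta>})"
proof -
  let ?C = "compat {..<N} q (rel r)"
  let ?lo = "{\<tau> \<in> ?C. (x / 6)\<^sup>2 \<le> Y \<tau>}"
  let ?hi = "{\<tau> \<in> ?C. \<theta> < Y \<tau>}"
  let ?mid = "{\<tau> \<in> ?C. (x / 6)\<^sup>2 \<le> Y \<tau> \<and> Y \<tau> \<le> \<theta>}"
  have "0 < 2 * real q * x" using x q_ge_2 by simp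
  then have \<theta>: "0 < \<theta>" using x by linarith
  obtain u where u: "u < N" "x / 3 * real N \<le> real (card ((rel r)\<^sup>* `` {u}))"
    using r(2) unfolding small_def by (meson linear)
  have "num r \<le> real q * real (card {\<tau> \<in> ?C. (x / 3 / 2)\<^sup>2 \<le> Y \<tau>})"
    using x by (intro card_imbalance_ge[OF u]) auto
  then have lo: "num r \<le> real q * real (card ?lo)" by simp
  have "real (card ?hi) \<le> num r * x / \<theta>" by (rule card_imbalance_gt[OF r(1) \<theta>])
  then have "2 * real q * real (card ?hi) \<le> 2 * real q * (num r * x / \<theta>)"
    by (intro mult_left_mono) auto
  also have "\<dots> = num r * (2 * real q * x / \<theta>)" by simp
  also have "\<dots> \<le> num r * 1"
    using x \<theta> num_pos[of r] by (intro mult_left_mono) auto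
  finally have hi: "2 * real q * real (card ?hi) \<le> num r" by simp
  have "card ?lo \<le> card (?mid \<union> ?hi)" by (intro card_mono) auto
  also have "\<dots> \<le> card ?mid + card ?hi" by (rule card_Un_le)
  finally have "real (card ?lo) \<le> real (card ?mid) + real (card ?hi)" by simp
  then have "real q * real (card ?lo) \<le> real q * real (card ?mid) + real q * real (card ?hi)"
    using mult_left_mono[of "real (card ?lo)" "real (card ?mid) + real (card ?hi)" "real q"]
    by (simp only: distrib_left of_nat_0_le_iff)
  then show ?thesis using lo hi by linarith
qed

text \<open>Edwards--Sokal for the multigraph: for a fixed colouring the compatible configurations
  are the subsets of the agreeing edges, and their weights sum to a power of 1 + w.\<close>

lemma sum_rwt_colourings:
  assumes w: "0 \<le> w"
  shows "(\<Sum>r\<in>Pow {..<j}. w ^ card r * real (card {\<tau> \<in> compat {..<N} q (rel r). P \<tau>}))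
    = (\<Sum>\<tau>\<in>{\<tau> \<in> Cl. P \<tau>}. (1 + w) ^ card (agree j \<tau>))"
proof -
  have "(\<Sum>r\<in>Pow {..<j}. w ^ card r * real (card {\<tau> \<in> compat {..<N} q (rel r). P \<tau>}))
      = (\<Sum>r\<in>Pow {..<j}. \<Sum>\<tau>\<in>{\<tau> \<in> Cl. P \<tau>}. if r \<subseteq> agree j \<tau> then w ^ card r else 0)"
  proof (rule sum.cong[OF refl])
    fix r assume r: "r \<in> Pow {..<j}"
    have "{\<tau> \<in> compat {..<N} q (rel r). P \<tau>} = {\<tau> \<in> Cl. P \<tau>} \<inter> {\<tau>. r \<subseteq> agree j \<tau>}"
      using compat_rel_iff[of r j] r by auto
    then show "w ^ card r * real (card {\<tau> \<in> compat {..<N} q (rel r). P \<tau>})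
        = (\<Sum>\<tau>\<in>{\<tau> \<in> Cl. P \<tau>}. if r \<subseteq> agree j \<tau> then w ^ card r else 0)"
      by (simp add: sum.If_cases)
  qed
  also have "\<dots> = (\<Sum>\<tau>\<in>{\<tau> \<in> Cl. P \<tau>}. \<Sum>r\<in>Pow {..<j}. if r \<subseteq> agree j \<tau> then w ^ card r else 0)"
    by (rule sum.swap)
  also have "\<dots> = (\<Sum>\<tau>\<in>{\<tau> \<in> Cl. P \<tau>}. \<Sum>r\<in>Pow (agree j \<tau>). w ^ card r)"
  proof (rule sum.cong[OF refl])
    fix \<tau>
    have "Pow {..<j} \<inter> {r. r \<subseteq> agree j \<tau>} = Pow (agree j \<tau>)" by (auto simp: agree_def)
    then show "(\<Sum>r\<in>Pow {..<j}. if r \<subseteq> agree j \<tau> then w ^ card r else 0) = (\<Sum>r\<in>Pow (agree j \<tau>). w ^ card r)"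
      by (simp add: sum.If_cases)
  qed
  also have "\<dots> = (\<Sum>\<tau>\<in>{\<tau> \<in> Cl. P \<tau>}. (1 + w) ^ card (agree j \<tau>))"
    by (intro sum.cong refl sum_power_card_Pow) (simp add: agree_def)
  finally show ?thesis .
qed

lemma sum_rwt_all: "0 \<le> w \<Longrightarrow> (\<Sum>r\<in>Pow {..<j}. rwt w r) = (\<Sum>\<tau>\<in>Cl. (1 + w) ^ card (agree j \<tau>))"
  using sum_rwt_colourings[where w = w and j = j and P = "\<lambda>_. True"] by (simp add: rwt_def num_def)

end

text \<open>Bernoulli's inequality (1 + w / q)^q >= 1 + w. It compares the energy of an edge at
  uniform frequencies with the factor 1 + w / q by which a new edge multiplies the bound for small
  configurations.\<close>

lemma ln_one_plus_div_le:
  fixes w :: real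
  assumes "0 \<le> w" "q > 0"
  shows "exp (ln (1 + w) / real q) \<le> 1 + w / real q"
proof -
  have nn: "0 \<le> w / real q" using assms by simp
  have "1 + w = 1 + real q * (w / real q)" using assms by simp
  also have "\<dots> \<le> (1 + w / real q) ^ q" using nn by (intro Bernoulli_inequality) auto
  finally have "ln (1 + w) \<le> ln ((1 + w / real q) ^ q)" using assms by (intro ln_mono) auto
  also have "\<dots> = real q * ln (1 + w / real q)" using nn by (simp add: ln_realpow)
  finally have "ln (1 + w) / real q \<le> ln (1 + w / real q)" using assms by (simp add: field_simps)
  then have "exp (ln (1 + w) / real q) \<le> exp (ln (1 + w / real q))" by simp
  then show ?thesis using nn by simp
qed

text \<open>The parameter \<open>bb\<close> is the coupling per vertex. It is below \<open>\<kappa>\<close>, half the curvature of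
  the entropy in the region \<open>imbalance \<le> \<theta>\<close>. The bound \<open>upper\<close> compares the number of monochromatic
  edges with its mean for the given colour frequencies.\<close>
locale pseudorandom = edge_list +
  fixes M :: nat and w \<beta> bb \<delta> \<theta> x \<kappa> :: real
  assumes w: "0 < w" and \<beta>_def: "\<beta> = ln (1 + w)" and \<beta>M: "\<beta> * real M = bb * real N"
    and \<delta>: "0 \<le> \<delta>" and x: "0 < x" "1 \<le> x * real N" "2 * real q * x \<le> \<theta>"
    and \<kappa>_def: "\<kappa> = real q / (2 * (1 + real q * sqrt \<theta>))" and bb: "bb \<le> \<kappa>"
    and upper: "\<And>j \<tau>. j \<le> M \<Longrightarrow> \<tau> \<in> colourings {..<N} q \<Longrightarrow>
      real (card (agree j \<tau>)) \<le> real j * (1 / real q + imbalance N q \<tau>) + \<delta> * real M"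
begin

lemma \<beta>_pos: "0 < \<beta>" using w by (simp add: \<beta>_def)

text \<open>Beyond uniform frequencies and the error term the energy is at most \<open>bb\<close> N
  Y. It is split into \<kappa> N Y, which the entropy absorbs, minus (\<kappa> - \<open>bb\<close>)
  N Y, an exponential gain once Y >= t.\<close>

lemma power_agree_le:
  assumes "j \<le> M" "\<tau> \<in> Cl" "t \<le> Y \<tau>"
  shows "(1 + w) ^ card (agree j \<tau>)
    \<le> exp (\<beta> * real j / real q + bb * \<delta> * real N - (\<kappa> - bb) * t * real N) * exp (\<kappa> * real N * Y \<tau>)"
proof -
  have Y: "0 \<le> Y \<tau>" by (rule imbalance_nonneg)
  have "(1 + w) ^ card (agree j \<tau>) = exp (real (card (agree j \<tau>)) * \<beta>)"
    using w by (simp add: \<beta>_def exp_of_nat_mult)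
  also have "\<dots> \<le> exp (\<beta> * real j / real q + bb * \<delta> * real N - (\<kappa> - bb) * t * real N + \<kappa> * real N * Y \<tau>)"
  proof -
    have "real (card (agree j \<tau>)) * \<beta> \<le> (real j * (1 / real q + Y \<tau>) + \<delta> * real M) * \<beta>"
      using upper[OF assms(1,2)] \<beta>_pos by (intro mult_right_mono) auto
    also have "\<dots> = \<beta> * real j / real q + (\<beta> * real j) * Y \<tau> + \<delta> * (\<beta> * real M)"
      by (simp add: algebra_simps)
    also have "(\<beta> * real j) * Y \<tau> \<le> (\<beta> * real M) * Y \<tau>"
      using assms(1) \<beta>_pos Y by (intro mult_right_mono mult_left_mono) auto
    finally have 1: "real (card (agree j \<tau>)) * \<beta> \<le> \<beta> * real j / real q + bb * real N * Y \<tau> + \<delta> * (bb * real N)"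
      by (simp add: \<beta>M)
    have "((\<kappa> - bb) * real N) * t \<le> ((\<kappa> - bb) * real N) * Y \<tau>"
      using bb assms(3) by (intro mult_left_mono) auto
    then show ?thesis using 1 by (simp add: algebra_simps)
  qed
  finally show ?thesis by (simp only: exp_add)
qed

lemma sum_power_agree_le:
  assumes j: "j \<le> M"
  shows "(\<Sum>\<tau>\<in>{\<tau> \<in> Cl. t \<le> Y \<tau> \<and> Y \<tau> \<le> \<theta>}. (1 + w) ^ card (agree j \<tau>))
    \<le> exp (\<beta> * real j / real q + bb * \<delta> * real N - (\<kappa> - bb) * t * real N) * (real q ^ N * (real N + 1) ^ q)"
proof -
  let ?e = "exp (\<beta> * real j / real q + bb * \<delta> * real N - (\<kappa> - bb) * t * real N)"
  have "(\<Sum>\<tau>\<in>{\<tau> \<in> Cl. t \<le> Y \<tau> \<and> Y \<tau> \<le> \<theta>}. (1 + w) ^ card (agree j \<tau>))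
      \<le> (\<Sum>\<tau>\<in>{\<tau> \<in> Cl. t \<le> Y \<tau> \<and> Y \<tau> \<le> \<theta>}. ?e * exp (\<kappa> * real N * Y \<tau>))"
    using power_agree_le[OF j] by (intro sum_mono) auto
  also have "\<dots> \<le> (\<Sum>\<tau>\<in>{\<tau> \<in> Cl. Y \<tau> \<le> \<theta>}. ?e * exp (\<kappa> * real N * Y \<tau>))"
    by (intro sum_mono2) auto
  also have "\<dots> = ?e * (\<Sum>\<tau>\<in>{\<tau> \<in> Cl. Y \<tau> \<le> \<theta>}. exp (\<kappa> * real N * Y \<tau>))"
    by (simp add: sum_distrib_left)
  also have "\<dots> \<le> ?e * (real q ^ N * (real N + 1) ^ q)"
    using sum_exp_imbalance_le[OF N_pos, of q \<theta>] q_ge_2 unfolding \<kappa>_def by (intro mult_left_mono) auto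
  finally show ?thesis .
qed

text \<open>Bound for the critical weight relative to the uniform phase: 2 q from
  \<open>num_le_critical\<close>, the polynomial from counting frequency vectors, and in the
  exponent the least imbalance (x / 6)^2 of the window against the error of
  \<open>upper\<close>.\<close>

definition \<epsilon> :: real where
  "\<epsilon> = 2 * real q * (real N + 1) ^ q * exp (bb * \<delta> * real N - (\<kappa> - bb) * (x / 6)\<^sup>2 * real N)"

lemma \<epsilon>_pos: "0 < \<epsilon>" using q_ge_2 by (simp add: \<epsilon>_def)

definition critical :: "nat \<Rightarrow> nat set set" where
  "critical j = {r \<in> Pow {..<j}. small x r \<and> \<not> small (x / 3) r}"

definition smalls :: "nat \<Rightarrow> nat set set" where
  "smalls j = {r \<in> Pow {..<j}. small x r}"

lemma sum_critical_le:
  assumes j: "j \<le> M"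
  shows "(\<Sum>r\<in>critical j. rwt w r) \<le> \<epsilon> * real q ^ N * exp (\<beta> * real j / real q)"
proof -
  let ?mid = "\<lambda>r. {\<tau> \<in> compat {..<N} q (rel r). (x / 6)\<^sup>2 \<le> Y \<tau> \<and> Y \<tau> \<le> \<theta>}"
  have "(\<Sum>r\<in>critical j. rwt w r) \<le> (\<Sum>r\<in>critical j. 2 * real q * (w ^ card r * real (card (?mid r))))"
  proof (rule sum_mono)
    fix r assume "r \<in> critical j"
    then have "num r \<le> 2 * real q * real (card (?mid r))"
      using x unfolding critical_def by (intro num_le_critical) auto
    then have "w ^ card r * num r \<le> w ^ card r * (2 * real q * real (card (?mid r)))"
      using w by (intro mult_left_mono) auto
    then show "rwt w r \<le> 2 * real q * (w ^ card r * real (card (?mid r)))"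
      by (simp add: rwt_def mult_ac)
  qed
  also have "\<dots> \<le> (\<Sum>r\<in>Pow {..<j}. 2 * real q * (w ^ card r * real (card (?mid r))))"
    using w by (intro sum_mono2) (auto simp: critical_def)
  also have "\<dots> = 2 * real q * (\<Sum>\<tau>\<in>{\<tau> \<in> Cl. (x / 6)\<^sup>2 \<le> Y \<tau> \<and> Y \<tau> \<le> \<theta>}. (1 + w) ^ card (agree j \<tau>))"
    using w by (simp only: sum_distrib_left[symmetric] sum_rwt_colourings less_imp_le)
  also have "\<dots> \<le> 2 * real q * (exp (\<beta> * real j / real q + bb * \<delta> * real N - (\<kappa> - bb) * (x / 6)\<^sup>2 * real N)
      * (real q ^ N * (real N + 1) ^ q))"
    by (intro mult_left_mono sum_power_agree_le[OF j]) auto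
  also have "exp (\<beta> * real j / real q + bb * \<delta> * real N - (\<kappa> - bb) * (x / 6)\<^sup>2 * real N)
      = exp (\<beta> * real j / real q) * exp (bb * \<delta> * real N - (\<kappa> - bb) * (x / 6)\<^sup>2 * real N)"
    by (simp only: exp_add[symmetric]) (simp add: algebra_simps)
  finally show ?thesis by (simp add: \<epsilon>_def mult_ac)
qed

text \<open>By Markov's inequality at least half of the colourings of a small configuration have
  imbalance at most \<theta>, so the frequency estimate applies, here with t = 0. Up to the \<delta>
  error and the polynomial factor this is the free energy of the uniform phase.\<close>

lemma sum_smalls_le:
  "(\<Sum>r\<in>smalls M. rwt w r)
    \<le> 2 * (real N + 1) ^ q * exp (real N * (ln (real q) + bb / real q + bb * \<delta>))"
proof -
  let ?lo = "\<lambda>r. {\<tau> \<in> compat {..<N} q (rel r). 0 \<le> Y \<tau> \<and> Y \<tau> \<le> \<theta>}"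
  have "0 < 2 * real q * x" using x q_ge_2 by simp
  then have \<theta>: "0 < \<theta>" using x by linarith
  have "(\<Sum>r\<in>smalls M. rwt w r) \<le> (\<Sum>r\<in>smalls M. 2 * (w ^ card r * real (card (?lo r))))"
  proof (rule sum_mono)
    fix r assume r: "r \<in> smalls M"
    have "real (card {\<tau> \<in> compat {..<N} q (rel r). \<theta> < Y \<tau>}) \<le> num r * x / \<theta>"
      using r \<theta> by (intro card_imbalance_gt) (auto simp: smalls_def)
    also have "\<dots> = num r * (x / \<theta>)" by simp
    also have "\<dots> \<le> num r * (1 / 2)"
    proof -
      have "2 * x \<le> 2 * real q * x" using x q_ge_2 by simp
      then have "x / \<theta> \<le> 1 / 2" using x(3) \<theta> by (simp add: field_simps)
      then show ?thesis using num_pos[of r] by (intro mult_left_mono) auto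
    qed
    finally have hi: "real (card {\<tau> \<in> compat {..<N} q (rel r). \<theta> < Y \<tau>}) \<le> num r / 2" by simp
    have "card (compat {..<N} q (rel r)) \<le> card (?lo r \<union> {\<tau> \<in> compat {..<N} q (rel r). \<theta> < Y \<tau>})"
      by (intro card_mono) (auto simp: imbalance_nonneg)
    also have "\<dots> \<le> card (?lo r) + card {\<tau> \<in> compat {..<N} q (rel r). \<theta> < Y \<tau>}" by (rule card_Un_le)
    finally have "num r \<le> real (card (?lo r)) + real (card {\<tau> \<in> compat {..<N} q (rel r). \<theta> < Y \<tau>})"
      by (simp add: num_def)
    then have "num r \<le> 2 * real (card (?lo r))" using hi by linarith
    then have "w ^ card r * num r \<le> w ^ card r * (2 * real (card (?lo r)))"
      using w by (intro mult_left_mono) auto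
    then show "rwt w r \<le> 2 * (w ^ card r * real (card (?lo r)))" by (simp add: rwt_def mult_ac)
  qed
  also have "\<dots> \<le> (\<Sum>r\<in>Pow {..<M}. 2 * (w ^ card r * real (card (?lo r))))"
    using w by (intro sum_mono2) (auto simp: smalls_def)
  also have "\<dots> = 2 * (\<Sum>\<tau>\<in>{\<tau> \<in> Cl. 0 \<le> Y \<tau> \<and> Y \<tau> \<le> \<theta>}. (1 + w) ^ card (agree M \<tau>))"
    using w by (simp only: sum_distrib_left[symmetric] sum_rwt_colourings less_imp_le)
  also have "\<dots> \<le> 2 * (exp (\<beta> * real M / real q + bb * \<delta> * real N - (\<kappa> - bb) * 0 * real N) * (real q ^ N * (real N + 1) ^ q))"
    by (intro mult_left_mono sum_power_agree_le) auto
  also have "real q ^ N = exp (real N * ln (real q))" using q_ge_2 by (simp add: exp_of_nat_mult)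
  also have "2 * (exp (\<beta> * real M / real q + bb * \<delta> * real N - (\<kappa> - bb) * 0 * real N) * (exp (real N * ln (real q)) * (real N + 1) ^ q))
      = 2 * (real N + 1) ^ q * (exp (\<beta> * real M / real q + bb * \<delta> * real N) * exp (real N * ln (real q)))"
    by simp
  also have "exp (\<beta> * real M / real q + bb * \<delta> * real N) * exp (real N * ln (real q))
      = exp (real N * (ln (real q) + bb / real q + bb * \<delta>))"
    unfolding \<beta>M exp_add[symmetric] by (simp add: algebra_simps)
  finally show ?thesis .
qed

text \<open>A small configuration that ceases to be small when j is opened is critical by
  \<open>small_insert\<close>; for all others opening j keeps them small and multiplies the weight
  by at least w / q.\<close>

lemma smalls_Suc:
  "(\<Sum>r\<in>smalls (Suc j). rwt w r) \<ge> (1 + w / real q) * (\<Sum>r\<in>smalls j. rwt w r) - w / real q * (\<Sum>r\<in>critical j. rwt w r)"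
proof -
  let ?I = "{r \<in> Pow {..<j}. small x (insert j r)}"
  have fin: "finite (smalls j)" "finite ?I" "finite (critical j)" by (auto simp: smalls_def critical_def)
  have inj: "inj_on (insert j) ?I" by (rule inj_onI) (auto simp: insert_ident)
  have "Pow {..<Suc j} = Pow {..<j} \<union> insert j ` Pow {..<j}" by (simp add: lessThan_Suc Pow_insert)
  then have split: "smalls (Suc j) = smalls j \<union> insert j ` ?I" by (auto simp: smalls_def)
  have disj: "smalls j \<inter> insert j ` ?I = {}" by (auto simp: smalls_def)
  have "(\<Sum>r\<in>smalls j. rwt w r) \<le> (\<Sum>r\<in>?I \<union> critical j. rwt w r)"
  proof (rule sum_mono2)
    show "smalls j \<subseteq> ?I \<union> critical j" using small_insert[of x] by (auto simp: smalls_def critical_def)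
  qed (use fin rwt_nonneg w in auto)
  also have "\<dots> \<le> (\<Sum>r\<in>?I. rwt w r) + (\<Sum>r\<in>critical j. rwt w r)"
    using fin rwt_nonneg w by (subst sum_Un) (auto intro!: sum_nonneg)
  finally have "w / real q * ((\<Sum>r\<in>smalls j. rwt w r) - (\<Sum>r\<in>critical j. rwt w r)) \<le> w / real q * (\<Sum>r\<in>?I. rwt w r)"
    using w by (intro mult_left_mono) auto
  also have "\<dots> = (\<Sum>r\<in>?I. w / real q * rwt w r)" by (simp add: sum_distrib_left)
  also have "\<dots> \<le> (\<Sum>r\<in>?I. rwt w (insert j r))"
  proof (rule sum_mono)
    fix r assume "r \<in> ?I"
    then have c: "card (insert j r) = Suc (card r)"
      by (intro card_insert_disjoint) (auto intro: finite_subset)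
    have "w ^ card r * w * (num r / real q) \<le> w ^ card r * w * num (insert j r)"
      using num_insert[of r j] w q_ge_2 by (intro mult_left_mono) (auto simp: field_simps)
    then show "w / real q * rwt w r \<le> rwt w (insert j r)" by (simp add: rwt_def c mult_ac)
  qed
  also have "\<dots> = (\<Sum>r\<in>insert j ` ?I. rwt w r)" by (subst sum.reindex[OF inj]) simp
  finally have "w / real q * ((\<Sum>r\<in>smalls j. rwt w r) - (\<Sum>r\<in>critical j. rwt w r)) \<le> (\<Sum>r\<in>insert j ` ?I. rwt w r)" .
  moreover have "(\<Sum>r\<in>smalls (Suc j). rwt w r) = (\<Sum>r\<in>smalls j. rwt w r) + (\<Sum>r\<in>insert j ` ?I. rwt w r)"
    unfolding split using fin disj by (intro sum.union_disjoint) auto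
  ultimately show ?thesis by (simp add: algebra_simps)
qed

text \<open>Each new edge multiplies the bound by 1 + w / q and loses at most a share \<epsilon>,
  since the critical weight at stage j is at most \<epsilon> q^N (1 + w / q)^j. This is where
  \<open>upper\<close> is used at every prefix length j.\<close>

lemma smalls_ge:
  "j \<le> M \<Longrightarrow> real q ^ N * (1 + w / real q) ^ j * (1 - real j * \<epsilon>) \<le> (\<Sum>r\<in>smalls j. rwt w r)"
proof (induction j)
  case 0
  \<comment> \<open>Singletons are small because 1 <= x N.\<close>
  have "smalls 0 = {{}}"
    using x by (auto simp: smalls_def small_def rel_def)
  moreover have "num {} = real q ^ N"
    by (simp add: num_def rel_def colourings_def card_PiE)
  ultimately show ?case by (simp add: rwt_def)
next
  case (Suc j)
  let ?g = "1 + w / real q"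
  let ?A = "real q ^ N * ?g ^ j"
  have g: "0 < ?g" "w / real q \<le> ?g" using w q_ge_2 by (auto intro!: add_pos_nonneg)
  have "exp (\<beta> * real j / real q) = exp (\<beta> / real q) ^ j"
    by (simp flip: exp_of_nat_mult add: mult_ac)
  also have "\<dots> \<le> ?g ^ j"
    using ln_one_plus_div_le[of w q] w q_ge_2 unfolding \<beta>_def by (intro power_mono) auto
  finally have e: "exp (\<beta> * real j / real q) \<le> ?g ^ j" .
  have "(\<Sum>r\<in>critical j. rwt w r) \<le> \<epsilon> * real q ^ N * exp (\<beta> * real j / real q)"
    using Suc.prems by (intro sum_critical_le) auto
  also have "\<dots> \<le> \<epsilon> * real q ^ N * ?g ^ j" using e \<epsilon>_pos by (intro mult_left_mono) auto
  finally have "w / real q * (\<Sum>r\<in>critical j. rwt w r) \<le> ?g * (\<epsilon> * real q ^ N * ?g ^ j)"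
    using g w \<epsilon>_pos rwt_nonneg[of w] by (intro mult_mono sum_nonneg) auto
  then have c: "w / real q * (\<Sum>r\<in>critical j. rwt w r) \<le> ?g * ?A * \<epsilon>" by (simp add: mult_ac)
  have "?g * (?A * (1 - real j * \<epsilon>)) \<le> ?g * (\<Sum>r\<in>smalls j. rwt w r)"
    using Suc g by (intro mult_left_mono) auto
  moreover have "real q ^ N * ?g ^ Suc j * (1 - real (Suc j) * \<epsilon>) = ?g * (?A * (1 - real j * \<epsilon>)) - ?g * ?A * \<epsilon>"
    by (simp only: power_Suc of_nat_Suc) (simp only: algebra_simps)
  ultimately show ?case using smalls_Suc[of j] c by linarith
qed

lemma critical_le_smalls:
  assumes "real M * \<epsilon> \<le> 1 / 2"
  shows "(\<Sum>r\<in>critical M. rwt w r) \<le> 2 * \<epsilon> * (\<Sum>r\<in>smalls M. rwt w r)"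
proof -
  let ?g = "1 + w / real q"
  have g: "0 < ?g" using w q_ge_2 by (auto intro!: add_pos_nonneg)
  have "exp (\<beta> * real M / real q) = exp (\<beta> / real q) ^ M"
    by (simp flip: exp_of_nat_mult add: mult_ac)
  also have "\<dots> \<le> ?g ^ M"
    using ln_one_plus_div_le[of w q] w q_ge_2 unfolding \<beta>_def by (intro power_mono) auto
  finally have e: "exp (\<beta> * real M / real q) \<le> ?g ^ M" .
  have "(\<Sum>r\<in>critical M. rwt w r) \<le> \<epsilon> * real q ^ N * exp (\<beta> * real M / real q)"
    by (intro sum_critical_le) auto
  also have "\<dots> \<le> \<epsilon> * real q ^ N * ?g ^ M" using e \<epsilon>_pos by (intro mult_left_mono) auto
  also have "\<dots> = 2 * \<epsilon> * (real q ^ N * ?g ^ M * (1 / 2))" by simp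
  also have "\<dots> \<le> 2 * \<epsilon> * (real q ^ N * ?g ^ M * (1 - real M * \<epsilon>))"
    using assms \<epsilon>_pos g by (intro mult_left_mono) auto
  also have "\<dots> \<le> 2 * \<epsilon> * (\<Sum>r\<in>smalls M. rwt w r)"
    using smalls_ge[of M] \<epsilon>_pos by (intro mult_left_mono) auto
  finally show ?thesis .
qed

end

section \<open>Lower bound on the partition function\<close>

context edge_list
begin

text \<open>Gibbs' variational principle, with the product measure of a vector \<open>m\<close> of colour
  probabilities as the trial measure.\<close>
lemma partition_function_ge:
  fixes m :: "nat \<Rightarrow> real" and w :: real
  assumes m: "\<And>c. c \<in> {1..q} \<Longrightarrow> 0 < m c" "(\<Sum>c\<in>{1..q}. m c) = 1" and w: "0 \<le> w"
  shows "exp (ln (1 + w) * real M * (\<Sum>c\<in>{1..q}. (m c)\<^sup>2) - real N * (\<Sum>c\<in>{1..q}. m c * ln (m c)))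
    \<le> (\<Sum>\<tau>\<in>Cl. (1 + w) ^ card (agree M \<tau>))"
proof -
  define \<beta> where "\<beta> = ln (1 + w)"
  have \<beta>: "0 \<le> \<beta>" using w by (simp add: \<beta>_def)
  define P where "P \<tau> = (\<Prod>v<N. m (\<tau> v))" for \<tau> :: "nat \<Rightarrow> nat"
  define g where "g \<tau> = \<beta> * real (card (agree M \<tau>)) - (\<Sum>v<N. ln (m (\<tau> v)))" for \<tau>
  have mc: "0 < m (\<tau> v)" if "\<tau> \<in> Cl" "v < N" for \<tau> v
    using that by (intro m(1)) (auto simp: colourings_def PiE_iff)
  have P_pos: "0 < P \<tau>" if "\<tau> \<in> Cl" for \<tau>
    unfolding P_def using mc[OF that] by (intro prod_pos) auto
  have prod: "(\<Sum>\<tau>\<in>Cl. P \<tau> * (\<Prod>v<N. \<phi> v (\<tau> v))) = (\<Prod>v<N. \<Sum>c\<in>{1..q}. m c * \<phi> v c)" for \<phi>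
  proof -
    have "(\<Prod>v<N. \<Sum>c\<in>{1..q}. m c * \<phi> v c) = (\<Sum>\<tau>\<in>Cl. \<Prod>v<N. m (\<tau> v) * \<phi> v (\<tau> v))"
      unfolding colourings_def by (intro prod_sum_PiE) auto
    then show ?thesis by (simp add: P_def prod.distrib)
  qed
  have P_1: "(\<Sum>\<tau>\<in>Cl. P \<tau>) = 1"
    using prod[of "\<lambda>_ _. 1"] m(2) by simp
  have single: "(\<Sum>\<tau>\<in>Cl. P \<tau> * f (\<tau> u)) = (\<Sum>c\<in>{1..q}. m c * f c)" if u: "u < N" for u f
  proof -
    have "(\<Sum>\<tau>\<in>Cl. P \<tau> * f (\<tau> u)) = (\<Sum>\<tau>\<in>Cl. P \<tau> * (\<Prod>v<N. if v = u then f (\<tau> v) else 1))"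
      using u by (intro sum.cong refl) (simp add: prod.delta)
    also have "\<dots> = (\<Prod>v<N. \<Sum>c\<in>{1..q}. m c * (if v = u then f c else 1))"
      by (rule prod[of "\<lambda>v c. if v = u then f c else 1"])
    also have "\<dots> = (\<Prod>v<N. if v = u then \<Sum>c\<in>{1..q}. m c * f c else 1)"
      using m(2) by (intro prod.cong refl) auto
    also have "\<dots> = (\<Sum>c\<in>{1..q}. m c * f c)" using u by (simp add: prod.delta)
    finally show ?thesis .
  qed
  \<comment> \<open>For distinct vertices equality holds; the ends of a loop always agree, and the
    sum of squares is at most 1.\<close>
  have pair: "(\<Sum>c\<in>{1..q}. (m c)\<^sup>2) \<le> (\<Sum>\<tau>\<in>Cl. P \<tau> * (if \<tau> u = \<tau> v then 1 else 0))"
    if u: "u < N" and v: "v < N" for u v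
  proof (cases "u = v")
    case True
    have "(\<Sum>c\<in>{1..q}. (m c)\<^sup>2) \<le> (\<Sum>c\<in>{1..q}. m c)"
    proof (rule sum_mono)
      fix c assume c: "c \<in> {1..q}"
      have "m c \<le> (\<Sum>c\<in>{1..q}. m c)"
        using m(1) by (intro member_le_sum[OF c]) (auto intro: less_imp_le)
      then show "(m c)\<^sup>2 \<le> m c"
        using m(1)[OF c] m(2) by (simp add: power2_eq_square mult_left_le)
    qed
    then show ?thesis using True P_1 m(2) by simp
  next
    case False
    have "(\<Sum>\<tau>\<in>Cl. P \<tau> * (if \<tau> u = c \<and> \<tau> v = c then 1 else 0)) = (m c)\<^sup>2" if c: "c \<in> {1..q}" for c
    proof -
      let ?\<phi> = "\<lambda>y d. if y = u \<or> y = v then (if d = c then 1 else 0) else 1 :: real"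
      have "(\<Prod>y<N. ?\<phi> y (\<tau> y)) = (if \<tau> u = c \<and> \<tau> v = c then 1 else 0)" for \<tau>
      proof -
        have "(\<Prod>y<N. ?\<phi> y (\<tau> y)) = (\<Prod>y\<in>{u, v}. ?\<phi> y (\<tau> y))"
          using u v by (intro prod.mono_neutral_right) auto
        then show ?thesis using False by simp
      qed
      then have "(\<Sum>\<tau>\<in>Cl. P \<tau> * (if \<tau> u = c \<and> \<tau> v = c then 1 else 0))
          = (\<Sum>\<tau>\<in>Cl. P \<tau> * (\<Prod>y<N. ?\<phi> y (\<tau> y)))" by simp
      also have "\<dots> = (\<Prod>y<N. \<Sum>d\<in>{1..q}. m d * ?\<phi> y d)" by (rule prod)
      also have "\<dots> = (\<Prod>y<N. if y = u \<or> y = v then m c else 1)"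
      proof (intro prod.cong refl)
        fix y
        have "(\<Sum>d\<in>{1..q}. m d * (if d = c then 1 else 0)) = m c"
          using c by (simp add: if_distrib sum.delta cong: if_cong)
        then show "(\<Sum>d\<in>{1..q}. m d * ?\<phi> y d) = (if y = u \<or> y = v then m c else 1)"
          using m(2) by auto
      qed
      also have "\<dots> = (\<Prod>y\<in>{u, v}. if y = u \<or> y = v then m c else 1)"
        using u v by (intro prod.mono_neutral_right) auto
      also have "\<dots> = (m c)\<^sup>2" using False by (simp add: power2_eq_square)
      finally show ?thesis .
    qed
    then have "(\<Sum>c\<in>{1..q}. (m c)\<^sup>2) = (\<Sum>c\<in>{1..q}. \<Sum>\<tau>\<in>Cl. P \<tau> * (if \<tau> u = c \<and> \<tau> v = c then 1 else 0))"
      by simp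
    also have "\<dots> = (\<Sum>\<tau>\<in>Cl. \<Sum>c\<in>{1..q}. P \<tau> * (if \<tau> u = c \<and> \<tau> v = c then 1 else 0))"
      by (rule sum.swap)
    also have "\<dots> = (\<Sum>\<tau>\<in>Cl. P \<tau> * (if \<tau> u = \<tau> v then 1 else 0))"
    proof (intro sum.cong refl)
      fix \<tau> assume "\<tau> \<in> Cl"
      then have "\<tau> u \<in> {1..q}" using u by (auto simp: colourings_def PiE_iff)
      then show "(\<Sum>c\<in>{1..q}. P \<tau> * (if \<tau> u = c \<and> \<tau> v = c then 1 else 0)) = P \<tau> * (if \<tau> u = \<tau> v then 1 else 0)"
      proof (cases "\<tau> u = \<tau> v")
        case False
        then have "(\<Sum>c\<in>{1..q}. P \<tau> * (if \<tau> u = c \<and> \<tau> v = c then 1 else 0)) = 0"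
          by (intro sum.neutral) auto
        then show ?thesis using False by simp
      qed (auto simp: sum.delta' if_distrib cong: if_cong)
    qed
    finally show ?thesis by simp
  qed
  define E where "E = (\<Sum>\<tau>\<in>Cl. P \<tau> * g \<tau>)"
  have weight: "(1 + w) ^ card (agree M \<tau>) = P \<tau> * exp (g \<tau>)" if "\<tau> \<in> Cl" for \<tau>
  proof -
    have "P \<tau> = exp (\<Sum>v<N. ln (m (\<tau> v)))"
      unfolding P_def exp_sum[OF finite_lessThan] using mc[OF that] by (intro prod.cong refl) simp
    moreover have "(1 + w) ^ card (agree M \<tau>) = exp (real (card (agree M \<tau>)) * \<beta>)"
      using w by (simp add: \<beta>_def exp_of_nat_mult)
    ultimately show ?thesis by (simp add: g_def exp_diff mult.commute[of \<beta>])
  qed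
  \<comment> \<open>Jensen's inequality by the tangent of exp at the mean E: exp g >= exp E (1 + g -
    E), averaged under P.\<close>
  have "exp E = (\<Sum>\<tau>\<in>Cl. P \<tau> * (exp E * (1 + (g \<tau> - E))))"
  proof -
    have "(\<Sum>\<tau>\<in>Cl. P \<tau> * (exp E * (1 + (g \<tau> - E)))) = (\<Sum>\<tau>\<in>Cl. exp E * (1 - E) * P \<tau> + exp E * (P \<tau> * g \<tau>))"
      by (intro sum.cong refl) (simp add: algebra_simps)
    also have "\<dots> = exp E * (1 - E) * (\<Sum>\<tau>\<in>Cl. P \<tau>) + exp E * E"
      by (simp add: sum.distrib E_def flip: sum_distrib_left)
    finally show ?thesis by (simp add: P_1 algebra_simps)
  qed
  also have "\<dots> \<le> (\<Sum>\<tau>\<in>Cl. P \<tau> * exp (g \<tau>))"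
  proof (intro sum_mono mult_left_mono)
    fix \<tau> assume "\<tau> \<in> Cl"
    have "exp E * (1 + (g \<tau> - E)) \<le> exp E * exp (g \<tau> - E)"
      by (intro mult_left_mono exp_ge_add_one_self) auto
    also have "\<dots> = exp (g \<tau>)" by (simp flip: exp_add)
    finally show "exp E * (1 + (g \<tau> - E)) \<le> exp (g \<tau>)" .
  qed (use P_pos in \<open>auto intro: less_imp_le\<close>)
  also have "\<dots> = (\<Sum>\<tau>\<in>Cl. (1 + w) ^ card (agree M \<tau>))" using weight by simp
  finally have lower: "exp E \<le> (\<Sum>\<tau>\<in>Cl. (1 + w) ^ card (agree M \<tau>))" .
  have "E = \<beta> * (\<Sum>\<tau>\<in>Cl. P \<tau> * real (card (agree M \<tau>))) - (\<Sum>\<tau>\<in>Cl. P \<tau> * (\<Sum>v<N. ln (m (\<tau> v))))"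
    unfolding E_def g_def sum_distrib_left[of \<beta>] sum_subtractf[symmetric]
    by (intro sum.cong refl) (simp add: algebra_simps)
  also have "(\<Sum>\<tau>\<in>Cl. P \<tau> * (\<Sum>v<N. ln (m (\<tau> v)))) = (\<Sum>v<N. \<Sum>\<tau>\<in>Cl. P \<tau> * ln (m (\<tau> v)))"
    unfolding sum_distrib_left by (rule sum.swap)
  also have "\<dots> = real N * (\<Sum>c\<in>{1..q}. m c * ln (m c))"
    using single[of _ "\<lambda>c. ln (m c)"] by simp
  also have "(\<Sum>\<tau>\<in>Cl. P \<tau> * real (card (agree M \<tau>)))
      = (\<Sum>\<tau>\<in>Cl. P \<tau> * (\<Sum>i<M. if \<tau> (a i) = \<tau> (b i) then 1 else 0))"
    by (intro sum.cong refl) (simp add: agree_def sum.If_cases Int_def)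
  also have "\<dots> = (\<Sum>i<M. \<Sum>\<tau>\<in>Cl. P \<tau> * (if \<tau> (a i) = \<tau> (b i) then 1 else 0))"
    unfolding sum_distrib_left by (rule sum.swap)
  finally have E_eq: "E = \<beta> * (\<Sum>i<M. \<Sum>\<tau>\<in>Cl. P \<tau> * (if \<tau> (a i) = \<tau> (b i) then 1 else 0))
      - real N * (\<Sum>c\<in>{1..q}. m c * ln (m c))" .
  have "(\<Sum>i<M. \<Sum>c\<in>{1..q}. (m c)\<^sup>2) \<le> (\<Sum>i<M. \<Sum>\<tau>\<in>Cl. P \<tau> * (if \<tau> (a i) = \<tau> (b i) then 1 else 0))"
    using pair ends by (intro sum_mono) auto
  then have "\<beta> * (real M * (\<Sum>c\<in>{1..q}. (m c)\<^sup>2)) \<le> \<beta> * (\<Sum>i<M. \<Sum>\<tau>\<in>Cl. P \<tau> * (if \<tau> (a i) = \<tau> (b i) then 1 else 0))"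
    using \<beta> by (intro mult_left_mono) auto
  then have "exp (\<beta> * real M * (\<Sum>c\<in>{1..q}. (m c)\<^sup>2) - real N * (\<Sum>c\<in>{1..q}. m c * ln (m c))) \<le> exp E"
    unfolding E_eq by (simp add: mult.assoc)
  from order_trans[OF this lower] show ?thesis unfolding \<beta>_def .
qed

end

section \<open>Concentration for random edge lists\<close>

lemma exp_le_quadratic:
  fixes y :: real
  assumes "\<bar>y\<bar> \<le> 1"
  shows "exp y \<le> 1 + y + y\<^sup>2"
proof (cases "0 \<le> y")
  case True
  then show ?thesis using assms by (intro exp_bound) auto
next
  case False
  define z where "z = - y"
  have z: "0 \<le> z" using False by (simp add: z_def)
  have "1 \<le> (1 - z + z\<^sup>2) * (1 + z + z\<^sup>2 / 2)"
  proof -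
    have "(1 - z + z\<^sup>2) * (1 + z + z\<^sup>2 / 2) = 1 + z\<^sup>2 / 2 + z ^ 3 / 2 + z ^ 4 / 2"
      by (simp add: field_simps power2_eq_square power3_eq_cube power4_eq_xxxx)
    then show ?thesis using z by simp
  qed
  also have "\<dots> \<le> (1 - z + z\<^sup>2) * exp z"
  proof (rule mult_left_mono)
    show "1 + z + z\<^sup>2 / 2 \<le> exp z" by (rule exp_lower_Taylor_quadratic[OF z])
    have "0 \<le> (1 - z / 2)\<^sup>2 + 3 / 4 * z\<^sup>2" by simp
    then show "0 \<le> 1 - z + z\<^sup>2" by (simp add: power2_eq_square field_simps)
  qed
  finally have "exp y * 1 \<le> exp y * ((1 - z + z\<^sup>2) * exp z)" by (intro mult_left_mono) auto
  also have "\<dots> = (1 - z + z\<^sup>2) * (exp y * exp z)" by simp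
  also have "exp y * exp z = 1" by (simp add: z_def flip: exp_add)
  finally show ?thesis by (simp add: z_def)
qed

text \<open>The edges are chosen independently and uniformly among the ordered pairs of vertices, with a
  union bound over the colourings and the prefixes of the edge list.\<close>
lemma exists_pseudorandom:
  assumes N: "N > 0" and q: "q > 0" and \<delta>: "0 < \<delta>" "\<delta> \<le> 2"
    and few: "(real M + 1) * real q ^ N * exp (- (\<delta>\<^sup>2 * real M / 4)) < 1"
  obtains a b :: "nat \<Rightarrow> nat" where "\<And>i. a i < N" "\<And>i. b i < N"
    "\<And>j \<tau>. j \<le> M \<Longrightarrow> \<tau> \<in> colourings {..<N} q \<Longrightarrow>
      real (card {i \<in> {..<j}. \<tau> (a i) = \<tau> (b i)}) \<le> real j * (1 / real q + imbalance N q \<tau>) + \<delta> * real M"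
proof -
  let ?Cl = "colourings {..<N} q"
  let ?E = "{..<N} \<times> {..<N}"
  let ?\<Omega> = "{..<M} \<rightarrow>\<^sub>E ?E"
  \<comment> \<open>The minimiser of s^2 - s \<delta>, which gives the exponent -\<delta>^2 / 4;
    \<delta> <= 2 keeps s <= 1, the range in which \<open>exp_le_quadratic\<close> applies.\<close>
  define s where "s = \<delta> / 2"
  have s: "0 < s" "s \<le> 1" using \<delta> by (auto simp: s_def)
  define \<rho> where "\<rho> \<tau> = 1 / real q + imbalance N q \<tau>" for \<tau>
  define ind where "ind \<tau> e = (if \<tau> (fst e) = \<tau> (snd e) then 1 else 0 :: real)" for \<tau> :: "nat \<Rightarrow> nat" and e :: "nat \<times> nat"
  define X where "X h j \<tau> = (\<Sum>i<j. ind \<tau> (h i))" for h :: "nat \<Rightarrow> nat \<times> nat" and j \<tau>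
  have \<rho>: "(\<Sum>e\<in>?E. ind \<tau> e) = (real N)\<^sup>2 * \<rho> \<tau>" if "\<tau> \<in> ?Cl" for \<tau>
    using imbalance_eq[OF that N q] N
    by (simp add: \<rho>_def ind_def sum.cartesian_product case_prod_unfold)
  have moment: "(\<Sum>e\<in>?E. exp (s * (ind \<tau> e - \<rho> \<tau>))) \<le> (real N)\<^sup>2 * exp (s\<^sup>2)" if \<tau>: "\<tau> \<in> ?Cl" for \<tau>
  proof -
    have card_E: "real (card ?E) = (real N)\<^sup>2" by (simp add: power2_eq_square)
    have "(\<Sum>e\<in>?E. ind \<tau> e) \<le> (\<Sum>e\<in>?E. 1)" by (intro sum_mono) (simp add: ind_def)
    then have "(real N)\<^sup>2 * \<rho> \<tau> \<le> (real N)\<^sup>2 * 1" using \<rho>[OF \<tau>] card_E by simp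
    then have \<rho>_1: "\<rho> \<tau> \<le> 1" by (rule mult_left_le_imp_le) (use N in simp)
    have \<rho>_0: "0 \<le> \<rho> \<tau>" using imbalance_nonneg[of N q \<tau>] by (simp add: \<rho>_def)
    have dev: "\<bar>ind \<tau> e - \<rho> \<tau>\<bar> \<le> 1" for e using \<rho>_0 \<rho>_1 by (simp add: ind_def)
    have "(\<Sum>e\<in>?E. exp (s * (ind \<tau> e - \<rho> \<tau>))) \<le> (\<Sum>e\<in>?E. (1 + s\<^sup>2) + s * (ind \<tau> e - \<rho> \<tau>))"
    proof (rule sum_mono)
      fix e
      have "\<bar>s * (ind \<tau> e - \<rho> \<tau>)\<bar> \<le> 1"
        using s dev[of e] by (simp add: abs_mult mult_le_one)
      then have "exp (s * (ind \<tau> e - \<rho> \<tau>)) \<le> 1 + s * (ind \<tau> e - \<rho> \<tau>) + (s * (ind \<tau> e - \<rho> \<tau>))\<^sup>2"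
        by (rule exp_le_quadratic)
      moreover have "(s * (ind \<tau> e - \<rho> \<tau>))\<^sup>2 \<le> s\<^sup>2 * 1"
        using dev[of e] unfolding power_mult_distrib by (intro mult_left_mono) (auto simp: abs_square_le_1)
      ultimately show "exp (s * (ind \<tau> e - \<rho> \<tau>)) \<le> (1 + s\<^sup>2) + s * (ind \<tau> e - \<rho> \<tau>)" by linarith
    qed
    also have "\<dots> = real (card ?E) * (1 + s\<^sup>2) + s * ((\<Sum>e\<in>?E. ind \<tau> e) - real (card ?E) * \<rho> \<tau>)"
      by (simp add: sum.distrib sum_subtractf flip: sum_distrib_left)
    also have "\<dots> = (real N)\<^sup>2 * (1 + s\<^sup>2)" unfolding \<rho>[OF \<tau>] card_E by simp
    also have "\<dots> \<le> (real N)\<^sup>2 * exp (s\<^sup>2)"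
      by (intro mult_left_mono exp_ge_add_one_self) auto
    finally show ?thesis .
  qed
  have chernoff: "(\<Sum>h\<in>?\<Omega>. exp (s * (X h j \<tau> - real j * \<rho> \<tau>))) \<le> ((real N)\<^sup>2) ^ M * exp (s\<^sup>2 * real M)"
    if \<tau>: "\<tau> \<in> ?Cl" and j: "j \<le> M" for j \<tau>
  proof -
    \<comment> \<open>Indices from j on contribute a factor 1, so that the product runs over all of
      {..<M} and the sum over edge lists factorises.\<close>
    have "exp (s * (X h j \<tau> - real j * \<rho> \<tau>)) = (\<Prod>i<M. if i < j then exp (s * (ind \<tau> (h i) - \<rho> \<tau>)) else 1)" for h
    proof -
      have "(\<Prod>i<M. if i < j then exp (s * (ind \<tau> (h i) - \<rho> \<tau>)) else 1) = (\<Prod>i<j. exp (s * (ind \<tau> (h i) - \<rho> \<tau>)))"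
        using j by (intro prod.mono_neutral_cong_right) auto
      also have "\<dots> = exp (\<Sum>i<j. s * (ind \<tau> (h i) - \<rho> \<tau>))" by (simp add: exp_sum)
      also have "(\<Sum>i<j. s * (ind \<tau> (h i) - \<rho> \<tau>)) = s * (X h j \<tau> - real j * \<rho> \<tau>)"
        by (simp add: X_def sum_subtractf flip: sum_distrib_left)
      finally show ?thesis by simp
    qed
    then have "(\<Sum>h\<in>?\<Omega>. exp (s * (X h j \<tau> - real j * \<rho> \<tau>)))
        = (\<Sum>h\<in>?\<Omega>. \<Prod>i<M. if i < j then exp (s * (ind \<tau> (h i) - \<rho> \<tau>)) else 1)" by simp
    also have "\<dots> = (\<Prod>i<M. \<Sum>e\<in>?E. if i < j then exp (s * (ind \<tau> e - \<rho> \<tau>)) else 1)"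
      by (rule prod_sum_PiE[symmetric]) auto
    also have "\<dots> \<le> (\<Prod>i<M. (real N)\<^sup>2 * exp (s\<^sup>2))"
    proof (rule prod_mono, rule conjI)
      fix i
      show "0 \<le> (\<Sum>e\<in>?E. if i < j then exp (s * (ind \<tau> e - \<rho> \<tau>)) else 1)"
        by (intro sum_nonneg) auto
      show "(\<Sum>e\<in>?E. if i < j then exp (s * (ind \<tau> e - \<rho> \<tau>)) else 1) \<le> (real N)\<^sup>2 * exp (s\<^sup>2)"
      proof (cases "i < j")
        case True
        then show ?thesis using moment[OF \<tau>] by simp
      next
        case False
        have "(real N)\<^sup>2 * 1 \<le> (real N)\<^sup>2 * exp (s\<^sup>2)" by (intro mult_left_mono) auto
        then show ?thesis using False by (simp add: power2_eq_square)
      qed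
    qed
    also have "\<dots> = ((real N)\<^sup>2) ^ M * exp (s\<^sup>2 * real M)"
      by (simp add: power_mult_distrib exp_of_nat_mult mult.commute)
    finally show ?thesis .
  qed
  have "\<exists>h\<in>?\<Omega>. \<forall>j\<le>M. \<forall>\<tau>\<in>?Cl. X h j \<tau> \<le> real j * \<rho> \<tau> + \<delta> * real M"
  proof (rule ccontr)
    assume neg: "\<not> ?thesis"
    \<comment> \<open>A list that fails at some j and \<tau> contributes at least 1 to the
      corresponding normalised exponential moment. If every list failed, the sum of all moments
      would be at least the number of lists, against \<open>few\<close>.\<close>
    have ge: "1 \<le> (\<Sum>j\<le>M. \<Sum>\<tau>\<in>?Cl. exp (s * (X h j \<tau> - real j * \<rho> \<tau>)) * exp (- (s * \<delta> * real M)))" if h: "h \<in> ?\<Omega>" for h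
    proof -
      have "\<not> (\<forall>j\<le>M. \<forall>\<tau>\<in>?Cl. X h j \<tau> \<le> real j * \<rho> \<tau> + \<delta> * real M)"
      proof
        assume "\<forall>j\<le>M. \<forall>\<tau>\<in>?Cl. X h j \<tau> \<le> real j * \<rho> \<tau> + \<delta> * real M"
        then have "\<exists>h\<in>?\<Omega>. \<forall>j\<le>M. \<forall>\<tau>\<in>?Cl. X h j \<tau> \<le> real j * \<rho> \<tau> + \<delta> * real M"
          using h by (rule bexI)
        with neg show False by (rule notE)
      qed
      then obtain j \<tau> where j: "j \<le> M" "\<tau> \<in> ?Cl" "\<not> X h j \<tau> \<le> real j * \<rho> \<tau> + \<delta> * real M"
        by blast
      then have "s * (\<delta> * real M) \<le> s * (X h j \<tau> - real j * \<rho> \<tau>)"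
        using s by (intro mult_left_mono) auto
      then have "1 \<le> exp (s * (X h j \<tau> - real j * \<rho> \<tau>)) * exp (- (s * \<delta> * real M))"
        by (simp flip: exp_add add: mult.assoc)
      also have "\<dots> \<le> (\<Sum>\<tau>\<in>?Cl. exp (s * (X h j \<tau> - real j * \<rho> \<tau>)) * exp (- (s * \<delta> * real M)))"
        by (rule member_le_sum[OF j(2), of "\<lambda>\<tau>. exp (s * (X h j \<tau> - real j * \<rho> \<tau>)) * exp (- (s * \<delta> * real M))"]) auto
      also have "\<dots> \<le> (\<Sum>j\<le>M. \<Sum>\<tau>\<in>?Cl. exp (s * (X h j \<tau> - real j * \<rho> \<tau>)) * exp (- (s * \<delta> * real M)))"
        using j(1) by (intro member_le_sum[where f = "\<lambda>j. \<Sum>\<tau>\<in>?Cl. exp (s * (X h j \<tau> - real j * \<rho> \<tau>)) * exp (- (s * \<delta> * real M))"]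
          sum_nonneg) auto
      finally show ?thesis .
    qed
    have "((real N)\<^sup>2) ^ M = (\<Sum>h\<in>?\<Omega>. 1)"
      by (simp add: card_PiE power2_eq_square)
    also have "\<dots> \<le> (\<Sum>h\<in>?\<Omega>. \<Sum>j\<le>M. \<Sum>\<tau>\<in>?Cl. exp (s * (X h j \<tau> - real j * \<rho> \<tau>)) * exp (- (s * \<delta> * real M)))"
      using ge by (rule sum_mono)
    also have "\<dots> = (\<Sum>j\<le>M. \<Sum>h\<in>?\<Omega>. \<Sum>\<tau>\<in>?Cl. exp (s * (X h j \<tau> - real j * \<rho> \<tau>)) * exp (- (s * \<delta> * real M)))"
      by (rule sum.swap)
    also have "\<dots> = (\<Sum>j\<le>M. \<Sum>\<tau>\<in>?Cl. (\<Sum>h\<in>?\<Omega>. exp (s * (X h j \<tau> - real j * \<rho> \<tau>))) * exp (- (s * \<delta> * real M)))"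
      unfolding sum_distrib_right by (intro sum.cong refl, rule sum.swap)
    also have "\<dots> \<le> (\<Sum>j\<le>M. \<Sum>\<tau>\<in>?Cl. ((real N)\<^sup>2) ^ M * exp (s\<^sup>2 * real M) * exp (- (s * \<delta> * real M)))"
      using chernoff by (intro sum_mono mult_right_mono) auto
    also have "\<dots> = ((real N)\<^sup>2) ^ M * ((real M + 1) * real q ^ N * (exp (s\<^sup>2 * real M) * exp (- (s * \<delta> * real M))))"
      by (simp add: colourings_def card_PiE add.commute)
    also have "exp (s\<^sup>2 * real M) * exp (- (s * \<delta> * real M)) = exp (- (\<delta>\<^sup>2 * real M / 4))"
      unfolding exp_add[symmetric] s_def by (simp add: power2_eq_square field_simps)
    also have "((real N)\<^sup>2) ^ M * ((real M + 1) * real q ^ N * exp (- (\<delta>\<^sup>2 * real M / 4))) < ((real N)\<^sup>2) ^ M * 1"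
      using few N by (intro mult_strict_left_mono) auto
    finally show False by simp
  qed
  then obtain h where h: "h \<in> ?\<Omega>" "\<forall>j\<le>M. \<forall>\<tau>\<in>?Cl. X h j \<tau> \<le> real j * \<rho> \<tau> + \<delta> * real M"
    by (rule bexE)
  \<comment> \<open>The bounds on end points are required at every index; beyond M the vertex 0 is
    used, which exists as N > 0.\<close>
  define a where "a i = (if i < M then fst (h i) else 0)" for i
  define b where "b i = (if i < M then snd (h i) else 0)" for i
  show ?thesis
  proof (rule that)
    have "h i \<in> ?E" if "i < M" for i using PiE_mem[OF h(1)] that by simp
    then show "a i < N" "b i < N" for i using N by (auto simp: a_def b_def mem_Times_iff)
    fix j \<tau> assume j: "j \<le> M" "\<tau> \<in> ?Cl"
    have "real (card {i \<in> {..<j}. \<tau> (a i) = \<tau> (b i)}) = (\<Sum>i<j. if \<tau> (a i) = \<tau> (b i) then 1 else 0)"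
      by (simp add: sum.If_cases Int_def)
    also have "\<dots> = X h j \<tau>"
      unfolding X_def ind_def using j(1) by (intro sum.cong refl) (auto simp: a_def b_def)
    finally show "real (card {i \<in> {..<j}. \<tau> (a i) = \<tau> (b i)})
        \<le> real j * (1 / real q + imbalance N q \<tau>) + \<delta> * real M"
      using h(2) j by (simp add: \<rho>_def)
  qed
qed

section \<open>The mean-field bottleneck\<close>

text \<open>The difference of the sides has derivative (1 - 1 / s)^2 / 2. At t = q - 1 the
  inequality is the gap between the critical value and q / 2; at t = 1, that is q = 2, both sides
  vanish and the gap closes.\<close>

lemma ln_less_half_diff:
  fixes t :: real
  assumes "1 < t"
  shows "ln t < (t - 1 / t) / 2"
proof -
  define f where "f = (\<lambda>t::real. (t - 1 / t) / 2 - ln t)"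
  have "f 1 < f t"
  proof (rule DERIV_pos_imp_increasing_open[OF assms])
    fix s :: real assume s: "1 < s" "s < t"
    have "(f has_real_derivative ((1 + 1 / s\<^sup>2) / 2 - 1 / s)) (at s)"
      unfolding f_def using s
      by (auto intro!: derivative_eq_intros simp: power2_eq_square field_simps)
    moreover have "(1 + 1 / s\<^sup>2) / 2 - 1 / s = (1 - 1 / s)\<^sup>2 / 2"
      using s by (simp add: power2_eq_square field_simps)
    ultimately show "\<exists>y. (f has_real_derivative y) (at s) \<and> 0 < y" using s by auto
  next
    show "continuous_on {1..t} f" unfolding f_def by (intro continuous_intros) auto
  qed
  then show ?thesis by (simp add: f_def)
qed

lemma eventually_poly_exp_le:
  fixes C a :: real
  assumes "0 < a" "0 < C"
  shows "\<forall>\<^sub>F N in sequentially. C * (real N + 1) ^ k * exp (- (2 * a * real N)) \<le> exp (- (a * real N))"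
proof -
  have "((\<lambda>N. (real N + 1) ^ k / exp (a * real N)) \<longlongrightarrow> 0) sequentially"
    using assms by real_asymp
  then have "\<forall>\<^sub>F N in sequentially. (real N + 1) ^ k / exp (a * real N) < 1 / C"
    using assms by (intro order_tendstoD) auto
  then show ?thesis
  proof (rule eventually_mono)
    fix N assume "(real N + 1) ^ k / exp (a * real N) < 1 / C"
    then have "C * (real N + 1) ^ k \<le> exp (a * real N)"
      using assms by (simp add: field_simps)
    then have "C * (real N + 1) ^ k * exp (- (2 * a * real N)) \<le> exp (a * real N) * exp (- (2 * a * real N))"
      by (intro mult_right_mono) auto
    then show "C * (real N + 1) ^ k * exp (- (2 * a * real N)) \<le> exp (- (a * real N))"
      by (simp flip: exp_add)
  qed
qed

text \<open>What the mean-field analysis hands over to the graph. The family is down-closed, so only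
  opening an edge can leave it; \<epsilon> bounds both the share of its boundary and its own share
  of the total weight.\<close>

definition bottleneck_family :: "nat \<Rightarrow> nat set set \<Rightarrow> (nat set \<Rightarrow> real) \<Rightarrow> real \<Rightarrow> bool" where
  "bottleneck_family M D W \<epsilon> \<longleftrightarrow> D \<subseteq> Pow {..<M} \<and> {} \<in> D \<and> (\<forall>r\<in>D. \<forall>r'. r' \<subseteq> r \<longrightarrow> r' \<in> D) \<and>
     (\<Sum>r\<in>{r \<in> D. \<exists>i<M. insert i r \<notin> D}. W r) \<le> \<epsilon> * (\<Sum>r\<in>D. W r) \<and>
     (\<Sum>r\<in>D. W r) \<le> \<epsilon> * (\<Sum>r\<in>Pow {..<M}. W r)"

lemma exists_reduced_bottleneck:
  assumes q: "3 \<le> q"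
  obtains D :: nat and w c :: real where "0 < D" "0 < w" "0 < c"
    "\<forall>\<^sub>F N in sequentially. \<exists>a b F. edge_list N q a b \<and>
       bottleneck_family (D * N) F (edge_list.rwt N q a b w) (exp (- (c * real N)))"
proof -
  define Q where "Q = real q"
  have Q: "3 \<le> Q" using q by (simp add: Q_def)
  define L where "L = ln (Q - 1)"
  define b_crit where "b_crit = (Q - 1) * L / (Q - 2)"
  have L_pos: "0 < L" using Q by (simp add: L_def)
  have "L < ((Q - 1) - 1 / (Q - 1)) / 2"
    unfolding L_def using Q by (intro ln_less_half_diff) auto
  also have "\<dots> = Q * (Q - 2) / (2 * (Q - 1))" using Q by (simp add: field_simps)
  finally have L_less: "L < Q * (Q - 2) / (2 * (Q - 1))" .
  have "b_crit < Q / 2"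
  proof -
    have "(Q - 1) * L < (Q - 1) * (Q * (Q - 2) / (2 * (Q - 1)))"
      using L_less Q by (intro mult_strict_left_mono) auto
    also have "\<dots> = Q / 2 * (Q - 2)" using Q by (simp add: field_simps)
    finally show ?thesis using Q by (simp add: b_crit_def pos_divide_less_eq)
  qed
  moreover have b_crit_pos: "0 < b_crit" using Q L_pos by (simp add: b_crit_def)
  ultimately obtain bb where bb: "b_crit < bb" "bb < Q / 2" using dense by blast
  have bb_pos: "0 < bb" using bb b_crit_pos by linarith
  \<comment> \<open>Free energy per vertex of the trial frequencies \<open>m\<close> minus that of
    the uniform ones; it vanishes at \<open>b_crit\<close>.\<close>
  define gain where "gain = (Q - 2) / Q * (bb * (Q - 2) / (Q - 1) - L)"
  have gain: "0 < gain"
  proof -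
    have "(Q - 1) * L < bb * (Q - 2)" using bb(1) Q by (simp add: b_crit_def pos_divide_less_eq)
    then have "L < bb * (Q - 2) / (Q - 1)" using Q by (simp add: pos_less_divide_eq mult.commute)
    then show ?thesis using Q by (simp add: gain_def)
  qed
  \<comment> \<open>Chosen so that q \<eta> is half of q / (2 \<open>bb\<close>) - 1; then \<kappa>
    = q / (2 (1 + q \<eta>)) still exceeds \<open>bb\<close>.\<close>
  define \<eta> where "\<eta> = (Q / (2 * bb) - 1) / (2 * Q)"
  have "1 < Q / (2 * bb)" using bb bb_pos by (simp add: pos_less_divide_eq)
  then have \<eta>: "0 < \<eta>" using Q by (simp add: \<eta>_def)
  define \<theta> where "\<theta> = \<eta>\<^sup>2"
  have sqrt\<theta>: "sqrt \<theta> = \<eta>" using \<eta> by (simp add: \<theta>_def)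
  have \<theta>: "0 < \<theta>" using \<eta> by (simp add: \<theta>_def)
  define \<kappa> where "\<kappa> = real q / (2 * (1 + real q * sqrt \<theta>))"
  have \<kappa>: "bb < \<kappa>"
  proof -
    have "Q * \<eta> = (Q / (2 * bb) - 1) / 2" using Q by (simp add: \<eta>_def)
    then have "1 + Q * \<eta> < Q / (2 * bb)" using \<open>1 < Q / (2 * bb)\<close> by (simp add: field_simps)
    then have "bb * (2 * (1 + Q * \<eta>)) < Q" using bb_pos by (simp add: pos_less_divide_eq mult_ac)
    moreover have "0 < 2 * (1 + Q * \<eta>)" using Q \<eta> by (simp add: add_pos_pos)
    ultimately show ?thesis unfolding \<kappa>_def sqrt\<theta> Q_def[symmetric] by (simp add: pos_less_divide_eq)
  qed
  define x where "x = \<theta> / (2 * Q)"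
  have x: "0 < x" using \<theta> Q by (simp add: x_def)
  have x_\<theta>: "2 * real q * x \<le> \<theta>" using Q by (simp add: x_def flip: Q_def)
  define gap where "gap = (\<kappa> - bb) * (x / 6)\<^sup>2"
  have gap: "0 < gap" using \<kappa> x by (simp add: gap_def)
  \<comment> \<open>The error \<open>bb * \<delta>\<close> may use up at most half of
    \<open>gap\<close> and half of \<open>gain\<close>.\<close>
  define \<delta> where "\<delta> = min 1 (min (gap / (2 * bb)) (gain / (2 * bb)))"
  have \<delta>: "0 < \<delta>" "\<delta> \<le> 2" using gap gain bb_pos by (auto simp: \<delta>_def)
  have "\<delta> \<le> gap / (2 * bb)" "\<delta> \<le> gain / (2 * bb)" by (auto simp: \<delta>_def)
  then have \<delta>_gap: "bb * \<delta> \<le> gap / 2" and \<delta>_gain: "bb * \<delta> \<le> gain / 2"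
    using bb_pos by (auto simp: pos_le_divide_eq mult_ac)
  \<comment> \<open>Enough edges per vertex that the Chernoff exponent \<delta>^2 D / 4 beats the ln
    q coming from q^N colourings, with exp (-N) left over for the number of prefixes.\<close>
  define D where "D = nat \<lceil>4 * (ln Q + 1) / \<delta>\<^sup>2\<rceil>"
  have D_ge: "4 * (ln Q + 1) / \<delta>\<^sup>2 \<le> real D" by (simp add: D_def real_nat_ceiling_ge)
  have lnQ: "0 \<le> ln Q" using Q by simp
  then have "0 < 4 * (ln Q + 1) / \<delta>\<^sup>2" using \<delta> by simp
  then have D: "0 < D" using D_ge by (metis gr0I less_le_trans of_nat_0 order_less_irrefl)
  have D_\<delta>: "ln Q + 1 \<le> \<delta>\<^sup>2 * real D / 4" using D_ge \<delta> by (simp add: pos_divide_le_eq mult_ac)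
  \<comment> \<open>The higher density is compensated by weaker edges, so that the coupling per
    vertex stays \<open>bb\<close>.\<close>
  define \<beta> where "\<beta> = bb / real D"
  have \<beta>: "0 < \<beta>" using bb_pos D by (simp add: \<beta>_def)
  define w where "w = exp \<beta> - 1"
  have w: "0 < w" using \<beta> by (simp add: w_def)
  have ln_w: "\<beta> = ln (1 + w)" by (simp add: w_def)
  \<comment> \<open>Of \<open>gap\<close> and \<open>gain\<close>, one half goes to \<delta> and a
    quarter to the polynomial factors.\<close>
  define c where "c = min (gap / 4) (gain / 4)"
  have c: "0 < c" using gap gain by (simp add: c_def)
  have c_le: "c * real N \<le> gap / 4 * real N" "c * real N \<le> gain / 4 * real N" for N
    by (auto simp: c_def intro!: mult_right_mono simp del: times_divide_eq_left)
  \<comment> \<open>The frequencies of the ordered mean-field phase exactly at the transition, kept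
    as trial vector for the larger coupling \<open>bb\<close>.\<close>
  define m where "m c = (if c = 1 then (Q - 1) / Q else 1 / (Q * (Q - 1)))" for c :: nat
  have m_pos: "0 < m c" for c using Q by (simp add: m_def)
  have range_q: "{1..q} = insert 1 {2..q}" "1 \<notin> {2..q}" using q by auto
  have card_q: "real (card {2..q}) = Q - 1" using q by (simp add: Q_def)
  have m_sum: "(\<Sum>c\<in>{1..q}. f (m c)) = f ((Q - 1) / Q) + (Q - 1) * f (1 / (Q * (Q - 1)))" for f :: "real \<Rightarrow> real"
  proof -
    have "(\<Sum>c\<in>{2..q}. f (m c)) = (\<Sum>c\<in>{2..q}. f (1 / (Q * (Q - 1))))"
      by (intro sum.cong refl) (simp add: m_def)
    also have "\<dots> = (Q - 1) * f (1 / (Q * (Q - 1)))" unfolding sum_constant card_q ..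
    finally show ?thesis unfolding range_q(1) by (simp add: m_def)
  qed
  have m_1: "(\<Sum>c\<in>{1..q}. m c) = 1"
    using m_sum[of "\<lambda>y. y"] Q by (simp add: field_simps)
  have m_sq: "(\<Sum>c\<in>{1..q}. (m c)\<^sup>2) = 1 / Q + (Q - 2)\<^sup>2 / (Q * (Q - 1))"
    unfolding m_sum[of "\<lambda>y. y\<^sup>2"] using Q by (simp add: power2_eq_square divide_simps) (simp add: algebra_simps)
  have m_ent: "(\<Sum>c\<in>{1..q}. m c * ln (m c)) = (Q - 2) / Q * L - ln Q"
  proof -
    have l1: "ln ((Q - 1) / Q) = L - ln Q" and l2: "ln (1 / (Q * (Q - 1))) = - ln Q - L"
      using Q by (auto simp: L_def ln_div ln_mult)
    show ?thesis
      unfolding m_sum[of "\<lambda>y. y * ln y"] l1 l2 using Q by (simp add: field_simps)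
  qed
  have exponent: "bb * (\<Sum>c\<in>{1..q}. (m c)\<^sup>2) - (\<Sum>c\<in>{1..q}. m c * ln (m c)) = ln Q + bb / Q + gain"
  proof -
    have "bb * ((Q - 2)\<^sup>2 / (Q * (Q - 1))) = (Q - 2) / Q * (bb * (Q - 2) / (Q - 1))"
      by (simp add: power2_eq_square)
    then show ?thesis
      unfolding m_sq m_ent gain_def right_diff_distrib[of "(Q - 2) / Q"] distrib_left by simp
  qed
  have ev: "\<forall>\<^sub>F N in sequentially. 1 \<le> x * real N"
    "\<forall>\<^sub>F N in sequentially. (real D * real N + 1) * exp (- real N) < 1"
    "\<forall>\<^sub>F N in sequentially. 4 * Q * (real N + 1) ^ q * exp (- (2 * (gap / 4) * real N)) \<le> exp (- (gap / 4 * real N))"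
    "\<forall>\<^sub>F N in sequentially. real D * real N * (2 * Q * (real N + 1) ^ q * exp (- (gap / 2 * real N))) < 1 / 2"
    "\<forall>\<^sub>F N in sequentially. 2 * (real N + 1) ^ q * exp (- (2 * (gain / 4) * real N)) \<le> exp (- (gain / 4 * real N))"
    "\<forall>\<^sub>F N in sequentially. 0 < N"
  proof -
    show "\<forall>\<^sub>F N in sequentially. 1 \<le> x * real N" using x by real_asymp
    have "((\<lambda>N. (real D * real N + 1) * exp (- real N)) \<longlongrightarrow> 0) sequentially" by real_asymp
    then show "\<forall>\<^sub>F N in sequentially. (real D * real N + 1) * exp (- real N) < 1"
      by (rule order_tendstoD) simp
    have "((\<lambda>N. real D * real N * (2 * Q * (real N + 1) ^ q * exp (- (gap / 2 * real N)))) \<longlongrightarrow> 0) sequentially"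
      using gap by real_asymp
    then show "\<forall>\<^sub>F N in sequentially. real D * real N * (2 * Q * (real N + 1) ^ q * exp (- (gap / 2 * real N))) < 1 / 2"
      by (rule order_tendstoD) simp
    show "\<forall>\<^sub>F N in sequentially. 4 * Q * (real N + 1) ^ q * exp (- (2 * (gap / 4) * real N)) \<le> exp (- (gap / 4 * real N))"
      using gap Q by (intro eventually_poly_exp_le) auto
    show "\<forall>\<^sub>F N in sequentially. 2 * (real N + 1) ^ q * exp (- (2 * (gain / 4) * real N)) \<le> exp (- (gain / 4 * real N))"
      using gain by (intro eventually_poly_exp_le) auto
    show "\<forall>\<^sub>F N in sequentially. 0 < N" by (rule eventually_gt_at_top)
  qed
  show thesis
  proof (rule that[OF D w c])
    show "\<forall>\<^sub>F N in sequentially. \<exists>a b F. edge_list N q a b \<and>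
       bottleneck_family (D * N) F (edge_list.rwt N q a b w) (exp (- (c * real N)))"
      using ev
    proof eventually_elim
      case (elim N)
      let ?M = "D * N"
      have few: "(real ?M + 1) * real q ^ N * exp (- (\<delta>\<^sup>2 * real ?M / 4)) < 1"
      proof -
        have "(ln Q + 1) * real N \<le> \<delta>\<^sup>2 * real D / 4 * real N" by (intro mult_right_mono D_\<delta>) auto
        then have "exp (- (\<delta>\<^sup>2 * real ?M / 4)) \<le> exp (- (real N * ln Q) - real N)"
          by (simp add: algebra_simps)
        then have "real q ^ N * exp (- (\<delta>\<^sup>2 * real ?M / 4)) \<le> real q ^ N * exp (- (real N * ln Q) - real N)"
          by (intro mult_left_mono) auto
        also have "\<dots> = exp (- real N)"
        proof -
          have "real q ^ N = exp (real N * ln Q)" using Q by (simp add: exp_of_nat_mult flip: Q_def)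
          then show ?thesis by (simp flip: exp_add)
        qed
        finally have "(real ?M + 1) * (real q ^ N * exp (- (\<delta>\<^sup>2 * real ?M / 4))) \<le> (real ?M + 1) * exp (- real N)"
          by (intro mult_left_mono) auto
        then show ?thesis using elim(2) by (simp add: mult.assoc)
      qed
      have q0: "q > 0" using q by simp
      obtain a b where ab: "\<And>i. a i < N" "\<And>i. b i < N"
        "\<And>j \<tau>. j \<le> ?M \<Longrightarrow> \<tau> \<in> colourings {..<N} q \<Longrightarrow>
          real (card {i \<in> {..<j}. \<tau> (a i) = \<tau> (b i)}) \<le> real j * (1 / real q + imbalance N q \<tau>) + \<delta> * real ?M"
        using exists_pseudorandom[OF elim(6) q0 \<delta> few] by blast
      interpret edge_list N q a b using ab(1,2) elim(6) q by unfold_locales auto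
      interpret pseudorandom N q a b ?M w \<beta> bb \<delta> \<theta> x \<kappa>
      proof unfold_locales
        show "\<beta> * real ?M = bb * real N" using D by (simp add: \<beta>_def)
        fix j \<tau> assume "j \<le> ?M" "\<tau> \<in> colourings {..<N} q"
        then show "real (card (agree j \<tau>)) \<le> real j * (1 / real q + imbalance N q \<tau>) + \<delta> * real ?M"
          unfolding agree_def by (rule ab(3))
      qed (use w ln_w \<delta> x elim x_\<theta> \<kappa> \<kappa>_def in auto)
      have \<epsilon>_le: "\<epsilon> \<le> 2 * Q * (real N + 1) ^ q * exp (- (gap / 2 * real N))"
      proof -
        have "(bb * \<delta> - gap) * real N \<le> - (gap / 2) * real N"
          using \<delta>_gap by (intro mult_right_mono) auto
        then have "exp (bb * \<delta> * real N - gap * real N) \<le> exp (- (gap / 2 * real N))"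
          by (simp add: algebra_simps)
        then show ?thesis unfolding \<epsilon>_def gap_def[symmetric] Q_def[symmetric]
          using Q by (intro mult_left_mono) auto
      qed
      have M\<epsilon>: "real ?M * \<epsilon> \<le> 1 / 2"
      proof -
        have "real ?M * \<epsilon> \<le> real ?M * (2 * Q * (real N + 1) ^ q * exp (- (gap / 2 * real N)))"
          using \<epsilon>_le by (intro mult_left_mono) auto
        then show ?thesis using elim(4) by simp
      qed
      have e2: "2 * \<epsilon> \<le> exp (- (c * real N))"
      proof -
        have "2 * \<epsilon> \<le> exp (- (gap / 4 * real N))" using \<epsilon>_le elim(3) by simp
        also have "\<dots> \<le> exp (- (c * real N))" using c_le(1)[of N] by simp
        finally show ?thesis .
      qed
      have nonneg: "0 \<le> rwt w r" for r using w by (intro rwt_nonneg) auto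
      have fin: "finite (smalls ?M)" by (simp add: smalls_def)
      have "(\<Sum>r\<in>{r \<in> smalls ?M. \<exists>i<?M. insert i r \<notin> smalls ?M}. rwt w r) \<le> (\<Sum>r\<in>critical ?M. rwt w r)"
      proof (rule sum_mono2)
        show "{r \<in> smalls ?M. \<exists>i<?M. insert i r \<notin> smalls ?M} \<subseteq> critical ?M"
          using small_insert[of x] by (auto simp: smalls_def critical_def)
      qed (auto simp: critical_def nonneg)
      also have "\<dots> \<le> 2 * \<epsilon> * (\<Sum>r\<in>smalls ?M. rwt w r)" by (rule critical_le_smalls[OF M\<epsilon>])
      also have "\<dots> \<le> exp (- (c * real N)) * (\<Sum>r\<in>smalls ?M. rwt w r)"
        using e2 nonneg by (intro mult_right_mono sum_nonneg) auto
      finally have bd: "(\<Sum>r\<in>{r \<in> smalls ?M. \<exists>i<?M. insert i r \<notin> smalls ?M}. rwt w r)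
          \<le> exp (- (c * real N)) * (\<Sum>r\<in>smalls ?M. rwt w r)" .
      have "exp (real N * (ln Q + bb / Q + gain))
          = exp (ln (1 + w) * real ?M * (\<Sum>c\<in>{1..q}. (m c)\<^sup>2) - real N * (\<Sum>c\<in>{1..q}. m c * ln (m c)))"
        unfolding exponent[symmetric] ln_w[symmetric] \<beta>M by (simp add: algebra_simps)
      also have "\<dots> \<le> (\<Sum>\<tau>\<in>Cl. (1 + w) ^ card (agree ?M \<tau>))"
        using m_pos m_1 w by (intro partition_function_ge) auto
      also have "\<dots> = (\<Sum>r\<in>Pow {..<?M}. rwt w r)" using w by (intro sum_rwt_all[symmetric]) auto
      finally have Z: "exp (real N * (ln Q + bb / Q + gain)) \<le> (\<Sum>r\<in>Pow {..<?M}. rwt w r)" .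
      have "(\<Sum>r\<in>smalls ?M. rwt w r)
          \<le> 2 * (real N + 1) ^ q * exp (real N * (ln Q + bb / Q + bb * \<delta>))"
        using sum_smalls_le by (simp add: Q_def)
      also have "\<dots> \<le> 2 * (real N + 1) ^ q * (exp (- (2 * (gain / 4) * real N)) * exp (real N * (ln Q + bb / Q + gain)))"
      proof -
        have "real N * (bb * \<delta>) \<le> real N * (gain / 2)" using \<delta>_gain by (intro mult_left_mono) auto
        then have "exp (real N * (ln Q + bb / Q + bb * \<delta>)) \<le> exp (- (2 * (gain / 4) * real N)) * exp (real N * (ln Q + bb / Q + gain))"
          unfolding exp_add[symmetric] by (simp add: algebra_simps)
        then show ?thesis by (intro mult_left_mono) auto
      qed
      also have "\<dots> \<le> exp (- (gain / 4 * real N)) * exp (real N * (ln Q + bb / Q + gain))"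
        using mult_right_mono[OF elim(5), of "exp (real N * (ln Q + bb / Q + gain))"] by (simp add: mult.assoc)
      also have "\<dots> \<le> exp (- (c * real N)) * exp (real N * (ln Q + bb / Q + gain))"
        by (intro mult_right_mono) (use c_le(2)[of N] in auto)
      also have "\<dots> \<le> exp (- (c * real N)) * (\<Sum>r\<in>Pow {..<?M}. rwt w r)"
        using Z by (intro mult_left_mono) auto
      finally have total: "(\<Sum>r\<in>smalls ?M. rwt w r) \<le> exp (- (c * real N)) * (\<Sum>r\<in>Pow {..<?M}. rwt w r)" .
      have empty: "{} \<in> smalls ?M"
        using x elim(1) by (auto simp: smalls_def small_def rel_def)
      have down: "r' \<in> smalls ?M" if "r \<in> smalls ?M" "r' \<subseteq> r" for r r'
        using that small_antimono[of r' r x] by (auto simp: smalls_def)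
      have "bottleneck_family ?M (smalls ?M) (rwt w) (exp (- (c * real N)))"
        unfolding bottleneck_family_def
      proof (intro conjI ballI allI impI bd total empty)
        show "smalls ?M \<subseteq> Pow {..<?M}" by (auto simp: smalls_def)
      qed (rule down)
      then show ?case
        by (intro exI[of _ a] exI[of _ b] exI[of _ "smalls ?M"] conjI edge_list_axioms)
    qed
  qed
qed

section \<open>Paths as effective edges\<close>

lemma sum_Pow_Un_disjoint:
  fixes k :: "'a set \<Rightarrow> real"
  assumes "A \<inter> B = {}"
  shows "(\<Sum>X\<in>Pow (A \<union> B). k X) = (\<Sum>X\<in>Pow A. \<Sum>Y\<in>Pow B. k (X \<union> Y))"
proof -
  have "(\<Sum>X\<in>Pow A. \<Sum>Y\<in>Pow B. k (X \<union> Y)) = (\<Sum>(X, Y)\<in>Pow A \<times> Pow B. k (X \<union> Y))"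
    by (simp add: sum.cartesian_product)
  also have "\<dots> = (\<Sum>X\<in>Pow (A \<union> B). k X)"
    by (rule sum.reindex_bij_witness[where j = "\<lambda>(X, Y). X \<union> Y" and i = "\<lambda>Z. (Z \<inter> A, Z \<inter> B)"])
      (use assms in auto)
  finally show ?thesis by simp
qed

section \<open>Edge weights that factorise for a fixed colouring\<close>

definition config_weight :: "('e \<Rightarrow> real) \<Rightarrow> ('e \<Rightarrow> real) \<Rightarrow> 'e set \<Rightarrow> 'e set \<Rightarrow> real" where
  "config_weight f g U \<omega> = (\<Prod>e\<in>U. if e \<in> \<omega> then f e else g e)"

lemma config_weight_Un:
  assumes "finite A" "finite B" "A \<inter> B = {}" "X \<subseteq> A" "Y \<subseteq> B"
  shows "config_weight f g (A \<union> B) (X \<union> Y) = config_weight f g A X * config_weight f g B Y"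
proof -
  have "config_weight f g (A \<union> B) (X \<union> Y)
      = (\<Prod>e\<in>A. if e \<in> X \<union> Y then f e else g e) * (\<Prod>e\<in>B. if e \<in> X \<union> Y then f e else g e)"
    unfolding config_weight_def using assms by (intro prod.union_disjoint) auto
  moreover have "(\<Prod>e\<in>A. if e \<in> X \<union> Y then f e else g e) = config_weight f g A X"
    unfolding config_weight_def using assms by (intro prod.cong) auto
  moreover have "(\<Prod>e\<in>B. if e \<in> X \<union> Y then f e else g e) = config_weight f g B Y"
    unfolding config_weight_def using assms by (intro prod.cong) auto
  ultimately show ?thesis by simp
qed

lemma config_weight_full: "config_weight f g U U = (\<Prod>e\<in>U. f e)"
  unfolding config_weight_def by (intro prod.cong) auto

lemma sum_config_weight:
  assumes "finite U"
  shows "(\<Sum>\<omega>\<in>Pow U. config_weight f g U \<omega>) = (\<Prod>e\<in>U. f e + g e)"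
proof -
  have "config_weight f g U \<omega> = (\<Prod>e\<in>\<omega>. f e) * (\<Prod>e\<in>U - \<omega>. g e)" if "\<omega> \<in> Pow U" for \<omega>
    unfolding config_weight_def using that assms
    by (simp add: prod.If_cases Int_absorb1 Diff_eq)
  then show ?thesis using prod_add[OF assms, of f g] by simp
qed

lemma sum_config_weight_open:
  assumes "finite U"
  shows "(\<Sum>\<omega>\<in>Pow U. if U \<subseteq> \<omega> then config_weight f g U \<omega> else 0) = (\<Prod>e\<in>U. f e)"
proof -
  have "(\<Sum>\<omega>\<in>Pow U. if U \<subseteq> \<omega> then config_weight f g U \<omega> else 0)
      = (\<Sum>\<omega>\<in>Pow U. if \<omega> = U then config_weight f g U U else 0)"
    by (intro sum.cong) auto
  then show ?thesis using assms by (simp add: config_weight_full)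
qed

lemma sum_config_weight_closed:
  assumes "finite U"
  shows "(\<Sum>\<omega>\<in>Pow U. if U \<subseteq> \<omega> then 0 else config_weight f g U \<omega>) = (\<Prod>e\<in>U. f e + g e) - (\<Prod>e\<in>U. f e)"
proof -
  have "(\<Sum>\<omega>\<in>Pow U. if U \<subseteq> \<omega> then 0 else config_weight f g U \<omega>)
      = (\<Sum>\<omega>\<in>Pow U. config_weight f g U \<omega> - (if U \<subseteq> \<omega> then config_weight f g U \<omega> else 0))"
    by (intro sum.cong) auto
  then show ?thesis
    by (simp only: sum_subtractf sum_config_weight[OF assms] sum_config_weight_open[OF assms])
qed

text \<open>Weights are products over edges, so the sum splits over B and the paths. A path outside
  r is one that is not fully open: all of its states minus the fully open one.\<close>

lemma sum_config_weight_paths: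
  fixes P :: "nat \<Rightarrow> 'e set"
  assumes fin: "finite B" "\<And>i. i < m \<Longrightarrow> finite (P i)"
    and disj: "\<And>i. i < m \<Longrightarrow> P i \<inter> B = {}" "\<And>i j. i < m \<Longrightarrow> j < m \<Longrightarrow> i \<noteq> j \<Longrightarrow> P i \<inter> P j = {}"
  shows "(\<Sum>\<omega>\<in>Pow (B \<union> (\<Union>i<m. P i)). if (\<forall>i<m. P i \<subseteq> \<omega> \<longleftrightarrow> i \<in> r) \<and> Q (\<omega> \<inter> B)
        then config_weight f g (B \<union> (\<Union>i<m. P i)) \<omega> else 0)
    = (\<Sum>\<omega>\<in>Pow B. if Q \<omega> then config_weight f g B \<omega> else 0)
      * (\<Prod>i<m. if i \<in> r then (\<Prod>e\<in>P i. f e) else (\<Prod>e\<in>P i. f e + g e) - (\<Prod>e\<in>P i. f e))"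
  using assms
proof (induction m)
  case 0
  have U0: "B \<union> (\<Union>i<0. P i) = B" by simp
  have "(\<Sum>\<omega>\<in>Pow B. if Q (\<omega> \<inter> B) then config_weight f g B \<omega> else 0)
      = (\<Sum>\<omega>\<in>Pow B. if Q \<omega> then config_weight f g B \<omega> else 0)"
    by (intro sum.cong refl) (simp add: Int_absorb2)
  then show ?case unfolding U0 by simp
next
  case (Suc m)
  let ?U = "B \<union> (\<Union>i<m. P i)"
  let ?c = "\<lambda>X. (\<forall>i<m. P i \<subseteq> X \<longleftrightarrow> i \<in> r) \<and> Q (X \<inter> B)"
  have U: "B \<union> (\<Union>i<Suc m. P i) = ?U \<union> P m" by (auto simp: less_Suc_eq)
  have finU: "finite ?U" and finP: "finite (P m)" using Suc.prems by auto
  have "B \<inter> P m = {}" using Suc.prems(3)[of m] by blast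
  moreover have "P i \<inter> P m = {}" if "i < m" for i using Suc.prems(4)[of i m] that by simp
  ultimately have disjU: "?U \<inter> P m = {}" by blast
  have cond: "((\<forall>i<Suc m. P i \<subseteq> X \<union> Z \<longleftrightarrow> i \<in> r) \<and> Q ((X \<union> Z) \<inter> B)) \<longleftrightarrow> ?c X \<and> (P m \<subseteq> Z \<longleftrightarrow> m \<in> r)"
    if X: "X \<subseteq> ?U" and Z: "Z \<subseteq> P m" for X Z
  proof -
    have 1: "P i \<subseteq> X \<union> Z \<longleftrightarrow> P i \<subseteq> X" if "i < m" for i
    proof -
      have "P i \<inter> P m = {}" using Suc.prems(4)[of i m] that by simp
      then show ?thesis using Z by blast
    qed
    have 2: "P m \<subseteq> X \<union> Z \<longleftrightarrow> P m \<subseteq> Z" using X disjU by blast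
    have 3: "(X \<union> Z) \<inter> B = X \<inter> B" using Z Suc.prems(3)[of m] by blast
    show ?thesis unfolding less_Suc_eq 3 using 1 2 by blast
  qed
  have if_mult: "(if A \<and> A' then s * t else 0) = (if A then s else 0) * (if A' then t else 0)"
    for A A' and s t :: real by simp
  have "(\<Sum>\<omega>\<in>Pow (?U \<union> P m). if (\<forall>i<Suc m. P i \<subseteq> \<omega> \<longleftrightarrow> i \<in> r) \<and> Q (\<omega> \<inter> B)
        then config_weight f g (?U \<union> P m) \<omega> else 0)
      = (\<Sum>X\<in>Pow ?U. \<Sum>Z\<in>Pow (P m). (if ?c X then config_weight f g ?U X else 0)
          * (if P m \<subseteq> Z \<longleftrightarrow> m \<in> r then config_weight f g (P m) Z else 0))"
    unfolding sum_Pow_Un_disjoint[OF disjU]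
  proof (intro sum.cong refl)
    fix X Z assume "X \<in> Pow ?U" "Z \<in> Pow (P m)"
    then have XZ: "X \<subseteq> ?U" "Z \<subseteq> P m" by auto
    show "(if (\<forall>i<Suc m. P i \<subseteq> X \<union> Z \<longleftrightarrow> i \<in> r) \<and> Q ((X \<union> Z) \<inter> B)
        then config_weight f g (?U \<union> P m) (X \<union> Z) else 0)
      = (if ?c X then config_weight f g ?U X else 0)
          * (if P m \<subseteq> Z \<longleftrightarrow> m \<in> r then config_weight f g (P m) Z else 0)"
      unfolding cond[OF XZ] config_weight_Un[OF finU finP disjU XZ] by (rule if_mult)
  qed
  also have "\<dots> = (\<Sum>X\<in>Pow ?U. if ?c X then config_weight f g ?U X else 0)
      * (\<Sum>Z\<in>Pow (P m). if P m \<subseteq> Z \<longleftrightarrow> m \<in> r then config_weight f g (P m) Z else 0)"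
    by (simp only: sum_product)
  also have "(\<Sum>Z\<in>Pow (P m). if P m \<subseteq> Z \<longleftrightarrow> m \<in> r then config_weight f g (P m) Z else 0)
      = (if m \<in> r then (\<Prod>e\<in>P m. f e) else (\<Prod>e\<in>P m. f e + g e) - (\<Prod>e\<in>P m. f e))"
  proof (cases "m \<in> r")
    case True
    then show ?thesis using sum_config_weight_open[OF finP, of f g] by simp
  next
    case False
    have "(\<Sum>Z\<in>Pow (P m). if P m \<subseteq> Z \<longleftrightarrow> m \<in> r then config_weight f g (P m) Z else 0)
        = (\<Sum>Z\<in>Pow (P m). if P m \<subseteq> Z then 0 else config_weight f g (P m) Z)"
      using False by (intro sum.cong) auto
    then show ?thesis using sum_config_weight_closed[OF finP, of f g] False by simp
  qed
  also have "(\<Sum>X\<in>Pow ?U. if ?c X then config_weight f g ?U X else 0)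
      = (\<Sum>\<omega>\<in>Pow B. if Q \<omega> then config_weight f g B \<omega> else 0)
      * (\<Prod>i<m. if i \<in> r then (\<Prod>e\<in>P i. f e) else (\<Prod>e\<in>P i. f e + g e) - (\<Prod>e\<in>P i. f e))"
    using Suc.prems by (intro Suc.IH) auto
  finally show ?case unfolding U by (simp add: mult.assoc)
qed

section \<open>Transfer matrices along a path\<close>

lemma sum_PiE_insert:
  fixes k :: "('a \<Rightarrow> 'b) \<Rightarrow> real"
  assumes "z \<notin> A"
  shows "(\<Sum>\<sigma>\<in>insert z A \<rightarrow>\<^sub>E C. k \<sigma>) = (\<Sum>\<sigma>\<in>A \<rightarrow>\<^sub>E C. \<Sum>c\<in>C. k (\<sigma>(z := c)))"
proof -
  have inj: "inj_on (\<lambda>(y, g). g(z := y)) (C \<times> (A \<rightarrow>\<^sub>E C))"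
    using assms by (rule inj_combinator)
  have "(\<Sum>\<sigma>\<in>insert z A \<rightarrow>\<^sub>E C. k \<sigma>) = (\<Sum>(c, \<sigma>)\<in>C \<times> (A \<rightarrow>\<^sub>E C). k (\<sigma>(z := c)))"
    unfolding PiE_insert_eq by (subst sum.reindex[OF inj]) (simp add: case_prod_unfold)
  also have "\<dots> = (\<Sum>c\<in>C. \<Sum>\<sigma>\<in>A \<rightarrow>\<^sub>E C. k (\<sigma>(z := c)))"
    by (simp add: sum.cartesian_product)
  also have "\<dots> = (\<Sum>\<sigma>\<in>A \<rightarrow>\<^sub>E C. \<Sum>c\<in>C. k (\<sigma>(z := c)))" by (rule sum.swap)
  finally show ?thesis .
qed

text \<open>Powers of the transfer matrix with entries \<open>x + y\<close> on the diagonal and \<open>y\<close> off it.\<close>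
definition transfer :: "nat \<Rightarrow> real \<Rightarrow> real \<Rightarrow> nat \<Rightarrow> nat \<Rightarrow> nat \<Rightarrow> real" where
  "transfer q x y k \<alpha> \<gamma> = (if \<alpha> = \<gamma> then x ^ k else 0) + ((x + y * real q) ^ k - x ^ k) / real q"

lemma transfer_Suc:
  assumes "q > 0" "\<gamma> \<in> {1..q}" "\<alpha> \<in> {1..q}"
  shows "(\<Sum>c\<in>{1..q}. transfer q x y k \<alpha> c * ((if c = \<gamma> then x else 0) + y)) = transfer q x y (Suc k) \<alpha> \<gamma>"
proof -
  define s where "s = ((x + y * real q) ^ k - x ^ k) / real q"
  have q0: "real q \<noteq> 0" using assms by simp
  have gen: "((x + y * Q) * S - x * T) / Q = (S - T) / Q * x + S * y" if "Q \<noteq> 0" for S T Q :: real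
    using that by (simp add: field_simps)
  have qs: "real q * s = (x + y * real q) ^ k - x ^ k" using assms by (simp add: s_def)
  have "(\<Sum>c\<in>{1..q}. transfer q x y k \<alpha> c * ((if c = \<gamma> then x else 0) + y))
      = (\<Sum>c\<in>{1..q}. (if c = \<gamma> then transfer q x y k \<alpha> \<gamma> * x else 0) + (if c = \<alpha> then x ^ k * y else 0) + s * y)"
    unfolding transfer_def s_def[symmetric] by (intro sum.cong refl) (auto simp: algebra_simps)
  also have "\<dots> = transfer q x y k \<alpha> \<gamma> * x + x ^ k * y + real q * (s * y)"
    using assms by (simp add: sum.distrib)
  also have "real q * (s * y) = ((x + y * real q) ^ k - x ^ k) * y" using qs by simp
  also have "transfer q x y k \<alpha> \<gamma> * x + x ^ k * y + ((x + y * real q) ^ k - x ^ k) * y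
      = transfer q x y (Suc k) \<alpha> \<gamma>"
    unfolding transfer_def power_Suc gen[OF q0] by (simp add: algebra_simps)
  finally show ?thesis .
qed

text \<open>The inner vertices are summed out from the last one backwards. H is arbitrary and may
  depend on the colour of the last vertex, so that each induction step can put one more matrix entry
  into it.\<close>

lemma sum_chain:
  fixes H :: "nat \<Rightarrow> ('v \<Rightarrow> nat) \<Rightarrow> real" and vs :: "nat \<Rightarrow> 'v"
  assumes q: "q > 0" and vs0: "vs 0 \<in> A"
    and vs: "inj_on vs {1..k}" "\<And>j. j \<in> {1..k} \<Longrightarrow> vs j \<notin> A"
  shows "(\<Sum>\<sigma>\<in>(A \<union> vs ` {1..k}) \<rightarrow>\<^sub>E {1..q}.
      (\<Prod>j<k. (if \<sigma> (vs j) = \<sigma> (vs (Suc j)) then x else 0) + y) * H (\<sigma> (vs k)) (restrict \<sigma> A))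
    = (\<Sum>\<rho>\<in>A \<rightarrow>\<^sub>E {1..q}. \<Sum>c\<in>{1..q}. transfer q x y k (\<rho> (vs 0)) c * H c \<rho>)"
  using vs
proof (induction k arbitrary: H)
  case 0
  have "(\<Sum>c\<in>{1..q}. transfer q x y 0 (\<rho> (vs 0)) c * H c \<rho>) = H (\<rho> (vs 0)) \<rho>"
    if "\<rho> \<in> A \<rightarrow>\<^sub>E {1..q}" for \<rho>
  proof -
    have "\<rho> (vs 0) \<in> {1..q}" using that vs0 by auto
    then show ?thesis by (simp add: transfer_def if_distrib[of "\<lambda>x. x * _"] cong: if_cong)
  qed
  then show ?case by (intro sum.cong) (auto simp: restrict_PiE)
next
  case (Suc k)
  let ?A = "A \<union> vs ` {1..k}"
  let ?t = "\<lambda>(c::nat) (d::nat). (if c = d then x else 0) + y"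
  have z: "vs (Suc k) \<notin> ?A"
  proof
    assume "vs (Suc k) \<in> ?A"
    moreover have "vs (Suc k) \<notin> A" using Suc.prems(2) by simp
    ultimately obtain j where "j \<in> {1..k}" "vs (Suc k) = vs j" by blast
    then show False using inj_onD[OF Suc.prems(1), of "Suc k" j] by simp
  qed
  have A': "A \<union> vs ` {1..Suc k} = insert (vs (Suc k)) ?A" by (auto simp: atLeastAtMostSuc_conv)
  have inA: "vs j \<in> ?A" if "j \<le> k" for j using that vs0 by (cases j) auto
  have "(\<Sum>\<sigma>\<in>insert (vs (Suc k)) ?A \<rightarrow>\<^sub>E {1..q}.
      (\<Prod>j<Suc k. ?t (\<sigma> (vs j)) (\<sigma> (vs (Suc j)))) * H (\<sigma> (vs (Suc k))) (restrict \<sigma> A))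
    = (\<Sum>\<sigma>\<in>?A \<rightarrow>\<^sub>E {1..q}. \<Sum>c\<in>{1..q}.
        (\<Prod>j<k. ?t (\<sigma> (vs j)) (\<sigma> (vs (Suc j)))) * (?t (\<sigma> (vs k)) c * H c (restrict \<sigma> A)))"
    unfolding sum_PiE_insert[OF z]
  proof (intro sum.cong refl)
    fix \<sigma> :: "'v \<Rightarrow> nat" and c :: nat
    let ?\<sigma> = "\<sigma>(vs (Suc k) := c)"
    have ne: "vs j \<noteq> vs (Suc k)" if "j \<le> k" for j using inA[OF that] z by metis
    have "restrict ?\<sigma> A = restrict \<sigma> A" using z by (auto simp: restrict_def)
    moreover have "(\<Prod>j<k. ?t (?\<sigma> (vs j)) (?\<sigma> (vs (Suc j)))) = (\<Prod>j<k. ?t (\<sigma> (vs j)) (\<sigma> (vs (Suc j))))"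
      using ne by (intro prod.cong refl) auto
    moreover have "?\<sigma> (vs k) = \<sigma> (vs k)" "?\<sigma> (vs (Suc k)) = c" using ne[of k] by auto
    ultimately show "(\<Prod>j<Suc k. ?t (?\<sigma> (vs j)) (?\<sigma> (vs (Suc j)))) * H (?\<sigma> (vs (Suc k))) (restrict ?\<sigma> A)
      = (\<Prod>j<k. ?t (\<sigma> (vs j)) (\<sigma> (vs (Suc j)))) * (?t (\<sigma> (vs k)) c * H c (restrict \<sigma> A))"
      by (simp only: prod.lessThan_Suc mult.assoc)
  qed
  also have "\<dots> = (\<Sum>\<sigma>\<in>?A \<rightarrow>\<^sub>E {1..q}. (\<Prod>j<k. ?t (\<sigma> (vs j)) (\<sigma> (vs (Suc j))))
      * (\<Sum>c\<in>{1..q}. ?t (\<sigma> (vs k)) c * H c (restrict \<sigma> A)))"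
    by (simp only: sum_distrib_left)
  also have "\<dots> = (\<Sum>\<rho>\<in>A \<rightarrow>\<^sub>E {1..q}. \<Sum>d\<in>{1..q}. transfer q x y k (\<rho> (vs 0)) d * (\<Sum>c\<in>{1..q}. ?t d c * H c \<rho>))"
  proof (rule Suc.IH)
    show "inj_on vs {1..k}" using Suc.prems(1) by (rule inj_on_subset) auto
    show "vs j \<notin> A" if "j \<in> {1..k}" for j using Suc.prems(2)[of j] that by simp
  qed
  also have "\<dots> = (\<Sum>\<rho>\<in>A \<rightarrow>\<^sub>E {1..q}. \<Sum>c\<in>{1..q}. transfer q x y (Suc k) (\<rho> (vs 0)) c * H c \<rho>)"
  proof (rule sum.cong[OF refl])
    fix \<rho> assume "\<rho> \<in> A \<rightarrow>\<^sub>E {1..q}"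
    then have \<rho>0: "\<rho> (vs 0) \<in> {1..q}" using vs0 by auto
    have "(\<Sum>d\<in>{1..q}. transfer q x y k (\<rho> (vs 0)) d * (\<Sum>c\<in>{1..q}. ?t d c * H c \<rho>))
        = (\<Sum>c\<in>{1..q}. \<Sum>d\<in>{1..q}. transfer q x y k (\<rho> (vs 0)) d * ?t d c * H c \<rho>)"
      unfolding sum_distrib_left mult.assoc by (rule sum.swap)
    also have "\<dots> = (\<Sum>c\<in>{1..q}. transfer q x y (Suc k) (\<rho> (vs 0)) c * H c \<rho>)"
      unfolding sum_distrib_right[symmetric]
      by (intro sum.cong refl arg_cong2[of _ _ _ _ "(*)"] transfer_Suc[OF q _ \<rho>0]) auto
    finally show "(\<Sum>d\<in>{1..q}. transfer q x y k (\<rho> (vs 0)) d * (\<Sum>c\<in>{1..q}. ?t d c * H c \<rho>))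
        = (\<Sum>c\<in>{1..q}. transfer q x y (Suc k) (\<rho> (vs 0)) c * H c \<rho>)" .
  qed
  finally show ?case unfolding A' .
qed

lemma sum_path:
  fixes G :: "('v \<Rightarrow> nat) \<Rightarrow> real" and vs :: "nat \<Rightarrow> 'v"
  assumes q: "q > 0" and ends: "vs 0 \<in> A" "vs (Suc k) \<in> A"
    and vs: "inj_on vs {1..k}" "\<And>j. j \<in> {1..k} \<Longrightarrow> vs j \<notin> A"
  shows "(\<Sum>\<sigma>\<in>(A \<union> vs ` {1..k}) \<rightarrow>\<^sub>E {1..q}.
      (\<Prod>j<Suc k. (if \<sigma> (vs j) = \<sigma> (vs (Suc j)) then x else 0) + y) * G (restrict \<sigma> A))
    = (\<Sum>\<rho>\<in>A \<rightarrow>\<^sub>E {1..q}. transfer q x y (Suc k) (\<rho> (vs 0)) (\<rho> (vs (Suc k))) * G \<rho>)"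
proof -
  let ?t = "\<lambda>(c::nat) (d::nat). (if c = d then x else 0) + y"
  have "(\<Sum>\<sigma>\<in>(A \<union> vs ` {1..k}) \<rightarrow>\<^sub>E {1..q}. (\<Prod>j<Suc k. ?t (\<sigma> (vs j)) (\<sigma> (vs (Suc j)))) * G (restrict \<sigma> A))
      = (\<Sum>\<sigma>\<in>(A \<union> vs ` {1..k}) \<rightarrow>\<^sub>E {1..q}. (\<Prod>j<k. ?t (\<sigma> (vs j)) (\<sigma> (vs (Suc j))))
          * (?t (\<sigma> (vs k)) (restrict \<sigma> A (vs (Suc k))) * G (restrict \<sigma> A)))"
    using ends by (simp add: mult.assoc)
  also have "\<dots> = (\<Sum>\<rho>\<in>A \<rightarrow>\<^sub>E {1..q}. \<Sum>c\<in>{1..q}. transfer q x y k (\<rho> (vs 0)) c * (?t c (\<rho> (vs (Suc k))) * G \<rho>))"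
    using sum_chain[OF q ends(1) vs, where H = "\<lambda>c \<rho>. ?t c (\<rho> (vs (Suc k))) * G \<rho>"] by simp
  also have "\<dots> = (\<Sum>\<rho>\<in>A \<rightarrow>\<^sub>E {1..q}. transfer q x y (Suc k) (\<rho> (vs 0)) (\<rho> (vs (Suc k))) * G \<rho>)"
  proof (rule sum.cong[OF refl])
    fix \<rho> assume "\<rho> \<in> A \<rightarrow>\<^sub>E {1..q}"
    then have \<rho>: "\<rho> (vs 0) \<in> {1..q}" "\<rho> (vs (Suc k)) \<in> {1..q}" using ends by auto
    show "(\<Sum>c\<in>{1..q}. transfer q x y k (\<rho> (vs 0)) c * (?t c (\<rho> (vs (Suc k))) * G \<rho>))
        = transfer q x y (Suc k) (\<rho> (vs 0)) (\<rho> (vs (Suc k))) * G \<rho>"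
      unfolding mult.assoc[symmetric] sum_distrib_right[symmetric]
      by (subst transfer_Suc[OF q \<rho>(2) \<rho>(1)]) simp
  qed
  finally show ?thesis .
qed

section \<open>The bounded-degree graph\<close>

text \<open>The vertices below \<open>N\<close> are hubs, one for each vertex of the multigraph. They are followed, for
  each edge \<open>i < M\<close>, by the vertices \<open>pv i 0, \<dots>, pv i l\<close> of a path, and by at least \<open>\<Delta>\<close> further
  vertices owned by hub \<open>0\<close>. The vertices other than the inner vertices of the paths form one tree for
  each owner, a path in which \<open>par\<close> is the predecessor, except that the last \<open>\<Delta> - 1\<close> vertices are
  children of \<open>n - \<Delta>\<close>, which thus has degree \<open>\<Delta>\<close>.\<close>
locale blowup = edge_list N q a b for N q a b +
  fixes M l \<Delta> n :: nat
  assumes l: "2 \<le> l" and \<Delta>: "3 \<le> \<Delta>" and n: "N + M * (l + 1) + \<Delta> \<le> n"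
begin

definition base :: nat where "base = N + M * (l + 1)"

definition pv :: "nat \<Rightarrow> nat \<Rightarrow> nat" where "pv i j = N + i * (l + 1) + j"

abbreviation V :: "nat set" where "V \<equiv> {..<n}"

definition W :: "nat set" where "W = V - (\<Union>i<M. pv i ` {1..l - 1})"

text \<open>Quotient and remainder by l + 1 invert \<open>pv\<close>: remainder 0 is the start of
  path i, in the tree of hub \<open>a i\<close>, and remainder l its end, in the tree of hub
  \<open>b i\<close>.\<close>

definition own :: "nat \<Rightarrow> nat" where
  "own w = (if w < N then w else if w < base then
     (if (w - N) mod (l + 1) = 0 then a ((w - N) div (l + 1)) else b ((w - N) div (l + 1))) else 0)"

definition par :: "nat \<Rightarrow> nat" where
  "par w = (if n - \<Delta> < w then n - \<Delta> else Max {u \<in> W. u < w \<and> own u = own w})"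

definition B :: "nat set set" where "B = (\<lambda>w. {par w, w}) ` {w \<in> W. N \<le> w}"

definition P :: "nat \<Rightarrow> nat set set" where "P i = (\<lambda>j. {pv i j, pv i (Suc j)}) ` {..<l}"

definition E :: "nat set set" where "E = B \<union> (\<Union>i<M. P i)"

definition red :: "nat set set \<Rightarrow> nat set" where "red \<omega> = {i \<in> {..<M}. P i \<subseteq> \<omega>}"

lemma base_le: "base + \<Delta> \<le> n" using n by (simp add: base_def)

lemma pv_div_mod:
  assumes "j \<le> l"
  shows "(pv i j - N) div (l + 1) = i" "(pv i j - N) mod (l + 1) = j"
proof -
  have eq: "pv i j - N = j + i * (l + 1)" by (simp add: pv_def)
  have j: "j < l + 1" and ne: "l + 1 \<noteq> 0" using assms by auto
  show "(pv i j - N) div (l + 1) = i"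
    unfolding eq div_mult_self1[OF ne] using j by (simp only: div_less add_0_right)
  show "(pv i j - N) mod (l + 1) = j"
    unfolding eq mod_mult_self1 using j by (rule mod_less)
qed

lemma pv_inj: "pv i j = pv i' j' \<Longrightarrow> j \<le> l \<Longrightarrow> j' \<le> l \<Longrightarrow> i = i' \<and> j = j'"
  using pv_div_mod[of j i] pv_div_mod[of j' i'] by simp

lemma inner_index: "j \<in> {1..l - 1} \<Longrightarrow> 0 < j \<and> j < l"
  using l by auto

lemma pv_ge: "N \<le> pv i j" by (simp add: pv_def)

lemma pv_less_base: "i < M \<Longrightarrow> j \<le> l \<Longrightarrow> pv i j < base"
proof -
  assume i: "i < M" and j: "j \<le> l"
  have "i * (l + 1) + j < (i + 1) * (l + 1)" using j by simp
  also have "\<dots> \<le> M * (l + 1)" using i by (intro mult_right_mono) auto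
  finally show ?thesis by (simp add: pv_def base_def)
qed

lemma pv_in_V: "i < M \<Longrightarrow> j \<le> l \<Longrightarrow> pv i j \<in> V"
  using pv_less_base[of i j] base_le by simp

lemma pv_in_W: "i < M \<Longrightarrow> pv i 0 \<in> W" "i < M \<Longrightarrow> pv i l \<in> W"
proof -
  assume i: "i < M"
  have ne: "pv i 0 \<noteq> pv i' j" "pv i l \<noteq> pv i' j" if "j \<in> {1..l - 1}" for i' j
    using pv_inj[of i 0 i' j] pv_inj[of i l i' j] inner_index[OF that] by auto
  show "pv i 0 \<in> W" "pv i l \<in> W"
    using pv_in_V[OF i, of 0] pv_in_V[OF i, of l] ne unfolding W_def by blast+
qed

lemma pv_notin_W: "i < M \<Longrightarrow> j \<in> {1..l - 1} \<Longrightarrow> pv i j \<notin> W"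
  unfolding W_def by blast

lemma W_subset: "W \<subseteq> V" by (auto simp: W_def)

lemma finite_W: "finite W" using W_subset finite_subset by blast

lemma hub_in_W: "v < N \<Longrightarrow> v \<in> W"
proof -
  assume v: "v < N"
  then have "v \<noteq> pv i j" for i j using pv_ge[of i j] by simp
  then show ?thesis using v base_le by (auto simp: W_def base_def)
qed

lemma outer_in_W: "base \<le> v \<Longrightarrow> v < n \<Longrightarrow> v \<in> W"
proof -
  assume v: "base \<le> v" "v < n"
  have "v \<noteq> pv i j" if "i < M" "j \<in> {1..l - 1}" for i j
    using pv_less_base[OF that(1), of j] inner_index[OF that(2)] v by auto
  moreover have "v \<in> V" using v by simp
  ultimately show ?thesis unfolding W_def by blast
qed

lemma own_less: "own w < N"
  using ends N_pos by (simp add: own_def)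

lemma own_pv: "i < M \<Longrightarrow> own (pv i 0) = a i" "i < M \<Longrightarrow> own (pv i l) = b i"
proof -
  assume i: "i < M"
  have "\<not> pv i j < N" for j by (simp add: pv_def)
  then show "own (pv i 0) = a i" "own (pv i l) = b i"
    using pv_less_base[OF i, of 0] pv_less_base[OF i, of l] pv_div_mod[of 0 i] pv_div_mod[of l i] l
    unfolding own_def by simp_all
qed

lemma par_props:
  assumes w: "w \<in> W" "N \<le> w"
  shows "par w \<in> W" "par w < w" "own (par w) = own w"
proof -
  have "par w \<in> W \<and> par w < w \<and> own (par w) = own w"
  proof (cases "n - \<Delta> < w")
    case True
    have c: "base \<le> n - \<Delta>" "n - \<Delta> < n" using base_le \<Delta> by auto
    then have "own (n - \<Delta>) = 0" "own w = 0" using True by (auto simp: own_def base_def)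
    then show ?thesis using True outer_in_W[OF c] by (simp add: par_def)
  next
    case False
    let ?S = "{u \<in> W. u < w \<and> own u = own w}"
    have "own w \<in> ?S" using own_less[of w] w hub_in_W by (auto simp: own_def)
    then have "Max ?S \<in> ?S" using finite_W by (intro Max_in) auto
    then show ?thesis using False by (simp add: par_def)
  qed
  then show "par w \<in> W" "par w < w" "own (par w) = own w" by auto
qed

lemma B_edge: "e \<in> B \<Longrightarrow> e \<subseteq> W \<and> card e = 2"
  using par_props by (fastforce simp: B_def card_2_iff)

lemma P_edge: "i < M \<Longrightarrow> e \<in> P i \<Longrightarrow> e \<subseteq> V \<and> card e = 2"
proof -
  assume i: "i < M" and e: "e \<in> P i"
  then obtain j where j: "j < l" "e = {pv i j, pv i (Suc j)}" by (auto simp: P_def)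
  have "pv i j \<noteq> pv i (Suc j)" by (simp add: pv_def)
  then show ?thesis using j pv_in_V[OF i, of j] pv_in_V[OF i, of "Suc j"] by simp
qed

lemma E_edges: "\<forall>e\<in>E. e \<subseteq> V \<and> card e = 2"
  using B_edge P_edge W_subset unfolding E_def by blast

lemma finite_B: "finite B" using finite_W by (simp add: B_def)

lemma finite_P: "finite (P i)" by (simp add: P_def)

lemma P_not_in_W: "i < M \<Longrightarrow> e \<in> P i \<Longrightarrow> \<not> e \<subseteq> W"
proof -
  assume i: "i < M" and e: "e \<in> P i"
  then obtain j where j: "j < l" "e = {pv i j, pv i (Suc j)}" by (auto simp: P_def)
  show ?thesis
  proof (cases "j = 0")
    case True
    then show ?thesis using pv_notin_W[OF i, of 1] j l by auto
  next
    case False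
    then show ?thesis using pv_notin_W[OF i, of j] j by auto
  qed
qed

lemma P_disjoint_B: "i < M \<Longrightarrow> P i \<inter> B = {}"
  using P_not_in_W B_edge by blast

lemma P_disjoint: "i < M \<Longrightarrow> i' < M \<Longrightarrow> i \<noteq> i' \<Longrightarrow> P i \<inter> P i' = {}"
proof (rule ccontr)
  assume ne: "i \<noteq> i'" and "P i \<inter> P i' \<noteq> {}"
  then obtain e where e: "e \<in> P i" "e \<in> P i'" by blast
  then obtain j j' where j: "j < l" "e = {pv i j, pv i (Suc j)}" "j' < l" "e = {pv i' j', pv i' (Suc j')}"
    by (auto simp: P_def)
  then have "pv i j \<in> {pv i' j', pv i' (Suc j')}" by auto
  then have "i = i'" using pv_inj[of i j i' j'] pv_inj[of i j i' "Suc j'"] j by auto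
  then show False using ne by simp
qed

lemma inj_path_edge: "inj_on (\<lambda>j. {pv i j, pv i (Suc j)}) {..<l}"
  by (rule inj_onI) (auto simp: pv_def doubleton_eq_iff)

lemma B_nonempty: "B \<noteq> {}"
proof -
  have "n - 1 \<in> W" "N \<le> n - 1" using outer_in_W[of "n - 1"] base_le \<Delta> by (auto simp: base_def)
  then show ?thesis by (auto simp: B_def)
qed

text \<open>Tree edges correspond to the vertices of W above the hubs: two path ends per multigraph
  edge and the vertices from \<open>base\<close> on. The term 2 M does not involve l, so long paths
  make the trees cheap.\<close>

lemma card_B_le: "card B \<le> 2 * M + (n - base)"
proof -
  have "{w \<in> W. N \<le> w} \<subseteq> (\<lambda>i. pv i 0) ` {..<M} \<union> (\<lambda>i. pv i l) ` {..<M} \<union> {base..<n}"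
  proof
    fix w assume "w \<in> {w \<in> W. N \<le> w}"
    then have w: "w \<in> W" "N \<le> w" by auto
    show "w \<in> (\<lambda>i. pv i 0) ` {..<M} \<union> (\<lambda>i. pv i l) ` {..<M} \<union> {base..<n}"
    proof (cases "base \<le> w")
      case True
      then show ?thesis using w W_subset by auto
    next
      case False
      define i where "i = (w - N) div (l + 1)"
      define j where "j = (w - N) mod (l + 1)"
      have "N + ((w - N) div (l + 1) * (l + 1) + (w - N) mod (l + 1)) = w"
        unfolding div_mult_mod_eq using w by simp
      then have wij: "w = pv i j" by (simp only: pv_def i_def j_def add.assoc)
      have "w - N < M * (l + 1)" using False w by (simp add: base_def)
      then have i: "i < M" by (simp add: i_def less_mult_imp_div_less)
      have jl: "j < l + 1" unfolding j_def by (rule mod_less_divisor) simp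
      then have "j = 0 \<or> j = l \<or> j \<in> {1..l - 1}" by auto
      then show ?thesis using pv_notin_W[OF i, of j] w wij i by auto
    qed
  qed
  then have "card {w \<in> W. N \<le> w} \<le> card ((\<lambda>i. pv i 0) ` {..<M} \<union> (\<lambda>i. pv i l) ` {..<M} \<union> {base..<n})"
    by (intro card_mono) auto
  also have "\<dots> \<le> card ((\<lambda>i. pv i 0) ` {..<M}) + card ((\<lambda>i. pv i l) ` {..<M}) + card {base..<n}"
    by (meson add_mono card_Un_le order_refl order_trans)
  also have "\<dots> \<le> M + M + (n - base)"
    using card_image_le[of "{..<M}" "\<lambda>i. pv i 0"] card_image_le[of "{..<M}" "\<lambda>i. pv i l"] by simp
  finally show ?thesis unfolding B_def using card_image_le[of "{w \<in> W. N \<le> w}" "\<lambda>w. {par w, w}"] finite_W by simp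
qed

lemma card_E_le: "card E \<le> 2 * n"
proof -
  have "card E \<le> card B + card (\<Union>i<M. P i)" unfolding E_def by (rule card_Un_le)
  also have "card B \<le> n"
  proof -
    have "card B \<le> card {w \<in> W. N \<le> w}" unfolding B_def using finite_W by (intro card_image_le) auto
    also have "\<dots> \<le> card V" using W_subset by (intro card_mono) auto
    finally show ?thesis by simp
  qed
  also have "card (\<Union>i<M. P i) \<le> n"
  proof -
    have "card (\<Union>i<M. P i) \<le> (\<Sum>i<M. card (P i))" by (rule card_UN_le) simp
    also have "\<dots> \<le> (\<Sum>i<M. l)"
      using card_image_le[of "{..<l}" "\<lambda>j. {pv i j, pv i (Suc j)}" for i] by (intro sum_mono) (simp add: P_def)
    also have "\<dots> \<le> n" using n by simp
    finally show ?thesis .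
  qed
  finally show ?thesis by simp
qed

text \<open>Vertices with the same predecessor have the same owner, and the predecessor of the later
  one, a maximum over earlier vertices, would be at least the earlier one.\<close>

lemma children_le_1:
  assumes "v \<noteq> n - \<Delta>" "w \<in> W" "N \<le> w" "par w = v" "w' \<in> W" "N \<le> w'" "par w' = v"
  shows "w = w'"
proof -
  have less: False if "w \<in> W" "N \<le> w" "par w = v" "w' \<in> W" "N \<le> w'" "par w' = v" "w < w'" for w w'
  proof -
    have "\<not> n - \<Delta> < w'" using that assms(1) by (auto simp: par_def)
    then have "v = Max {u \<in> W. u < w' \<and> own u = own w'}" using that by (simp add: par_def)
    moreover have "own w = own w'" using par_props(3)[of w] par_props(3)[of w'] that by simp
    then have "w \<le> Max {u \<in> W. u < w' \<and> own u = own w'}"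
      using that finite_W by (intro Max_ge) auto
    ultimately show False using par_props(2)[of w] that by simp
  qed
  show ?thesis using less[of w w'] less[of w' w] assms by (metis linorder_neqE_nat)
qed

lemma degree_centre: "vertex_degree E (n - \<Delta>) = \<Delta>"
proof -
  let ?c = "n - \<Delta>"
  have c: "base \<le> ?c" "?c < n" "N \<le> ?c" using base_le \<Delta> by (auto simp: base_def)
  have cW: "?c \<in> W" by (rule outer_in_W[OF c(1,2)])
  \<comment> \<open>The edge of the centre to its own predecessor and those to its \<Delta> - 1
    children, one for each w from n - \<Delta> on.\<close>
  have "{e \<in> E. ?c \<in> e} = (\<lambda>w. {par w, w}) ` {?c..<n}"
  proof (intro equalityI subsetI)
    fix e assume "e \<in> {e \<in> E. ?c \<in> e}"
    then have e: "e \<in> E" "?c \<in> e" by auto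
    have "e \<notin> P i" if "i < M" for i
    proof
      assume "e \<in> P i"
      then obtain j where j: "j < l" "e = {pv i j, pv i (Suc j)}" by (auto simp: P_def)
      then show False using e(2) pv_less_base[OF that, of j] pv_less_base[OF that, of "Suc j"] c(1) by auto
    qed
    then have "e \<in> B" using e(1) by (auto simp: E_def)
    then obtain w where w: "w \<in> W" "N \<le> w" "e = {par w, w}" by (auto simp: B_def)
    then have "?c \<le> w" using e(2) par_props(2)[OF w(1,2)] by auto
    then show "e \<in> (\<lambda>w. {par w, w}) ` {?c..<n}" using w W_subset by auto
  next
    fix e assume "e \<in> (\<lambda>w. {par w, w}) ` {?c..<n}"
    then obtain w where w: "?c \<le> w" "w < n" "e = {par w, w}" by auto
    then have "w \<in> W" "N \<le> w" using outer_in_W[of w] c by auto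
    then have "e \<in> B" using w(3) by (auto simp: B_def)
    moreover have "?c \<in> e" using w by (cases "w = ?c") (auto simp: par_def)
    ultimately show "e \<in> {e \<in> E. ?c \<in> e}" by (simp add: E_def)
  qed
  moreover have "inj_on (\<lambda>w. {par w, w}) {?c..<n}"
  proof (rule inj_onI)
    fix w w' assume w: "w \<in> {?c..<n}" "w' \<in> {?c..<n}" and e: "{par w, w} = {par w', w'}"
    have "w \<in> W" "N \<le> w" "w' \<in> W" "N \<le> w'" using w outer_in_W c by auto
    then have "par w < w" "par w' < w'" using par_props(2) by auto
    then show "w = w'" using e by (auto simp: doubleton_eq_iff)
  qed
  ultimately show ?thesis using c n by (simp add: vertex_degree_def card_image)
qed

text \<open>An inner path vertex has two path edges and no tree edge. Any other vertex except the
  centre has at most one path edge and at most two tree edges, to its predecessor and to a single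
  child.\<close>

lemma degree_le: "vertex_degree E v \<le> \<Delta>"
proof (cases "v = n - \<Delta>")
  case True
  then show ?thesis using degree_centre by simp
next
  case False
  define i where "i = (v - N) div (l + 1)"
  define j where "j = (v - N) mod (l + 1)"
  define e where "e k = {pv i k, pv i (Suc k)}" for k
  have path: "{e' \<in> \<Union>i<M. P i. v \<in> e'} \<subseteq> (if j < l then {e j} else {}) \<union> (if 0 < j then {e (j - 1)} else {})"
  proof
    fix e' assume "e' \<in> {e' \<in> \<Union>i<M. P i. v \<in> e'}"
    then obtain i' k where k: "i' < M" "k < l" "e' = {pv i' k, pv i' (Suc k)}" "v \<in> e'" by (auto simp: P_def)
    have ij: "i' = i \<and> k' = j" if "v = pv i' k'" "k' \<le> l" for k'
    proof -
      show ?thesis using that pv_div_mod[of k' i'] by (simp add: i_def j_def)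
    qed
    from k(3,4) consider "v = pv i' k" | "v = pv i' (Suc k)" by auto
    then show "e' \<in> (if j < l then {e j} else {}) \<union> (if 0 < j then {e (j - 1)} else {})"
    proof cases
      case 1
      then show ?thesis using ij[of k] k by (simp add: e_def)
    next
      case 2
      then have "i' = i" "Suc k = j" using ij[of "Suc k"] k by auto
      then show ?thesis using k by (auto simp: e_def)
    qed
  qed
  have tree: "card {e' \<in> B. v \<in> e'} \<le> 2"
  proof -
    define Ch where "Ch = {w \<in> W. N \<le> w \<and> par w = v}"
    have fin: "finite Ch" using finite_W by (simp add: Ch_def)
    have "card Ch \<le> 1"
      unfolding card_le_Suc0_iff_eq[OF fin, unfolded One_nat_def[symmetric]]
      using children_le_1[OF False] by (auto simp: Ch_def)
    have "{e' \<in> B. v \<in> e'} \<subseteq> (\<lambda>w. {par w, w}) ` (insert v Ch)"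
      by (auto simp: B_def Ch_def)
    then have "card {e' \<in> B. v \<in> e'} \<le> card ((\<lambda>w. {par w, w}) ` (insert v Ch))"
      using fin by (intro card_mono) auto
    also have "\<dots> \<le> card (insert v Ch)" using fin by (intro card_image_le) auto
    also have "\<dots> \<le> Suc (card Ch)" by (rule card_insert_le_m1[THEN order_trans]) (use fin in auto)
    finally show ?thesis using \<open>card Ch \<le> 1\<close> by simp
  qed
  have split: "vertex_degree E v \<le> card {e' \<in> B. v \<in> e'} + card {e' \<in> \<Union>i<M. P i. v \<in> e'}"
  proof -
    have "{e' \<in> E. v \<in> e'} = {e' \<in> B. v \<in> e'} \<union> {e' \<in> \<Union>i<M. P i. v \<in> e'}"
      unfolding E_def by blast
    then show ?thesis unfolding vertex_degree_def by (simp only: card_Un_le)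
  qed
  show ?thesis
  \<comment> \<open>Quotient and remainder are defined for every v, so it takes an incident path
    edge to conclude that v is an inner vertex.\<close>
  proof (cases "0 < j \<and> j < l \<and> {e' \<in> \<Union>i<M. P i. v \<in> e'} \<noteq> {}")
    case True
    then obtain i' k where k: "i' < M" "k < l" "v \<in> {pv i' k, pv i' (Suc k)}" by (auto simp: P_def)
    then have "v = pv i' k \<or> v = pv i' (Suc k)" by blast
    then obtain k' where k': "v = pv i' k'" "k' \<le> l"
    proof
      assume "v = pv i' k"
      then show thesis using that[of k] k(2) by simp
    next
      assume "v = pv i' (Suc k)"
      then show thesis using that[of "Suc k"] k(2) by simp
    qed
    have "k' = j" using k' pv_div_mod[of k' i'] by (simp add: j_def)
    then have "k' \<in> {1..l - 1}" using True by auto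
    then have "v \<notin> W" unfolding k'(1) by (rule pv_notin_W[OF k(1)])
    then have "{e' \<in> B. v \<in> e'} = {}" using B_edge by blast
    then have "card {e' \<in> B. v \<in> e'} = 0" by (simp only: card.empty)
    moreover have "card {e' \<in> \<Union>i<M. P i. v \<in> e'} \<le> card {e j, e (j - 1)}"
      using path by (intro card_mono) (auto split: if_splits)
    moreover have "card {e j, e (j - 1)} \<le> 2" by (simp add: card_insert_if)
    ultimately show ?thesis using split \<Delta> by linarith
  next
    case False
    have "card {e' \<in> \<Union>i<M. P i. v \<in> e'} \<le> 1"
    proof (cases "{e' \<in> \<Union>i<M. P i. v \<in> e'} = {}")
      case True
      then show ?thesis by (metis card.empty zero_le)
    next
      case ne: False
      then have "{e' \<in> \<Union>i<M. P i. v \<in> e'} \<subseteq> {e j} \<or> {e' \<in> \<Union>i<M. P i. v \<in> e'} \<subseteq> {e (j - 1)}"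
        using False path by (auto split: if_splits)
      then show ?thesis
      proof
        assume "{e' \<in> \<Union>i<M. P i. v \<in> e'} \<subseteq> {e j}"
        then show ?thesis using card_mono[of "{e j}"] by fastforce
      next
        assume "{e' \<in> \<Union>i<M. P i. v \<in> e'} \<subseteq> {e (j - 1)}"
        then show ?thesis using card_mono[of "{e (j - 1)}"] by fastforce
      qed
    qed
    then show ?thesis using split tree \<Delta> by simp
  qed
qed

lemma max_degree_E: "max_degree V E = \<Delta>"
  unfolding max_degree_def
proof (rule Max_eqI)
  show "\<Delta> \<in> vertex_degree E ` V"
    using degree_centre base_le \<Delta> by (intro image_eqI[of _ _ "n - \<Delta>"]) auto
qed (auto simp: degree_le)

lemma simple_graph_E: "simple_graph V E"
  using E_edges by (simp add: simple_graph_def)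

end

text \<open>Closing an edge gains at most a factor \<open>q\<close> in the number of compatible colourings.\<close>
lemma sum_tree_weights_le:
  fixes p :: real
  assumes W: "finite W" and q: "q > 0" and p: "0 \<le> p" "p \<le> 1"
    and B: "finite B" "\<forall>e\<in>B. e \<subseteq> W \<and> card e = 2" and R: "R \<subseteq> W \<times> W"
  shows "(\<Sum>\<rho>\<in>compat W q R. \<Prod>e\<in>B. (if \<forall>u\<in>e. \<forall>v\<in>e. \<rho> u = \<rho> v then p else 0) + (1 - p))
    \<le> (p + (1 - p) * real q) ^ card B * real (card (compat W q (R \<union> edge_rel B)))"
  using B R
proof (induction B arbitrary: R rule: finite_induct)
  case empty
  then show ?case by (simp add: edge_rel_def)
next
  case (insert e B)
  obtain u v where e: "e = {u, v}" using insert.prems(1) by (meson card_2_iff insertI1)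
  have uv: "u \<in> W" "v \<in> W" using insert.prems(1) e by auto
  let ?f = "\<lambda>\<rho> e. (if \<forall>u\<in>e. \<forall>v\<in>e. \<rho> u = \<rho> v then p else 0) + (1 - p)"
  let ?c = "p + (1 - p) * real q"
  let ?n = "\<lambda>R. real (card (compat W q R))"
  have B: "\<forall>e\<in>B. e \<subseteq> W \<and> card e = 2" using insert.prems(1) by simp
  have sub: "R \<union> edge_rel B \<subseteq> W \<times> W"
    using insert.prems(2) B by (auto simp: edge_rel_def)
  have c: "0 \<le> ?c" using p by simp
  have ins: "compat W q (insert (u, v) R \<union> edge_rel B) = compat W q (R \<union> edge_rel (insert e B))"
    by (auto simp: compat_def edge_rel_def e doubleton_eq_iff)
  have "(\<Sum>\<rho>\<in>compat W q R. \<Prod>e\<in>insert e B. ?f \<rho> e)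
      = (\<Sum>\<rho>\<in>compat W q R. p * (if \<rho> u = \<rho> v then \<Prod>e\<in>B. ?f \<rho> e else 0) + (1 - p) * (\<Prod>e\<in>B. ?f \<rho> e))"
    using insert.hyps by (intro sum.cong refl) (auto simp: e algebra_simps)
  also have "\<dots> = p * (\<Sum>\<rho>\<in>compat W q (insert (u, v) R). \<Prod>e\<in>B. ?f \<rho> e)
      + (1 - p) * (\<Sum>\<rho>\<in>compat W q R. \<Prod>e\<in>B. ?f \<rho> e)"
    using W by (simp add: sum.distrib sum_distrib_left compat_insert sum.inter_filter)
  also have "\<dots> \<le> p * (?c ^ card B * ?n (insert (u, v) R \<union> edge_rel B))
      + (1 - p) * (?c ^ card B * ?n (R \<union> edge_rel B))"
    using p uv insert.prems(2) by (intro add_mono mult_left_mono insert.IH[OF B]) auto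
  also have "\<dots> \<le> p * (?c ^ card B * ?n (R \<union> edge_rel (insert e B)))
      + (1 - p) * (?c ^ card B * (real q * ?n (R \<union> edge_rel (insert e B))))"
  proof -
    have "card (compat W q (R \<union> edge_rel B)) \<le> q * card (compat W q (insert (u, v) (R \<union> edge_rel B)))"
      by (rule card_compat_insert[OF W sub uv])
    then have "?n (R \<union> edge_rel B) \<le> real q * ?n (R \<union> edge_rel (insert e B))"
      unfolding ins[symmetric] Un_insert_left by (simp only: of_nat_mult[symmetric] of_nat_le_iff)
    then show ?thesis unfolding ins using p c by (intro add_left_mono mult_left_mono) auto
  qed
  also have "\<dots> = ?c ^ card (insert e B) * ?n (R \<union> edge_rel (insert e B))"
    using insert.hyps by (simp add: algebra_simps)
  finally show ?case .
qed

section \<open>Summing out the inner vertices of the paths\<close>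

locale weighted_blowup = blowup +
  fixes p :: real
  assumes p_pos: "0 < p" and p_less_1: "p < 1"
begin

definition fw :: "(nat \<Rightarrow> nat) \<Rightarrow> nat set \<Rightarrow> real" where
  "fw \<sigma> e = (if \<forall>u\<in>e. \<forall>v\<in>e. \<sigma> u = \<sigma> v then p else 0)"

text \<open>Total weight of the states of a path that are not fully open, summed over the inner
  colours. It does not depend on the end colours, so such a path acts as a closed edge.\<close>

definition \<kappa> :: real where "\<kappa> = ((p + (1 - p) * real q) ^ l - p ^ l) / real q"

definition open_weight :: real where "open_weight = p ^ l / \<kappa>"

lemma q_pos: "q > 0" using q_ge_2 by simp

lemma \<kappa>_pos: "0 < \<kappa>"
proof -
  have "p < p + (1 - p) * real q" using p_less_1 q_pos by simp
  then have "p ^ l < (p + (1 - p) * real q) ^ l" using p_pos l by (intro power_strict_mono) auto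
  then show ?thesis using q_pos by (simp add: \<kappa>_def)
qed

sublocale G: rc_graph V E p q
proof
  show "E \<noteq> {}" using B_nonempty by (auto simp: E_def)
qed (use E_edges p_pos p_less_1 q_ge_2 in auto)

text \<open>The Edwards--Sokal expansion, in a form where the weight for a fixed \<sigma> is a
  product over edges.\<close>

lemma wt_eq:
  assumes \<omega>: "\<omega> \<subseteq> E"
  shows "G.wt \<omega> = (\<Sum>\<sigma>\<in>colourings V q. config_weight (fw \<sigma>) (\<lambda>_. 1 - p) E \<omega>)"
proof -
  have fin: "finite E" by (rule G.finite_E)
  have cw: "config_weight (fw \<sigma>) (\<lambda>_. 1 - p) E \<omega>
      = (if \<omega> \<subseteq> monochromatic E \<sigma> then p ^ card \<omega> * (1 - p) ^ (card E - card \<omega>) else 0)" for \<sigma>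
  proof -
    have "config_weight (fw \<sigma>) (\<lambda>_. 1 - p) E \<omega> = (\<Prod>e\<in>\<omega>. fw \<sigma> e) * (\<Prod>e\<in>E - \<omega>. 1 - p)"
      unfolding config_weight_def using \<omega> fin by (simp add: prod.If_cases Int_absorb1 Diff_eq)
    also have "(\<Prod>e\<in>E - \<omega>. 1 - p) = (1 - p) ^ (card E - card \<omega>)"
      using \<omega> fin by (simp add: card_Diff_subset finite_subset)
    also have "(\<Prod>e\<in>\<omega>. fw \<sigma> e) = (if \<omega> \<subseteq> monochromatic E \<sigma> then p ^ card \<omega> else 0)"
    proof (cases "\<omega> \<subseteq> monochromatic E \<sigma>")
      case True
      then have "(\<Prod>e\<in>\<omega>. fw \<sigma> e) = (\<Prod>e\<in>\<omega>. p)"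
        by (intro prod.cong refl) (auto simp: fw_def monochromatic_def)
      then show ?thesis using True by simp
    next
      case False
      then obtain e where e: "e \<in> \<omega>" "e \<notin> monochromatic E \<sigma>" by blast
      then have "fw \<sigma> e = 0" using \<omega> unfolding fw_def monochromatic_def by auto
      then have "(\<Prod>e\<in>\<omega>. fw \<sigma> e) = 0"
        using e(1) \<omega> fin finite_subset by (intro prod_zero) auto
      then show ?thesis using False by simp
    qed
    finally show ?thesis by simp
  qed
  have "compat V q (edge_rel \<omega>) = colourings V q \<inter> {\<sigma>. \<omega> \<subseteq> monochromatic E \<sigma>}"
    using G.compat_iff_mono[OF \<omega>] by auto
  then show ?thesis
    unfolding cw G.wt_def G.n_compat_def by (simp add: sum.If_cases)
qed

text \<open>y = 1 - p adds up all states of the path for a given colouring, y = 0 keeps only the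
  fully open one.\<close>

definition path_prod :: "real \<Rightarrow> nat \<Rightarrow> (nat \<Rightarrow> nat) \<Rightarrow> real" where
  "path_prod y i \<sigma> = (\<Prod>j<l. (if \<sigma> (pv i j) = \<sigma> (pv i (Suc j)) then p else 0) + y)"

definition path_weight :: "nat set \<Rightarrow> nat \<Rightarrow> (nat \<Rightarrow> nat) \<Rightarrow> real" where
  "path_weight r i \<sigma> = (if i \<in> r then path_prod 0 i \<sigma> else path_prod (1 - p) i \<sigma> - path_prod 0 i \<sigma>)"

definition end_weight :: "nat set \<Rightarrow> nat \<Rightarrow> (nat \<Rightarrow> nat) \<Rightarrow> real" where
  "end_weight r i \<rho> = (if i \<in> r then (if \<rho> (pv i 0) = \<rho> (pv i l) then p ^ l else 0) else \<kappa>)"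

lemma prod_path: "(\<Prod>e\<in>P i. fw \<sigma> e + y) = path_prod y i \<sigma>"
proof -
  have "(\<Prod>e\<in>P i. fw \<sigma> e + y) = (\<Prod>j<l. fw \<sigma> {pv i j, pv i (Suc j)} + y)"
    unfolding P_def by (subst prod.reindex[OF inj_path_edge]) simp
  also have "\<dots> = path_prod y i \<sigma>"
    unfolding path_prod_def by (intro prod.cong refl) (auto simp: fw_def)
  finally show ?thesis .
qed

text \<open>The inner vertices of path m occur in no other factor, so \<open>sum_path\<close>
  replaces them by a weight on the two ends. The ends lie in W, so this weight can be moved into G
  for the induction.\<close>

lemma sum_out_paths:
  assumes "m \<le> M"
  shows "(\<Sum>\<sigma>\<in>(W \<union> (\<Union>i<m. pv i ` {1..l - 1})) \<rightarrow>\<^sub>E {1..q}. G (restrict \<sigma> W) * (\<Prod>i<m. path_weight r i \<sigma>))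
    = (\<Sum>\<rho>\<in>W \<rightarrow>\<^sub>E {1..q}. G \<rho> * (\<Prod>i<m. end_weight r i \<rho>))"
  using assms
proof (induction m arbitrary: G)
  case 0
  have "restrict \<sigma> W = \<sigma>" if "\<sigma> \<in> W \<rightarrow>\<^sub>E {1..q}" for \<sigma>
    using that by (rule PiE_restrict)
  then show ?case by simp
next
  case (Suc m)
  let ?A = "W \<union> (\<Union>i<m. pv i ` {1..l - 1})"
  let ?K = "\<lambda>\<rho>. G (restrict \<rho> W) * (\<Prod>i<m. path_weight r i \<rho>)"
  have m: "m < M" using Suc.prems by simp
  have A': "W \<union> (\<Union>i<Suc m. pv i ` {1..l - 1}) = ?A \<union> pv m ` {1..l - 1}"
    by (simp only: lessThan_Suc UN_insert Un_ac)
  have l1: "Suc (l - 1) = l" using l by simp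
  have ends: "pv m 0 \<in> ?A" "pv m (Suc (l - 1)) \<in> ?A" using pv_in_W[OF m] by (simp_all only: l1 Un_iff simp_thms)
  have inj: "inj_on (pv m) {1..l - 1}" by (rule inj_onI) (simp add: pv_def)
  have notin: "pv m j \<notin> ?A" if j: "j \<in> {1..l - 1}" for j
  proof
    assume "pv m j \<in> ?A"
    then obtain i j' where "i < m" "j' \<in> {1..l - 1}" "pv m j = pv i j'"
      using pv_notin_W[OF m j] by blast
    then show False using pv_inj[of m j i j'] inner_index j by (metis less_imp_le less_irrefl)
  qed
  have restr: "path_weight r i (restrict \<sigma> ?A) = path_weight r i \<sigma>" if i: "i < m" for i \<sigma>
  proof -
    have "pv i j \<in> ?A" if j: "j \<le> l" for j
    proof -
      consider "j = 0" | "j = l" | "j \<in> {1..l - 1}" using j by fastforce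
      then show ?thesis
      proof cases
        case 3
        then show ?thesis using i by blast
      qed (use pv_in_W[of i] i m in simp_all)
    qed
    then have "path_prod y i (restrict \<sigma> ?A) = path_prod y i \<sigma>" for y
      unfolding path_prod_def by (intro prod.cong refl) auto
    then show ?thesis by (simp add: path_weight_def)
  qed
  have K: "?K (restrict \<sigma> ?A) = ?K \<sigma>" for \<sigma>
  proof -
    have "restrict (restrict \<sigma> ?A) W = restrict \<sigma> W"
      by (simp only: restrict_restrict Int_absorb1 Un_upper1)
    then show ?thesis using restr by simp
  qed
  have sum1: "(\<Sum>\<sigma>\<in>(?A \<union> pv m ` {1..l - 1}) \<rightarrow>\<^sub>E {1..q}. path_prod y m \<sigma> * ?K \<sigma>)
      = (\<Sum>\<rho>\<in>?A \<rightarrow>\<^sub>E {1..q}. transfer q p y l (\<rho> (pv m 0)) (\<rho> (pv m l)) * ?K \<rho>)" for y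
    using sum_path[OF q_pos ends inj notin, of p y ?K] unfolding l1 K path_prod_def by simp
  \<comment> \<open>In both matrices the diagonal exceeds the other entries by p^l, so their
    difference is constant.\<close>
  have closed: "transfer q p (1 - p) l \<alpha> \<gamma> - transfer q p 0 l \<alpha> \<gamma> = \<kappa>" for \<alpha> \<gamma>
    by (simp add: transfer_def \<kappa>_def)
  have op: "transfer q p 0 l \<alpha> \<gamma> = (if \<alpha> = \<gamma> then p ^ l else 0)" for \<alpha> \<gamma>
    by (simp add: transfer_def)
  have "(\<Sum>\<sigma>\<in>(?A \<union> pv m ` {1..l - 1}) \<rightarrow>\<^sub>E {1..q}. G (restrict \<sigma> W) * (\<Prod>i<Suc m. path_weight r i \<sigma>))
      = (\<Sum>\<sigma>\<in>(?A \<union> pv m ` {1..l - 1}) \<rightarrow>\<^sub>E {1..q}. path_weight r m \<sigma> * ?K \<sigma>)"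
    by (intro sum.cong refl) simp
  also have "\<dots> = (\<Sum>\<rho>\<in>?A \<rightarrow>\<^sub>E {1..q}. end_weight r m \<rho> * ?K \<rho>)"
  proof (cases "m \<in> r")
    case True
    then show ?thesis using sum1[of 0] by (simp only: path_weight_def end_weight_def op if_True)
  next
    case False
    then have "(\<Sum>\<sigma>\<in>(?A \<union> pv m ` {1..l - 1}) \<rightarrow>\<^sub>E {1..q}. path_weight r m \<sigma> * ?K \<sigma>)
        = (\<Sum>\<sigma>\<in>(?A \<union> pv m ` {1..l - 1}) \<rightarrow>\<^sub>E {1..q}. path_prod (1 - p) m \<sigma> * ?K \<sigma>)
          - (\<Sum>\<sigma>\<in>(?A \<union> pv m ` {1..l - 1}) \<rightarrow>\<^sub>E {1..q}. path_prod 0 m \<sigma> * ?K \<sigma>)"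
      by (simp only: path_weight_def if_False left_diff_distrib sum_subtractf)
    also have "\<dots> = (\<Sum>\<rho>\<in>?A \<rightarrow>\<^sub>E {1..q}. \<kappa> * ?K \<rho>)"
      unfolding sum1 sum_subtractf[symmetric] left_diff_distrib[symmetric] closed ..
    finally show ?thesis using False by (simp only: end_weight_def if_False)
  qed
  also have "\<dots> = (\<Sum>\<rho>\<in>?A \<rightarrow>\<^sub>E {1..q}.
      (\<lambda>\<rho>. G \<rho> * end_weight r m \<rho>) (restrict \<rho> W) * (\<Prod>i<m. path_weight r i \<rho>))"
  proof (intro sum.cong refl)
    fix \<rho>
    have "end_weight r m (restrict \<rho> W) = end_weight r m \<rho>"
      using pv_in_W[OF m] by (simp add: end_weight_def)
    then show "end_weight r m \<rho> * ?K \<rho>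
        = (\<lambda>\<rho>. G \<rho> * end_weight r m \<rho>) (restrict \<rho> W) * (\<Prod>i<m. path_weight r i \<rho>)" by simp
  qed
  also have "\<dots> = (\<Sum>\<rho>\<in>W \<rightarrow>\<^sub>E {1..q}. (\<lambda>\<rho>. G \<rho> * end_weight r m \<rho>) \<rho> * (\<Prod>i<m. end_weight r i \<rho>))"
    using Suc.prems by (intro Suc.IH) auto
  finally show ?case unfolding A' by (simp only: prod.lessThan_Suc mult.assoc mult.commute[of "end_weight r m _"])
qed

lemma V_eq: "V = W \<union> (\<Union>i<M. pv i ` {1..l - 1})"
proof -
  have "pv i j \<in> V" if "i < M" "j \<in> {1..l - 1}" for i j
    using pv_in_V[OF that(1), of j] inner_index[OF that(2)] by simp
  then show ?thesis unfolding W_def by blast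
qed

definition link_rel :: "nat set \<Rightarrow> (nat \<times> nat) set" where
  "link_rel r = (\<lambda>i. (pv i 0, pv i l)) ` r"

lemma prod_end_weight:
  assumes r: "r \<subseteq> {..<M}"
  shows "(\<Prod>i<M. end_weight r i \<rho>)
    = (if \<forall>(u, v)\<in>link_rel r. \<rho> u = \<rho> v then \<kappa> ^ M * open_weight ^ card r else 0)"
proof -
  have fin: "finite r" using r finite_subset by blast
  have "(\<Prod>i<M. end_weight r i \<rho>)
      = (\<Prod>i\<in>r. if \<rho> (pv i 0) = \<rho> (pv i l) then p ^ l else 0) * (\<Prod>i\<in>{..<M} - r. \<kappa>)"
    unfolding end_weight_def using r by (simp add: prod.If_cases Int_absorb1 Diff_eq)
  also have "(\<Prod>i\<in>{..<M} - r. \<kappa>) = \<kappa> ^ (M - card r)"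
    using r fin by (simp add: card_Diff_subset)
  also have "(\<Prod>i\<in>r. if \<rho> (pv i 0) = \<rho> (pv i l) then p ^ l else 0)
      = (if \<forall>(u, v)\<in>link_rel r. \<rho> u = \<rho> v then (p ^ l) ^ card r else 0)"
  proof (cases "\<forall>(u, v)\<in>link_rel r. \<rho> u = \<rho> v")
    case True
    then have "(\<Prod>i\<in>r. if \<rho> (pv i 0) = \<rho> (pv i l) then p ^ l else 0) = (\<Prod>i\<in>r. p ^ l)"
      by (intro prod.cong refl) (auto simp: link_rel_def)
    then show ?thesis using True by simp
  next
    case False
    then obtain i where "i \<in> r" "\<rho> (pv i 0) \<noteq> \<rho> (pv i l)" by (auto simp: link_rel_def)
    then have "(\<Prod>i\<in>r. if \<rho> (pv i 0) = \<rho> (pv i l) then p ^ l else 0) = 0"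
      using fin by (intro prod_zero) auto
    then show ?thesis by (simp only: False if_False)
  qed
  moreover have "(p ^ l) ^ card r * \<kappa> ^ (M - card r) = \<kappa> ^ M * open_weight ^ card r"
  proof -
    have "card r \<le> M" using card_mono[OF _ r] by simp
    then show ?thesis using \<kappa>_pos by (simp add: open_weight_def power_divide power_diff)
  qed
  ultimately show ?thesis by simp
qed

text \<open>Used twice: with Q demanding all tree edges open and y = 0 for the lower bound on a
  fibre, and without any demand and y = 1 - p for the upper bound.\<close>

lemma sum_wt_fibre:
  assumes r: "r \<subseteq> {..<M}" and Q: "\<And>\<sigma>. (\<Sum>\<omega>\<in>Pow B. if Q \<omega> then config_weight (fw \<sigma>) (\<lambda>_. 1 - p) B \<omega> else 0) = (\<Prod>e\<in>B. fw \<sigma> e + y)"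
  shows "(\<Sum>\<omega>\<in>{\<omega> \<in> Pow E. red \<omega> = r \<and> Q (\<omega> \<inter> B)}. G.wt \<omega>)
    = \<kappa> ^ M * open_weight ^ card r * (\<Sum>\<rho>\<in>compat W q (link_rel r). \<Prod>e\<in>B. fw \<rho> e + y)"
proof -
  have cond: "red \<omega> = r \<longleftrightarrow> (\<forall>i<M. P i \<subseteq> \<omega> \<longleftrightarrow> i \<in> r)" for \<omega>
    using r by (auto simp: red_def)
  have "(\<Sum>\<omega>\<in>{\<omega> \<in> Pow E. red \<omega> = r \<and> Q (\<omega> \<inter> B)}. G.wt \<omega>)
      = (\<Sum>\<omega>\<in>Pow E. if red \<omega> = r \<and> Q (\<omega> \<inter> B) then G.wt \<omega> else 0)"
    using G.finite_E by (intro sum.inter_filter) auto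
  also have "\<dots> = (\<Sum>\<omega>\<in>Pow E. \<Sum>\<sigma>\<in>colourings V q.
      if (\<forall>i<M. P i \<subseteq> \<omega> \<longleftrightarrow> i \<in> r) \<and> Q (\<omega> \<inter> B) then config_weight (fw \<sigma>) (\<lambda>_. 1 - p) E \<omega> else 0)"
    unfolding cond
  proof (intro sum.cong refl)
    have gen: "(if C then s else 0) = (\<Sum>\<sigma>\<in>S. if C then f \<sigma> else 0)" if "C \<Longrightarrow> s = sum f S"
      for C s S and f :: "(nat \<Rightarrow> nat) \<Rightarrow> real" using that by (cases C) auto
    fix \<omega> assume "\<omega> \<in> Pow E"
    then have "G.wt \<omega> = (\<Sum>\<sigma>\<in>colourings V q. config_weight (fw \<sigma>) (\<lambda>_. 1 - p) E \<omega>)"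
      by (intro wt_eq) simp
    then show "(if (\<forall>i<M. P i \<subseteq> \<omega> \<longleftrightarrow> i \<in> r) \<and> Q (\<omega> \<inter> B) then G.wt \<omega> else 0)
        = (\<Sum>\<sigma>\<in>colourings V q. if (\<forall>i<M. P i \<subseteq> \<omega> \<longleftrightarrow> i \<in> r) \<and> Q (\<omega> \<inter> B)
            then config_weight (fw \<sigma>) (\<lambda>_. 1 - p) E \<omega> else 0)"
      by (rule gen)
  qed
  also have "\<dots> = (\<Sum>\<sigma>\<in>colourings V q. \<Sum>\<omega>\<in>Pow E.
      if (\<forall>i<M. P i \<subseteq> \<omega> \<longleftrightarrow> i \<in> r) \<and> Q (\<omega> \<inter> B) then config_weight (fw \<sigma>) (\<lambda>_. 1 - p) E \<omega> else 0)"
    by (rule sum.swap)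
  also have "\<dots> = (\<Sum>\<sigma>\<in>colourings V q. (\<Prod>e\<in>B. fw \<sigma> e + y) * (\<Prod>i<M. path_weight r i \<sigma>))"
  proof (intro sum.cong refl)
    fix \<sigma>
    have "(\<Sum>\<omega>\<in>Pow E. if (\<forall>i<M. P i \<subseteq> \<omega> \<longleftrightarrow> i \<in> r) \<and> Q (\<omega> \<inter> B) then config_weight (fw \<sigma>) (\<lambda>_. 1 - p) E \<omega> else 0)
        = (\<Prod>e\<in>B. fw \<sigma> e + y) * (\<Prod>i<M. if i \<in> r then (\<Prod>e\<in>P i. fw \<sigma> e)
            else (\<Prod>e\<in>P i. fw \<sigma> e + (1 - p)) - (\<Prod>e\<in>P i. fw \<sigma> e))"
      unfolding E_def Q[symmetric]
      by (rule sum_config_weight_paths) (auto simp: finite_B finite_P P_disjoint_B P_disjoint)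
    also have "(\<Prod>i<M. if i \<in> r then (\<Prod>e\<in>P i. fw \<sigma> e)
            else (\<Prod>e\<in>P i. fw \<sigma> e + (1 - p)) - (\<Prod>e\<in>P i. fw \<sigma> e)) = (\<Prod>i<M. path_weight r i \<sigma>)"
    proof -
      have "(\<Prod>e\<in>P i. fw \<sigma> e) = path_prod 0 i \<sigma>" for i using prod_path[of \<sigma> 0 i] by simp
      then show ?thesis by (simp only: path_weight_def prod_path cong: if_cong)
    qed
    finally show "(\<Sum>\<omega>\<in>Pow E. if (\<forall>i<M. P i \<subseteq> \<omega> \<longleftrightarrow> i \<in> r) \<and> Q (\<omega> \<inter> B) then config_weight (fw \<sigma>) (\<lambda>_. 1 - p) E \<omega> else 0)
        = (\<Prod>e\<in>B. fw \<sigma> e + y) * (\<Prod>i<M. path_weight r i \<sigma>)" .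
  qed
  also have "\<dots> = (\<Sum>\<sigma>\<in>(W \<union> (\<Union>i<M. pv i ` {1..l - 1})) \<rightarrow>\<^sub>E {1..q}.
      (\<Prod>e\<in>B. fw (restrict \<sigma> W) e + y) * (\<Prod>i<M. path_weight r i \<sigma>))"
  proof -
    have "(\<Prod>e\<in>B. fw (restrict \<sigma> W) e + y) = (\<Prod>e\<in>B. fw \<sigma> e + y)" for \<sigma>
    proof (intro prod.cong refl)
      fix e assume "e \<in> B"
      then have "e \<subseteq> W" using B_edge by simp
      then have "restrict \<sigma> W u = \<sigma> u" if "u \<in> e" for u using that by auto
      then show "fw (restrict \<sigma> W) e + y = fw \<sigma> e + y" by (simp add: fw_def)
    qed
    then show ?thesis unfolding colourings_def V_eq[symmetric] by simp
  qed
  also have "\<dots> = (\<Sum>\<rho>\<in>W \<rightarrow>\<^sub>E {1..q}. (\<Prod>e\<in>B. fw \<rho> e + y) * (\<Prod>i<M. end_weight r i \<rho>))"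
    by (rule sum_out_paths[where G = "\<lambda>\<rho>. \<Prod>e\<in>B. fw \<rho> e + y"]) simp
  also have "\<dots> = (\<Sum>\<rho>\<in>W \<rightarrow>\<^sub>E {1..q}. if \<forall>(u, v)\<in>link_rel r. \<rho> u = \<rho> v
      then \<kappa> ^ M * open_weight ^ card r * (\<Prod>e\<in>B. fw \<rho> e + y) else 0)"
    unfolding prod_end_weight[OF r] by (intro sum.cong refl) auto
  also have "\<dots> = (\<Sum>\<rho>\<in>compat W q (link_rel r). \<kappa> ^ M * open_weight ^ card r * (\<Prod>e\<in>B. fw \<rho> e + y))"
    unfolding compat_def colourings_def
    by (rule sum.inter_filter[symmetric]) (use finite_W in \<open>auto intro: finite_PiE\<close>)
  finally show ?thesis by (simp add: sum_distrib_left)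
qed

section \<open>Contracting the trees\<close>

lemma compat_tree_iff:
  assumes \<rho>: "\<rho> \<in> compat W q (edge_rel B)" and w: "w \<in> W"
  shows "\<rho> w = \<rho> (own w)"
  using w
proof (induction w rule: less_induct)
  case (less w)
  show ?case
  proof (cases "w < N")
    case True
    then show ?thesis by (simp add: own_def)
  next
    case False
    then have wN: "N \<le> w" by simp
    note par = par_props[OF less.prems wN]
    have "{par w, w} \<in> B" using less.prems wN by (auto simp: B_def)
    then have "(par w, w) \<in> edge_rel B" by (simp add: edge_rel_def)
    then have "\<rho> (par w) = \<rho> w" using \<rho> by (auto simp: compat_def)
    then show ?thesis using less.IH[OF par(2,1)] par(3) by simp
  qed
qed

text \<open>With all tree edges imposed, every vertex has the colour of its hub, and the link
  between the ends of path i becomes the constraint between \<open>a i\<close> and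
  \<open>b i\<close>.\<close>

lemma card_compat_tree:
  assumes r: "r \<subseteq> {..<M}"
  shows "real (card (compat W q (link_rel r \<union> edge_rel B))) = num r"
proof -
  have own_id: "own v = v" if "v < N" for v using that by (simp add: own_def)
  have "bij_betw (\<lambda>\<rho>. restrict \<rho> {..<N}) (compat W q (link_rel r \<union> edge_rel B)) (compat {..<N} q (rel r))"
  proof (rule bij_betw_byWitness[where f' = "\<lambda>\<tau>. \<lambda>w\<in>W. \<tau> (own w)"])
    show "\<forall>\<rho>\<in>compat W q (link_rel r \<union> edge_rel B). (\<lambda>w\<in>W. restrict \<rho> {..<N} (own w)) = \<rho>"
    proof
      fix \<rho> assume \<rho>: "\<rho> \<in> compat W q (link_rel r \<union> edge_rel B)"
      have t: "\<rho> \<in> compat W q (edge_rel B)" using \<rho> by (auto simp: compat_def)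
      have "\<rho> (own w) = \<rho> w" if "w \<in> W" for w using compat_tree_iff[OF t that] by (rule sym)
      moreover have "\<rho> \<in> extensional W" using \<rho> by (simp add: compat_def colourings_def PiE_def)
      ultimately show "(\<lambda>w\<in>W. restrict \<rho> {..<N} (own w)) = \<rho>"
        using own_less by (auto simp: fun_eq_iff extensional_def restrict_def)
    qed
    show "\<forall>\<tau>\<in>compat {..<N} q (rel r). restrict (\<lambda>w\<in>W. \<tau> (own w)) {..<N} = \<tau>"
    proof
      fix \<tau> assume "\<tau> \<in> compat {..<N} q (rel r)"
      then have "\<tau> \<in> extensional {..<N}" by (simp add: compat_def colourings_def PiE_def)
      then show "restrict (\<lambda>w\<in>W. \<tau> (own w)) {..<N} = \<tau>"
        using hub_in_W own_id by (auto simp: fun_eq_iff extensional_def restrict_def)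
    qed
    show "(\<lambda>\<rho>. restrict \<rho> {..<N}) ` compat W q (link_rel r \<union> edge_rel B) \<subseteq> compat {..<N} q (rel r)"
    proof (intro image_subsetI)
      fix \<rho> assume \<rho>: "\<rho> \<in> compat W q (link_rel r \<union> edge_rel B)"
      have t: "\<rho> \<in> compat W q (edge_rel B)" using \<rho> by (auto simp: compat_def)
      have "\<rho> (a i) = \<rho> (b i)" if i: "i \<in> r" for i
      proof -
        have iM: "i < M" using i r by auto
        have "(pv i 0, pv i l) \<in> link_rel r" using i by (simp add: link_rel_def)
        then have "\<rho> (pv i 0) = \<rho> (pv i l)" using \<rho> by (auto simp: compat_def)
        then show ?thesis
          using compat_tree_iff[OF t pv_in_W(1)[OF iM]] compat_tree_iff[OF t pv_in_W(2)[OF iM]] own_pv[OF iM] by simp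
      qed
      moreover have "\<rho> v \<in> {1..q}" if "v < N" for v
        using \<rho> hub_in_W[OF that] by (auto simp: compat_def colourings_def)
      ultimately show "restrict \<rho> {..<N} \<in> compat {..<N} q (rel r)"
        using ends by (auto simp: compat_def colourings_def rel_def)
    qed
    show "(\<lambda>\<tau>. \<lambda>w\<in>W. \<tau> (own w)) ` compat {..<N} q (rel r) \<subseteq> compat W q (link_rel r \<union> edge_rel B)"
    proof (intro image_subsetI)
      fix \<tau> assume \<tau>: "\<tau> \<in> compat {..<N} q (rel r)"
      let ?\<rho> = "\<lambda>w\<in>W. \<tau> (own w)"
      have "?\<rho> u = ?\<rho> v" if uv: "(u, v) \<in> link_rel r" for u v
      proof -
        obtain i where i: "i \<in> r" "u = pv i 0" "v = pv i l" using uv by (auto simp: link_rel_def)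
        then have iM: "i < M" using r by auto
        have "(a i, b i) \<in> rel r" using i by (auto simp: rel_def)
        then have "\<tau> (a i) = \<tau> (b i)" using \<tau> by (auto simp: compat_def)
        then show ?thesis using pv_in_W[OF iM] own_pv[OF iM] i by simp
      qed
      moreover have "?\<rho> u = ?\<rho> v" if uv: "(u, v) \<in> edge_rel B" for u v
      proof -
        obtain w where w: "w \<in> W" "N \<le> w" "{u, v} = {par w, w}" using uv by (auto simp: edge_rel_def B_def)
        then show ?thesis using par_props[OF w(1,2)] by (auto simp: doubleton_eq_iff)
      qed
      moreover have "?\<rho> \<in> colourings W q"
        using \<tau> own_less by (auto simp: compat_def colourings_def)
      ultimately show "?\<rho> \<in> compat W q (link_rel r \<union> edge_rel B)" by (auto simp: compat_def)
    qed
  qed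
  then show ?thesis unfolding num_def by (simp add: bij_betw_same_card)
qed

definition scale :: real where "scale = p ^ card B * \<kappa> ^ M"

text \<open>Bounds the factor gained by letting tree edges be closed: 1 + t with t = q (1 - p) / p
  for each of them.\<close>

definition tree_cost :: real where "tree_cost = ((p + (1 - p) * real q) / p) ^ card B"

lemma scale_pos: "0 < scale"
  using p_pos \<kappa>_pos by (simp add: scale_def)

lemma link_rel_subset: "r \<subseteq> {..<M} \<Longrightarrow> link_rel r \<subseteq> W \<times> W"
  using pv_in_W by (auto simp: link_rel_def)

lemma open_weight_pos: "0 < open_weight"
  using p_pos \<kappa>_pos by (simp add: open_weight_def)

lemma sum_wt_fibre_ge:
  assumes r: "r \<subseteq> {..<M}"
  shows "scale * rwt open_weight r \<le> (\<Sum>\<omega>\<in>{\<omega> \<in> Pow E. red \<omega> = r}. G.wt \<omega>)"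
proof -
  have "(\<Sum>\<rho>\<in>compat W q (link_rel r). \<Prod>e\<in>B. fw \<rho> e + 0)
      = (\<Sum>\<rho>\<in>compat W q (link_rel r). if \<forall>(u, v)\<in>edge_rel B. \<rho> u = \<rho> v then p ^ card B else 0)"
  proof (intro sum.cong refl)
    fix \<rho>
    show "(\<Prod>e\<in>B. fw \<rho> e + 0) = (if \<forall>(u, v)\<in>edge_rel B. \<rho> u = \<rho> v then p ^ card B else 0)"
    proof (cases "\<forall>(u, v)\<in>edge_rel B. \<rho> u = \<rho> v")
      case True
      have "fw \<rho> e = p" if e: "e \<in> B" for e
      proof -
        obtain u v where uv: "e = {u, v}" using B_edge[OF e] by (auto simp: card_2_iff)
        then have "\<rho> u = \<rho> v" using True e by (auto simp: edge_rel_def)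
        then show ?thesis by (simp add: fw_def uv)
      qed
      then show ?thesis using True by simp
    next
      case False
      then obtain u v where uv: "{u, v} \<in> B" "\<rho> u \<noteq> \<rho> v" by (auto simp: edge_rel_def)
      then have "fw \<rho> {u, v} = 0" by (simp add: fw_def)
      then have "(\<Prod>e\<in>B. fw \<rho> e + 0) = 0"
        using uv(1) finite_B by (intro prod_zero) auto
      then show ?thesis by (simp only: False if_False)
    qed
  qed
  also have "\<dots> = (\<Sum>\<rho>\<in>compat W q (link_rel r \<union> edge_rel B). p ^ card B)"
  proof -
    have "compat W q (link_rel r \<union> edge_rel B) = {\<rho> \<in> compat W q (link_rel r). \<forall>(u, v)\<in>edge_rel B. \<rho> u = \<rho> v}"
      by (auto simp: compat_def)
    then show ?thesis using finite_W by (simp only: sum.inter_filter finite_compat)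
  qed
  also have "\<dots> = p ^ card B * num r" using card_compat_tree[OF r] by simp
  finally have tree: "(\<Sum>\<rho>\<in>compat W q (link_rel r). \<Prod>e\<in>B. fw \<rho> e + 0) = p ^ card B * num r" .
  have "scale * rwt open_weight r = \<kappa> ^ M * open_weight ^ card r * (\<Sum>\<rho>\<in>compat W q (link_rel r). \<Prod>e\<in>B. fw \<rho> e + 0)"
    unfolding tree by (simp add: scale_def rwt_def)
  also have "\<dots> = (\<Sum>\<omega>\<in>{\<omega> \<in> Pow E. red \<omega> = r \<and> B \<subseteq> \<omega> \<inter> B}. G.wt \<omega>)"
    using sum_config_weight_open[OF finite_B] by (intro sum_wt_fibre[symmetric, where Q = "\<lambda>\<omega>. B \<subseteq> \<omega>"] r) simp
  also have "\<dots> \<le> (\<Sum>\<omega>\<in>{\<omega> \<in> Pow E. red \<omega> = r}. G.wt \<omega>)"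
    using G.finite_E G.wt_pos by (intro sum_mono2) (auto intro: less_imp_le)
  finally show ?thesis .
qed

lemma sum_wt_fibre_le:
  assumes r: "r \<subseteq> {..<M}"
  shows "(\<Sum>\<omega>\<in>{\<omega> \<in> Pow E. red \<omega> = r}. G.wt \<omega>) \<le> tree_cost * (scale * rwt open_weight r)"
proof -
  have "(\<Sum>\<omega>\<in>{\<omega> \<in> Pow E. red \<omega> = r}. G.wt \<omega>) = (\<Sum>\<omega>\<in>{\<omega> \<in> Pow E. red \<omega> = r \<and> True}. G.wt \<omega>)" by simp
  also have "\<dots> = \<kappa> ^ M * open_weight ^ card r * (\<Sum>\<rho>\<in>compat W q (link_rel r). \<Prod>e\<in>B. fw \<rho> e + (1 - p))"
    using sum_config_weight[OF finite_B] by (intro sum_wt_fibre[where Q = "\<lambda>_. True"] r) simp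
  also have "\<dots> \<le> \<kappa> ^ M * open_weight ^ card r * ((p + (1 - p) * real q) ^ card B * num r)"
  proof (rule mult_left_mono)
    have "(\<Sum>\<rho>\<in>compat W q (link_rel r). \<Prod>e\<in>B. fw \<rho> e + (1 - p))
        \<le> (p + (1 - p) * real q) ^ card B * real (card (compat W q (link_rel r \<union> edge_rel B)))"
      unfolding fw_def using finite_W q_pos p_pos p_less_1 finite_B B_edge link_rel_subset[OF r]
      by (intro sum_tree_weights_le) auto
    then show "(\<Sum>\<rho>\<in>compat W q (link_rel r). \<Prod>e\<in>B. fw \<rho> e + (1 - p)) \<le> (p + (1 - p) * real q) ^ card B * num r"
      by (simp add: card_compat_tree[OF r])
    show "0 \<le> \<kappa> ^ M * open_weight ^ card r" using \<kappa>_pos open_weight_pos by simp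
  qed
  also have "\<dots> = tree_cost * (scale * rwt open_weight r)"
    using p_pos by (simp add: tree_cost_def scale_def rwt_def power_divide)
  finally show ?thesis .
qed

section \<open>Lifting a bottleneck from the multigraph to the graph\<close>

definition lift :: "nat set set \<Rightarrow> nat set set set" where
  "lift F = {\<omega> \<in> Pow E. red \<omega> \<in> F}"

lemma sum_lift:
  assumes F: "F \<subseteq> Pow {..<M}"
  shows "(\<Sum>\<omega>\<in>lift F. G.wt \<omega>) = (\<Sum>r\<in>F. \<Sum>\<omega>\<in>{\<omega> \<in> Pow E. red \<omega> = r}. G.wt \<omega>)"
proof -
  have fin: "finite F" using F finite_subset by blast
  have "(\<Sum>r\<in>F. \<Sum>\<omega>\<in>{\<omega> \<in> lift F. red \<omega> = r}. G.wt \<omega>) = (\<Sum>\<omega>\<in>lift F. G.wt \<omega>)"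
    using fin G.finite_E by (intro sum.group) (auto simp: lift_def)
  moreover have "{\<omega> \<in> lift F. red \<omega> = r} = {\<omega> \<in> Pow E. red \<omega> = r}" if "r \<in> F" for r
    using that by (auto simp: lift_def)
  ultimately show ?thesis by simp
qed

lemma sum_lift_bounds:
  assumes F: "F \<subseteq> Pow {..<M}"
  shows "scale * (\<Sum>r\<in>F. rwt open_weight r) \<le> (\<Sum>\<omega>\<in>lift F. G.wt \<omega>)"
    and "(\<Sum>\<omega>\<in>lift F. G.wt \<omega>) \<le> tree_cost * (scale * (\<Sum>r\<in>F. rwt open_weight r))"
  unfolding sum_lift[OF F] sum_distrib_left
  using F sum_wt_fibre_ge sum_wt_fibre_le by (auto intro!: sum_mono)

lemma lift_all: "lift (Pow {..<M}) = Pow E"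
  by (auto simp: lift_def red_def)

text \<open>Closing an edge can only shrink \<open>red\<close>, and F is down-closed; opening an
  edge completes at most the one path that contains it, as the paths are edge-disjoint.\<close>

lemma lift_boundary:
  assumes F: "\<forall>r\<in>F. \<forall>r'. r' \<subseteq> r \<longrightarrow> r' \<in> F"
  shows "G.edge_boundary (lift F) \<subseteq> lift {r \<in> F. \<exists>i<M. insert i r \<notin> F}"
proof
  fix \<omega> assume "\<omega> \<in> G.edge_boundary (lift F)"
  then obtain e where \<omega>: "\<omega> \<subseteq> E" "red \<omega> \<in> F" and e: "e \<in> E" "insert e \<omega> \<notin> lift F \<or> \<omega> - {e} \<notin> lift F"
    by (auto simp: G.edge_boundary_def lift_def)
  have "red (\<omega> - {e}) \<subseteq> red \<omega>" by (auto simp: red_def)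
  then have "\<omega> - {e} \<in> lift F" using F \<omega> by (auto simp: lift_def)
  then have out: "red (insert e \<omega>) \<notin> F" using e \<omega> by (auto simp: lift_def)
  have "\<exists>i<M. red (insert e \<omega>) \<subseteq> insert i (red \<omega>)"
  proof (cases "\<exists>i<M. e \<in> P i")
    case True
    then obtain i where i: "i < M" "e \<in> P i" by blast
    have "P i' \<subseteq> \<omega>" if "i' < M" "i' \<noteq> i" "P i' \<subseteq> insert e \<omega>" for i'
      using P_disjoint[OF that(1) i(1) that(2)] i(2) that(3) by blast
    then show ?thesis using i(1) by (auto simp: red_def)
  next
    case False
    have "red (insert e \<omega>) = red \<omega>"
      using False by (auto simp: red_def)
    then show ?thesis using out \<omega>(2) by simp
  qed
  then have "\<exists>i<M. insert i (red \<omega>) \<notin> F" using out F by blast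
  then show "\<omega> \<in> lift {r \<in> F. \<exists>i<M. insert i r \<notin> F}" using \<omega> by (simp add: lift_def)
qed

text \<open>Left-hand sides use the upper bound on fibres and right-hand sides the lower one; the
  common factor \<open>scale\<close> cancels and one factor \<open>tree_cost\<close>
  remains.\<close>

lemma lift_bottleneck:
  assumes F: "bottleneck_family M F (rwt open_weight) \<epsilon>" and \<epsilon>: "0 \<le> \<epsilon>"
  shows "lift F \<subseteq> Pow E" "lift F \<noteq> {}"
    and "sum G.wt (G.edge_boundary (lift F)) \<le> tree_cost * \<epsilon> * sum G.wt (lift F)"
    and "sum G.wt (lift F) \<le> tree_cost * \<epsilon> * sum G.wt (Pow E)"
proof -
  let ?bd = "{r \<in> F. \<exists>i<M. insert i r \<notin> F}"
  have F': "F \<subseteq> Pow {..<M}" "{} \<in> F" "\<forall>r\<in>F. \<forall>r'. r' \<subseteq> r \<longrightarrow> r' \<in> F"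
    "(\<Sum>r\<in>?bd. rwt open_weight r) \<le> \<epsilon> * (\<Sum>r\<in>F. rwt open_weight r)"
    "(\<Sum>r\<in>F. rwt open_weight r) \<le> \<epsilon> * (\<Sum>r\<in>Pow {..<M}. rwt open_weight r)"
    using F by (auto simp: bottleneck_family_def)
  have tc: "0 \<le> tree_cost" using p_pos p_less_1 by (simp add: tree_cost_def)
  have fin: "finite (lift S)" for S using G.finite_E by (simp add: lift_def)
  show "lift F \<subseteq> Pow E" by (auto simp: lift_def)
  have "0 \<in> {..<l}" using l by simp
  then have "P i \<noteq> {}" for i unfolding P_def by blast
  then have "red {} = {}" by (simp add: red_def)
  then have "{} \<in> lift F" using F'(2) by (simp add: lift_def)
  then show "lift F \<noteq> {}" by blast
  have "sum G.wt (G.edge_boundary (lift F)) \<le> sum G.wt (lift ?bd)"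
  proof (rule sum_mono2[OF fin lift_boundary[OF F'(3)]])
    fix \<omega> assume "\<omega> \<in> lift ?bd - G.edge_boundary (lift F)"
    then show "0 \<le> G.wt \<omega>" using G.wt_pos[of \<omega>] by (simp add: lift_def less_imp_le)
  qed
  also have "\<dots> \<le> tree_cost * (scale * (\<Sum>r\<in>?bd. rwt open_weight r))"
    using F'(1) by (intro sum_lift_bounds) auto
  also have "\<dots> \<le> tree_cost * (scale * (\<epsilon> * (\<Sum>r\<in>F. rwt open_weight r)))"
    using F'(4) tc scale_pos by (intro mult_left_mono) auto
  also have "\<dots> = tree_cost * \<epsilon> * (scale * (\<Sum>r\<in>F. rwt open_weight r))" by simp
  also have "\<dots> \<le> tree_cost * \<epsilon> * sum G.wt (lift F)"
    using sum_lift_bounds(1)[OF F'(1)] tc \<epsilon> by (intro mult_left_mono) auto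
  finally show "sum G.wt (G.edge_boundary (lift F)) \<le> tree_cost * \<epsilon> * sum G.wt (lift F)" .
  have "sum G.wt (lift F) \<le> tree_cost * (scale * (\<Sum>r\<in>F. rwt open_weight r))"
    using F'(1) by (intro sum_lift_bounds)
  also have "\<dots> \<le> tree_cost * (scale * (\<epsilon> * (\<Sum>r\<in>Pow {..<M}. rwt open_weight r)))"
    using F'(5) tc scale_pos by (intro mult_left_mono) auto
  also have "\<dots> = tree_cost * \<epsilon> * (scale * (\<Sum>r\<in>Pow {..<M}. rwt open_weight r))" by simp
  also have "\<dots> \<le> tree_cost * \<epsilon> * sum G.wt (Pow E)"
    using sum_lift_bounds(1)[of "Pow {..<M}"] tc \<epsilon> unfolding lift_all by (intro mult_left_mono) auto
  finally show "sum G.wt (lift F) \<le> tree_cost * \<epsilon> * sum G.wt (Pow E)" .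
qed

end

section \<open>Slow mixing\<close>

context weighted_blowup
begin

text \<open>The escape bounds solved for k. For Swendsen--Wang the length of a sweep is at most 2 n,
  and the - 1 comes from the additional sweep in \<open>sw_bottleneck\<close>.\<close>

lemma mixing_times_ge:
  assumes F: "bottleneck_family M F (rwt open_weight) \<epsilon>" and \<epsilon>: "0 \<le> \<epsilon>"
    and \<delta>: "tree_cost * \<epsilon> \<le> \<delta>" "0 < \<delta>" "\<delta> \<le> 1 / 2"
  shows "ereal (1 / (4 * \<delta>)) \<le> ereal_of_enat (fk_mixing_time V E p (real q))"
    and "ereal (1 / (8 * real n * \<delta>) - 1) \<le> ereal_of_enat (sw_mixing_time V E p q)"
proof -
  let ?A = "lift F"
  let ?S = "sum G.wt ?A" and ?B = "sum G.wt (G.edge_boundary ?A)" and ?Z = "sum G.wt (Pow E)"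
  note A = lift_bottleneck[OF F \<epsilon>]
  have pos: "0 < ?S"
    using A(1,2) G.finite_E G.wt_pos by (intro sum_pos) (auto intro: finite_subset)
  have bd: "?B \<le> \<delta> * ?S"
    using A(3) mult_right_mono[OF \<delta>(1), of ?S] pos by linarith
  have "?S \<le> \<delta> * ?Z"
    using A(4) mult_right_mono[OF \<delta>(1), of ?Z] G.Z_pos by linarith
  moreover have "\<delta> * ?Z \<le> 1 / 2 * ?Z" using \<delta>(3) G.Z_pos by (intro mult_right_mono) auto
  ultimately have half: "2 * ?S \<le> ?Z" by linarith
  show "ereal (1 / (4 * \<delta>)) \<le> ereal_of_enat (fk_mixing_time V E p (real q))"
    unfolding fk_mixing_time_def
  proof (rule mixing_time_ge)
    fix k assume "\<And>x. x \<in> Pow E \<Longrightarrow> tv_dist (law_after (fk_step V E p (real q)) k x) (random_cluster V E p (real q)) \<le> 1 / 4"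
    then have "?S \<le> 4 * real k * ?B" by (intro G.fk_bottleneck A half)
    also have "\<dots> \<le> 4 * real k * (\<delta> * ?S)" using bd by (intro mult_left_mono) auto
    finally have "1 * ?S \<le> (4 * real k * \<delta>) * ?S" by simp
    then have "1 \<le> 4 * real k * \<delta>" using pos by (rule mult_right_le_imp_le)
    then show "1 / (4 * \<delta>) \<le> real k" using \<delta>(2) by (simp add: pos_divide_le_eq mult_ac)
  qed
  show "ereal (1 / (8 * real n * \<delta>) - 1) \<le> ereal_of_enat (sw_mixing_time V E p q)"
    unfolding sw_mixing_time_def
  proof (rule mixing_time_ge)
    fix k assume "\<And>x. x \<in> colourings V q \<Longrightarrow> tv_dist (law_after (sw_step V E p q) k x) (potts V E (- ln (1 - p)) q) \<le> 1 / 4"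
    then have "?S \<le> 4 * real (Suc k) * real (card E) * ?B" by (intro G.sw_bottleneck A half)
    also have "\<dots> \<le> 4 * real (Suc k) * real (card E) * (\<delta> * ?S)" using bd by (intro mult_left_mono) auto
    also have "\<dots> \<le> 4 * real (Suc k) * (2 * real n) * (\<delta> * ?S)"
      using card_E_le \<delta>(2) pos by (intro mult_right_mono mult_left_mono) auto
    finally have "1 * ?S \<le> (real (Suc k) * (8 * real n * \<delta>)) * ?S" by (simp add: mult_ac)
    then have "1 \<le> real (Suc k) * (8 * real n * \<delta>)" using pos by (rule mult_right_le_imp_le)
    moreover have "0 < 8 * real n * \<delta>" using \<delta>(2) n N_pos by simp
    ultimately have "1 / (8 * real n * \<delta>) \<le> real (Suc k)" by (simp add: pos_divide_le_eq)
    then show "1 / (8 * real n * \<delta>) - 1 \<le> real k" by simp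
  qed
qed

end

text \<open>Stands in for the finitely many n at which no slow graph is obtained, where maximum
  degree \<Delta> is still required.\<close>

definition star :: "nat \<Rightarrow> nat set set" where
  "star \<Delta> = (\<lambda>i. {0, i}) ` {1..\<Delta>}"

lemma star_props:
  assumes "0 < \<Delta>" "\<Delta> < n"
  shows "simple_graph {..<n} (star \<Delta>)" "max_degree {..<n} (star \<Delta>) = \<Delta>"
proof -
  show "simple_graph {..<n} (star \<Delta>)"
    using assms by (auto simp: simple_graph_def star_def)
  have inj: "inj_on (\<lambda>i. {0, i}) {1..\<Delta>}" by (rule inj_onI) (auto simp: doubleton_eq_iff)
  have card_star: "card (star \<Delta>) = \<Delta>" unfolding star_def card_image[OF inj] by simp
  have "{e \<in> star \<Delta>. 0 \<in> e} = star \<Delta>" by (auto simp: star_def)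
  then have centre: "vertex_degree (star \<Delta>) 0 = \<Delta>"
    by (simp add: vertex_degree_def card_star)
  have "vertex_degree (star \<Delta>) v \<le> \<Delta>" for v
  proof -
    have "card {e \<in> star \<Delta>. v \<in> e} \<le> card (star \<Delta>)" by (intro card_mono) (auto simp: star_def)
    then show ?thesis by (simp add: vertex_degree_def card_star)
  qed
  then show "max_degree {..<n} (star \<Delta>) = \<Delta>"
    unfolding max_degree_def using centre assms
    by (intro Max_eqI) (auto intro!: image_eqI[of _ _ 0])
qed

text \<open>With \<open>p = q / (q + u - 1)\<close> a closed edge costs exactly the factor \<open>u - 1\<close> when the gain of one
  component is included, and a path of length \<open>l\<close> acts as an edge of weight \<open>q / (u ^ l - 1)\<close>.\<close>
lemma slow_mixing_graph:
  fixes q \<Delta> l D N n :: nat and w c u p :: real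
  assumes q: "3 \<le> q" and \<Delta>: "3 \<le> \<Delta>" and l: "2 \<le> l" and w: "0 < w"
    and u: "1 < u" "u ^ l = 1 + real q / w" and p: "p = real q / (real q + u - 1)"
    and n: "N * (1 + D * (l + 1)) + \<Delta> \<le> n"
    and F: "edge_list N q a b" "bottleneck_family (D * N) F (edge_list.rwt N q a b w) (exp (- (c * real N)))"
    and \<delta>: "u ^ (2 * (D * N) + (n - N * (1 + D * (l + 1)))) * exp (- (c * real N)) \<le> \<delta>" "0 < \<delta>" "\<delta> \<le> 1 / 2"
  shows "\<exists>E. simple_graph {..<n} E \<and> max_degree {..<n} E = \<Delta> \<and>
    ereal (1 / (4 * \<delta>)) \<le> ereal_of_enat (fk_mixing_time {..<n} E p (real q)) \<and>
    ereal (1 / (8 * real n * \<delta>) - 1) \<le> ereal_of_enat (sw_mixing_time {..<n} E p q)"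
proof -
  interpret edge_list N q a b by (rule F(1))
  have p01: "0 < p" "p < 1" using u(1) q unfolding p by (auto simp: pos_divide_less_eq)
  have n': "N + D * N * (l + 1) + \<Delta> \<le> n" using n by (simp add: algebra_simps)
  interpret weighted_blowup N q a b "D * N" l \<Delta> n p
    by unfold_locales (use l \<Delta> n' p01 in auto)
  have ratio: "p + (1 - p) * real q = u * p"
  proof -
    define d where "d = real q + u - 1"
    have d: "d \<noteq> 0" using u(1) q by (simp add: d_def)
    have pd: "p = real q / d" by (simp add: p d_def)
    have "1 - p = (d - real q) / d" using d by (simp add: pd diff_divide_distrib)
    then have "p + (1 - p) * real q = (real q + (u - 1) * real q) / d"
      by (simp add: pd d_def add_divide_distrib)
    also have "\<dots> = u * p" by (simp add: pd algebra_simps)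
    finally show ?thesis .
  qed
  have \<kappa>: "\<kappa> = p ^ l / w"
    unfolding \<kappa>_def ratio power_mult_distrib u(2) using w q by (simp add: field_simps)
  have ow: "open_weight = w" unfolding open_weight_def \<kappa> using w p01 by simp
  have tc: "tree_cost = u ^ card B" unfolding tree_cost_def ratio using p01 by simp
  have base: "base = N * (1 + D * (l + 1))" by (simp add: base_def algebra_simps)
  have "u ^ card B \<le> u ^ (2 * (D * N) + (n - N * (1 + D * (l + 1))))"
    using u(1) card_B_le by (intro power_increasing) (auto simp: base)
  then have "tree_cost * exp (- (c * real N)) \<le> u ^ (2 * (D * N) + (n - N * (1 + D * (l + 1)))) * exp (- (c * real N))"
    unfolding tc by (intro mult_right_mono) auto
  then have "tree_cost * exp (- (c * real N)) \<le> \<delta>" using \<delta>(1) by linarith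
  note mix = mixing_times_ge[OF F(2)[folded ow] _ this \<delta>(2,3)]
  show ?thesis
    by (intro exI[of _ E] conjI simple_graph_E max_degree_E mix) auto
qed

theorem theorem1p8:
  fixes \<Delta> q :: nat and p\<^sub>0 :: real
  assumes "3 \<le> \<Delta>" and "3 \<le> q" and "p\<^sub>0 < 1"
  shows "\<exists>(p::real) (V :: nat \<Rightarrow> nat set) (E :: nat \<Rightarrow> nat set set).
           p\<^sub>0 < p \<and> 0 < p \<and> p < 1 \<and>
           (\<forall>n>\<Delta>. simple_graph (V n) (E n) \<and> card (V n) = n \<and> max_degree (V n) (E n) = \<Delta>) \<and>
           exp_Omega (\<lambda>n. sw_mixing_time (V n) (E n) p q) \<and>
           exp_Omega (\<lambda>n. fk_mixing_time (V n) (E n) p (real q))"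
proof -
  obtain D :: nat and w c :: real where D: "0 < D" and w: "0 < w" and c: "0 < c" and
    ev: "\<forall>\<^sub>F N in sequentially. \<exists>a b F. edge_list N q a b \<and>
       bottleneck_family (D * N) F (edge_list.rwt N q a b w) (exp (- (c * real N)))"
    using exists_reduced_bottleneck[OF assms(2)] by blast
  \<comment> \<open>The length l will enter through u = exp (h / l), so that u^l = 1 + q / w and the
    paths have the same effective weight w for every l.\<close>
  define h where "h = ln (1 + real q / w)"
  have qw: "0 < real q / w" using w assms(2) by simp
  have h: "0 < h" using qw by (simp add: h_def)
  have "((\<lambda>l. real q / (real q + exp (h / real l) - 1)) \<longlongrightarrow> 1) sequentially"
    using assms(2) by real_asymp
  then have "\<forall>\<^sub>F l in sequentially. p\<^sub>0 < real q / (real q + exp (h / real l) - 1)"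
    using assms(3) by (rule order_tendstoD)
  \<comment> \<open>The tree edges at path ends, at most 2 D N of them, cost a factor of at most exp
    (2 D N h / l), to be kept below exp (c N / 4).\<close>
  moreover have "\<forall>\<^sub>F l in sequentially. h / real l * (2 * real D) < c / 4"
  proof -
    have "((\<lambda>l. h / real l * (2 * real D)) \<longlongrightarrow> 0) sequentially" by real_asymp
    then show ?thesis using c by (intro order_tendstoD) auto
  qed
  moreover have "\<forall>\<^sub>F l in sequentially. 2 \<le> l" by (rule eventually_ge_at_top)
  ultimately have "\<forall>\<^sub>F l in sequentially. p\<^sub>0 < real q / (real q + exp (h / real l) - 1) \<and>
      h / real l * (2 * real D) < c / 4 \<and> 2 \<le> l" by eventually_elim auto
  then obtain l where l: "p\<^sub>0 < real q / (real q + exp (h / real l) - 1)"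
    "h / real l * (2 * real D) < c / 4" "2 \<le> l"
    using eventually_happens'[OF sequentially_bot] by blast
  define u where "u = exp (h / real l)"
  define p where "p = real q / (real q + u - 1)"
  have u: "1 < u" using h l by (simp add: u_def)
  have ul: "u ^ l = 1 + real q / w"
  proof -
    have "u ^ l = exp h" using l by (simp add: u_def flip: exp_of_nat_mult)
    then show ?thesis using qw by (simp add: h_def)
  qed
  have p: "0 < p" "p < 1" using u assms(2) by (auto simp: p_def pos_divide_less_eq)
  \<comment> \<open>Vertices of the graph per vertex of the multigraph: the hub and D paths with l +
    1 vertices each.\<close>
  define L where "L = 1 + D * (l + 1)"
  have L: "0 < L" by (simp add: L_def)
  \<comment> \<open>The at most L + \<Delta> vertices left over become tree vertices and cost at
    most a factor u each.\<close>
  define C where "C = u ^ (L + \<Delta>)"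
  have C: "0 < C" using u by (simp add: C_def)
  \<comment> \<open>From n <= 2 N L follows 6 r n <= 3 c N / 4, the rate left after the trees; the
    surplus of 6 r over r takes care of the constants and of the factor n.\<close>
  define r where "r = c / (16 * real L)"
  have r: "0 < r" using c L by (simp add: r_def)
  define \<delta> where "\<delta> n = C * exp (- (6 * r * real n))" for n
  have \<delta>_pos: "0 < \<delta> n" for n using C by (simp add: \<delta>_def)
  define N where "N n = (n - \<Delta>) div L" for n
  have N_top: "filterlim N at_top sequentially"
    unfolding filterlim_at_top
  proof
    fix Z
    show "\<forall>\<^sub>F n in sequentially. Z \<le> N n"
      using eventually_ge_at_top[of "Z * L + \<Delta>"]
    proof (rule eventually_mono)
      fix n assume "Z * L + \<Delta> \<le> n"
      then have "Z * L \<le> n - \<Delta>" by simp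
      then show "Z \<le> N n" using L by (simp add: N_def less_eq_div_iff_mult_less_eq)
    qed
  qed
  define good where "good n E \<longleftrightarrow> simple_graph {..<n} E \<and> max_degree {..<n} E = \<Delta> \<and>
    ereal (1 / (4 * \<delta> n)) \<le> ereal_of_enat (fk_mixing_time {..<n} E p (real q)) \<and>
    ereal (1 / (8 * real n * \<delta> n) - 1) \<le> ereal_of_enat (sw_mixing_time {..<n} E p q)" for n E
  have "\<forall>\<^sub>F n in sequentially. \<delta> n < 1 / 2"
  proof -
    have "(\<delta> \<longlongrightarrow> 0) sequentially" unfolding \<delta>_def using r by real_asymp
    then show ?thesis by (rule order_tendstoD) simp
  qed
  moreover have "\<forall>\<^sub>F n in sequentially. 2 * (L + \<Delta>) \<le> n" by (rule eventually_ge_at_top)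
  moreover have "\<forall>\<^sub>F n in sequentially. \<exists>a b F. edge_list (N n) q a b \<and>
       bottleneck_family (D * N n) F (edge_list.rwt (N n) q a b w) (exp (- (c * real (N n))))"
    using eventually_compose_filterlim[OF ev N_top] by simp
  ultimately have ev_good: "\<forall>\<^sub>F n in sequentially. \<exists>E. good n E"
  proof eventually_elim
    case (elim n)
    obtain a b F where F: "edge_list (N n) q a b"
      "bottleneck_family (D * N n) F (edge_list.rwt (N n) q a b w) (exp (- (c * real (N n))))"
      using elim(3) by blast
    have gen: "y + \<Delta> \<le> n \<and> n - y \<le> L + \<Delta> \<and> n \<le> 2 * y"
      if "y + m = n - \<Delta>" "m < L" "2 * (L + \<Delta>) \<le> n" for y m
      using that by auto
    have "N n * L + (n - \<Delta>) mod L = n - \<Delta>" by (simp add: N_def)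
    from gen[OF this mod_less_divisor[OF L] elim(2)]
    have NL: "N n * L + \<Delta> \<le> n" "n - N n * L \<le> L + \<Delta>" "n \<le> 2 * (N n * L)" by simp_all
    have "real n \<le> 2 * (real (N n) * real L)"
    proof -
      have "real n \<le> real (2 * (N n * L))" using NL(3) by (simp only: of_nat_le_iff)
      then show ?thesis by simp
    qed
    then have Nn: "6 * r * real n \<le> 3 / 4 * (c * real (N n))"
    proof -
      assume le: "real n \<le> 2 * (real (N n) * real L)"
      have "6 * r * real n \<le> 6 * r * (2 * (real (N n) * real L))" using le r by (intro mult_left_mono) auto
      also have "\<dots> = 3 / 4 * (c * real (N n))" using L by (simp add: r_def)
      finally show ?thesis .
    qed
    have "u ^ (2 * (D * N n) + (n - N n * (1 + D * (l + 1)))) * exp (- (c * real (N n))) \<le> \<delta> n"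
    proof -
      have "u ^ (2 * (D * N n) + (n - N n * (1 + D * (l + 1)))) \<le> u ^ (2 * (D * N n) + (L + \<Delta>))"
        using u NL(2) by (intro power_increasing) (auto simp: L_def)
      also have "\<dots> = C * exp (h / real l * (2 * real D) * real (N n))"
      proof -
        have "u ^ (2 * (D * N n)) = exp (real (2 * (D * N n)) * (h / real l))"
          unfolding u_def by (rule exp_of_nat_mult[symmetric])
        also have "real (2 * (D * N n)) * (h / real l) = h / real l * (2 * real D) * real (N n)" by simp
        finally show ?thesis by (simp add: power_add C_def)
      qed
      also have "\<dots> \<le> C * exp (c / 4 * real (N n))"
      proof -
        have "h / real l * (2 * real D) * real (N n) \<le> c / 4 * real (N n)"
          using l(2) by (intro mult_right_mono) auto
        then show ?thesis using C by (intro mult_left_mono) auto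
      qed
      finally have "u ^ (2 * (D * N n) + (n - N n * (1 + D * (l + 1)))) * exp (- (c * real (N n)))
          \<le> C * exp (c / 4 * real (N n)) * exp (- (c * real (N n)))"
        by (intro mult_right_mono) auto
      also have "\<dots> = C * exp (- (3 / 4 * (c * real (N n))))"
        by (simp add: mult.assoc flip: exp_add)
      also have "\<dots> \<le> \<delta> n" unfolding \<delta>_def using Nn C by (intro mult_left_mono) auto
      finally show ?thesis .
    qed
    then show "\<exists>E. good n E"
      unfolding good_def using elim(1) NL(1) \<delta>_pos[of n] p_def
      by (intro slow_mixing_graph[OF assms(2,1) l(3) w u ul _ _ F]) (auto simp: L_def)
  qed
  define E where "E n = (if \<exists>E. good n E then SOME E. good n E else star \<Delta>)" for n
  have E_good: "good n (E n)" if "\<exists>E. good n E" for n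
    using someI_ex[OF that] that by (simp add: E_def)
  have graph: "simple_graph {..<n} (E n) \<and> max_degree {..<n} (E n) = \<Delta>" if "\<Delta> < n" for n
  proof (cases "\<exists>E. good n E")
    case True
    then show ?thesis using E_good[OF True] by (simp add: good_def)
  next
    case False
    then show ?thesis using star_props[of \<Delta> n] that assms(1) by (simp add: E_def)
  qed
  have "exp_Omega (\<lambda>n. fk_mixing_time {..<n} (E n) p (real q))"
    unfolding exp_Omega_def
  proof (intro exI[of _ r] conjI r)
    have "\<forall>\<^sub>F n in sequentially. exp (r * real n) \<le> 1 / (4 * \<delta> n)"
      unfolding \<delta>_def using r C by real_asymp
    with ev_good show "\<forall>\<^sub>F n in sequentially. ereal (exp (r * real n))
        \<le> ereal_of_enat (fk_mixing_time {..<n} (E n) p (real q))"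
    proof eventually_elim
      case (elim n)
      then have "ereal (exp (r * real n)) \<le> ereal (1 / (4 * \<delta> n))" by simp
      also have "\<dots> \<le> ereal_of_enat (fk_mixing_time {..<n} (E n) p (real q))"
        using E_good[OF elim(1)] by (simp add: good_def)
      finally show ?case .
    qed
  qed
  moreover have "exp_Omega (\<lambda>n. sw_mixing_time {..<n} (E n) p q)"
    unfolding exp_Omega_def
  proof (intro exI[of _ r] conjI r)
    have "\<forall>\<^sub>F n in sequentially. exp (r * real n) \<le> 1 / (8 * real n * \<delta> n) - 1"
      unfolding \<delta>_def using r C by real_asymp
    with ev_good show "\<forall>\<^sub>F n in sequentially. ereal (exp (r * real n))
        \<le> ereal_of_enat (sw_mixing_time {..<n} (E n) p q)"
    proof eventually_elim
      case (elim n)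
      then have "ereal (exp (r * real n)) \<le> ereal (1 / (8 * real n * \<delta> n) - 1)" by simp
      also have "\<dots> \<le> ereal_of_enat (sw_mixing_time {..<n} (E n) p q)"
        using E_good[OF elim(1)] by (simp add: good_def)
      finally show ?case .
    qed
  qed
  ultimately show ?thesis
    using graph p l(1) by (intro exI[of _ p] exI[of _ "\<lambda>n. {..<n}"] exI[of _ E]) (auto simp: p_def u_def)
qed

end
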